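(* Let $(M_1,\mathcal{F}_1,g_1)$ and $(M_2,\mathcal{F}_2,g_2)$ be smooth compact connected foliated Riemannian manifolds of dimension $n$ with nonempty boundary and with foliations of codimension $q$. Let $S_i\subset\partial M_i$ be a nonempty union of boundary components ($i=1,2$), let $\phi:S_1\to S_2$ be an isometry mapping leaves (of the induced foliation of $S_1$) to leaves (of the induced foliation of $S_2$), and suppose that $\mathcal{F}_i$ is $g_i$-orthogonal to $S_i$. Let $M=M_1\cup_\phi M_2$ be formed from $M_1\amalg M_2$ by identifying $x\sim\phi(x)$ ($x\in S_1$), endowed with the induced foliation $\mathcal{F}$ and with a smooth Riemannian metric $g$ satisfying $g|_{M_i}=g_i$. Let $\pi_i:M_i\to\mathrm{HLS}(\mathcal{F}_i)$ be the natural projections and let $(X,d_X)$ be the quotient metric space of $\mathrm{HLS}(\mathcal{F}_1)\amalg\mathrm{HLS}(\mathcal{F}_2)$ by the smallest equivalence relation such that $\pi_1(x)\sim\pi_2(\phi(x))$ for all $x\in S_1$. Then $\mathrm{HLS}(\mathcal{F})$ is isometric to $(X,d_X)$.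
   Context: Hausdorff leaf space: for a compact connected foliated Riemannian manifold $(M,\mathcal{F},g)$ with Riemannian distance $d$ and set of leaves $\mathcal{L}$, put $\mathrm{dist}(L,L')=\inf\{d(x,y):x\in L,\,y\in L'\}$ and $$\rho(L,L')=\inf\Big\{\sum_{i=1}^{n-1}\mathrm{dist}(L_i,L_{i+1})\Big\},$$ the infimum being over all finite sequences of leaves $L_1,\dots,L_n$ with $L_1=L$, $L_n=L'$. Put $L\sim L'$ iff $\rho(L,L')=0$, $\tilde{\mathcal{L}}=\mathcal{L}/_\sim$ and $\tilde\rho([L],[L'])=\rho(L,L')$. The metric space $(\tilde{\mathcal{L}},\tilde\rho)$ is the Hausdorff leaf space $\mathrm{HLS}(\mathcal{F})$; the natural projection $M\to\mathrm{HLS}(\mathcal{F})$ sends $x$ to the class of the leaf through $x$. Disjoint union metric: on $Y_1\amalg Y_2$ the distance is that of $Y_j$ for two points of $Y_j$ and $\infty$ for points of different components. Quotient metric space: for a (possibly infinite-valued) metric space $(Y,d)$ with an equivalence relation $R$, put $d_R(x,y)=\inf\sum_{i=1}^k d(p_i,q_i)$ over all $k$ and all $p_1,q_1,\dots,p_k,q_k\in Y$ with $p_1=x$, $q_k=y$ and $(p_{i+1},q_i)\in R$ for $1\le i<k$; the quotient metric space is obtained by identifying points at $d_R$-distance $0$. *)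

theory Defs
  imports "HOL-Analysis.Analysis"
begin

section \<open>Smooth functions on subsets of Euclidean space\<close>

primrec Ck_on :: "nat \<Rightarrow> ('v::real_normed_vector \<Rightarrow> 'w::real_normed_vector) \<Rightarrow> 'v set \<Rightarrow> bool" where
  "Ck_on 0 f V \<longleftrightarrow> continuous_on V f"
| "Ck_on (Suc k) f V \<longleftrightarrow> (\<forall>z\<in>V. f differentiable (at z)) \<and>
     (\<forall>v. Ck_on k (\<lambda>z. frechet_derivative f (at z) v) V)"

text \<open>Smoothness on an arbitrary set: locally, the function extends to a smooth function on an open set.\<close>

definition smooth_fun_on :: "('v::real_normed_vector) set \<Rightarrow> ('v \<Rightarrow> 'w::real_normed_vector) \<Rightarrow> bool" where
  "smooth_fun_on A f \<longleftrightarrow> (\<forall>z\<in>A. \<exists>V F. open V \<and> z \<in> V \<and> (\<forall>k. Ck_on k F V) \<and> (\<forall>w\<in>A \<inter> V. F w = f w))"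


section \<open>Charts and atlases\<close>

text \<open>A chart is a domain together with a coordinate map; the values of the map outside the domain
  are irrelevant.\<close>

type_synonym ('a, 'n) chart = "'a set \<times> ('a \<Rightarrow> real ^ 'n)"

abbreviation cdom :: "('a, 'n::finite) chart \<Rightarrow> 'a set" where "cdom c \<equiv> fst c"
abbreviation cmap :: "('a, 'n::finite) chart \<Rightarrow> 'a \<Rightarrow> real ^ 'n" where "cmap c \<equiv> snd c"

definition half_space :: "'n \<Rightarrow> (real ^ 'n::finite) set" where
  "half_space i = {z. 0 \<le> z $ i}"

text \<open>Any coordinate may be the one that is nonnegative. For foliated charts this makes a difference:
  the boundary is transverse or tangent to the foliation according to whether that coordinate is a
  leaf coordinate or a transverse coordinate.\<close>

definition is_chart :: "'a topology \<Rightarrow> ('a, 'n::finite) chart \<Rightarrow> bool" where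
  "is_chart X c \<longleftrightarrow>
     openin X (cdom c) \<and>
     homeomorphic_map (subtopology X (cdom c)) (top_of_set (cmap c ` cdom c)) (cmap c) \<and>
     (open (cmap c ` cdom c) \<or> (\<exists>i. openin (top_of_set (half_space i)) (cmap c ` cdom c)))"

definition is_atlas :: "'a topology \<Rightarrow> ('a, 'n::finite) chart set \<Rightarrow> bool" where
  "is_atlas X A \<longleftrightarrow> (\<forall>c\<in>A. is_chart X c) \<and> topspace X = (\<Union>c\<in>A. cdom c)"

text \<open>The restriction to \<open>S\<close> of a map \<open>f\<close>, in the charts \<open>c\<close> (source) and \<open>d\<close> (target).\<close>

definition local_rep :: "('a, 'n::finite) chart \<Rightarrow> ('b, 'm::finite) chart \<Rightarrow> ('a \<Rightarrow> 'b) \<Rightarrow> real ^ 'n \<Rightarrow> real ^ 'm" where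
  "local_rep c d f = cmap d \<circ> f \<circ> inv_into (cdom c) (cmap c)"

definition local_dom :: "'a set \<Rightarrow> ('a, 'n::finite) chart \<Rightarrow> ('b, 'm::finite) chart \<Rightarrow> ('a \<Rightarrow> 'b) \<Rightarrow> (real ^ 'n) set" where
  "local_dom S c d f = cmap c ` {x \<in> cdom c \<inter> S. f x \<in> cdom d}"


section \<open>Foliated Riemannian manifolds with boundary\<close>

text \<open>The metric tensor is given by its coordinate expressions: \<open>rmetric M c x u v\<close> is the inner
  product of the tangent vectors at \<open>x\<close> whose components in the chart \<open>c\<close> are \<open>u\<close> and \<open>v\<close>.
  Neither \<open>atlas\<close> (the smooth structure) nor \<open>fol_atlas\<close> (the foliated charts) needs to be maximal.\<close>

record ('a, 'n::finite) fol_mfd =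
  mtop :: "'a topology"
  atlas :: "('a, 'n) chart set"
  rmetric :: "('a, 'n) chart \<Rightarrow> 'a \<Rightarrow> real ^ 'n \<Rightarrow> real ^ 'n \<Rightarrow> real"
  fol_atlas :: "('a, 'n) chart set"

abbreviation mspace :: "('a, 'n::finite) fol_mfd \<Rightarrow> 'a set" where "mspace M \<equiv> topspace (mtop M)"

definition smooth_map :: "('a, 'n::finite) fol_mfd \<Rightarrow> 'a set \<Rightarrow> ('b, 'm::finite) fol_mfd \<Rightarrow> ('a \<Rightarrow> 'b) \<Rightarrow> bool" where
  "smooth_map M S N f \<longleftrightarrow>
     continuous_map (subtopology (mtop M) S) (mtop N) f \<and>
     (\<forall>c\<in>atlas M. \<forall>d\<in>atlas N. smooth_fun_on (local_dom S c d f) (local_rep c d f))"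

text \<open>The differential of \<open>f\<close>, restricted to \<open>S\<close>, preserves inner products of the vectors in \<open>T c x\<close>,
  the (coordinate) tangent space of \<open>S\<close> at \<open>x\<close>. If \<open>S\<close> is part of the boundary, the derivative
  \<open>D\<close> is determined only on this tangent space.\<close>

definition preserves_rmetric ::
  "('a, 'n::finite) fol_mfd \<Rightarrow> 'a set \<Rightarrow> (('a, 'n) chart \<Rightarrow> 'a \<Rightarrow> (real ^ 'n) set) \<Rightarrow>
   ('b, 'm::finite) fol_mfd \<Rightarrow> ('a \<Rightarrow> 'b) \<Rightarrow> bool" where
  "preserves_rmetric M S T N f \<longleftrightarrow>
     (\<forall>c\<in>atlas M. \<forall>d\<in>atlas N. \<forall>x\<in>cdom c \<inter> S. f x \<in> cdom d \<longrightarrow>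
       (\<forall>D. (local_rep c d f has_derivative D) (at (cmap c x) within local_dom S c d f) \<longrightarrow>
         (\<forall>u\<in>T c x. \<forall>v\<in>T c x. rmetric N d (f x) (D u) (D v) = rmetric M c x u v)))"

definition riemannian_manifold :: "('a, 'n::finite) fol_mfd \<Rightarrow> bool" where
  "riemannian_manifold M \<longleftrightarrow>
     Hausdorff_space (mtop M) \<and> second_countable (mtop M) \<and>
     is_atlas (mtop M) (atlas M) \<and>
     smooth_map M (mspace M) M id \<and>
     (\<forall>c\<in>atlas M. \<forall>x\<in>cdom c.
        bilinear (rmetric M c x) \<and>
        (\<forall>u v. rmetric M c x u v = rmetric M c x v u) \<and>
        (\<forall>u. u \<noteq> 0 \<longrightarrow> rmetric M c x u u > 0)) \<and>
     (\<forall>c\<in>atlas M. \<forall>u v.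
        smooth_fun_on (cmap c ` cdom c) (\<lambda>z. rmetric M c (inv_into (cdom c) (cmap c) z) u v)) \<and>
     preserves_rmetric M (mspace M) (\<lambda>_ _. UNIV) M id"

text \<open>Foliations of codimension \<open>card Q\<close>: the coordinates with index in \<open>Q\<close> are transverse, the
  remaining ones are the leaf coordinates. In the overlap of two foliated charts, near every point,
  the transverse coordinates of one chart are an injective function of those of the other. This does
  not presuppose any differentiability; a foliation is smooth if its foliated charts belong to the
  smooth structure.\<close>

definition plaque_eq :: "'n set \<Rightarrow> ('a, 'n::finite) chart \<Rightarrow> 'a \<Rightarrow> 'a \<Rightarrow> bool" where
  "plaque_eq Q c x y \<longleftrightarrow> (\<forall>j\<in>Q. cmap c x $ j = cmap c y $ j)"

definition fol_compatible ::
  "'n set \<Rightarrow> 'a topology \<Rightarrow> ('a \<Rightarrow> 'b) \<Rightarrow> ('a, 'n::finite) chart \<Rightarrow> ('b, 'n) chart \<Rightarrow> bool" where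
  "fol_compatible Q X f c d \<longleftrightarrow>
     (\<forall>x\<in>cdom c. f x \<in> cdom d \<longrightarrow>
       (\<exists>W. openin X W \<and> x \<in> W \<and> W \<subseteq> cdom c \<and> f ` W \<subseteq> cdom d \<and>
         (\<forall>y\<in>W. \<forall>y'\<in>W. plaque_eq Q c y y' \<longleftrightarrow> plaque_eq Q d (f y) (f y'))))"

definition foliation :: "'n set \<Rightarrow> ('a, 'n::finite) fol_mfd \<Rightarrow> bool" where
  "foliation Q M \<longleftrightarrow>
     is_atlas (mtop M) (fol_atlas M) \<and>
     (\<forall>c\<in>fol_atlas M. \<forall>d\<in>fol_atlas M. fol_compatible Q (mtop M) id c d)"

definition smooth_foliation :: "'n set \<Rightarrow> ('a, 'n::finite) fol_mfd \<Rightarrow> bool" where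
  "smooth_foliation Q M \<longleftrightarrow> foliation Q M \<and> fol_atlas M \<subseteq> atlas M"

text \<open>Two points are joined by a step if they lie in a common plaque, intersected with \<open>S\<close>; the leaf is
  reached by chains of plaques. For \<open>S = mspace M\<close> these are the leaves of the foliation, and for a
  union \<open>S\<close> of boundary components transverse to it they are the leaves of the foliation
  induced on \<open>S\<close>.\<close>

definition plaque_step :: "'n set \<Rightarrow> ('a, 'n::finite) fol_mfd \<Rightarrow> 'a set \<Rightarrow> 'a \<Rightarrow> 'a \<Rightarrow> bool" where
  "plaque_step Q M S x y \<longleftrightarrow>
     (\<exists>c\<in>fol_atlas M. \<exists>P. connectedin (mtop M) P \<and> P \<subseteq> cdom c \<inter> S \<and> x \<in> P \<and> y \<in> P \<and>
        (\<forall>z\<in>P. plaque_eq Q c x z))"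

definition leaf :: "'n set \<Rightarrow> ('a, 'n::finite) fol_mfd \<Rightarrow> 'a set \<Rightarrow> 'a \<Rightarrow> 'a set" where
  "leaf Q M S x = {y. (plaque_step Q M S)\<^sup>*\<^sup>* x y}"

definition leaves :: "'n set \<Rightarrow> ('a, 'n::finite) fol_mfd \<Rightarrow> 'a set set" where
  "leaves Q M = leaf Q M (mspace M) ` mspace M"


section \<open>The boundary\<close>

definition mboundary :: "('a, 'n::finite) fol_mfd \<Rightarrow> 'a set" where
  "mboundary M = {x. \<exists>c\<in>atlas M. x \<in> cdom c \<and> cmap c x \<notin> interior (cmap c ` cdom c)}"

definition boundary_components_union :: "('a, 'n::finite) fol_mfd \<Rightarrow> 'a set \<Rightarrow> bool" where
  "boundary_components_union M S \<longleftrightarrow>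
     (\<exists>\<C>. \<C> \<subseteq> connected_components_of (subtopology (mtop M) (mboundary M)) \<and> S = \<Union>\<C>)"

text \<open>The tangent space of the boundary at a boundary point \<open>x\<close>, in the chart \<open>c\<close>. Exactly one index
  \<open>i\<close> satisfies the two conditions.\<close>

definition boundary_tangent :: "('a, 'n::finite) chart \<Rightarrow> 'a \<Rightarrow> (real ^ 'n) set" where
  "boundary_tangent c x =
     {u. \<forall>i. openin (top_of_set (half_space i)) (cmap c ` cdom c) \<and> cmap c x $ i = 0 \<longrightarrow> u $ i = 0}"

text \<open>The foliation is orthogonal to \<open>S\<close>: the vectors normal to \<open>S\<close> are tangent to the leaves.\<close>

definition orthogonal_to_boundary :: "'n set \<Rightarrow> ('a, 'n::finite) fol_mfd \<Rightarrow> 'a set \<Rightarrow> bool" where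
  "orthogonal_to_boundary Q M S \<longleftrightarrow>
     (\<forall>x\<in>S. \<forall>c\<in>fol_atlas M. x \<in> cdom c \<longrightarrow>
       (\<forall>u. (\<forall>v\<in>boundary_tangent c x. rmetric M c x u v = 0) \<longrightarrow> (\<forall>j\<in>Q. u $ j = 0)))"

definition boundary_isometry ::
  "('a, 'n::finite) fol_mfd \<Rightarrow> 'a set \<Rightarrow> ('b, 'n) fol_mfd \<Rightarrow> 'b set \<Rightarrow> ('a \<Rightarrow> 'b) \<Rightarrow> bool" where
  "boundary_isometry M S N S' \<phi> \<longleftrightarrow>
     bij_betw \<phi> S S' \<and> smooth_map M S N \<phi> \<and> smooth_map N S' M (inv_into S \<phi>) \<and>
     preserves_rmetric M S boundary_tangent N \<phi>"


section \<open>Riemannian distance\<close>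

definition C1_on_interval :: "('a, 'n::finite) fol_mfd \<Rightarrow> (real \<Rightarrow> 'a) \<Rightarrow> real \<Rightarrow> real \<Rightarrow> bool" where
  "C1_on_interval M \<gamma> a b \<longleftrightarrow>
     (\<forall>c\<in>atlas M. \<exists>v. continuous_on {t\<in>{a..b}. \<gamma> t \<in> cdom c} v \<and>
        (\<forall>t\<in>{a..b}. \<gamma> t \<in> cdom c \<longrightarrow>
           ((cmap c \<circ> \<gamma>) has_vector_derivative v t) (at t within {a..b})))"

text \<open>Unlike in \<^const>\<open>piecewise_C1_differentiable_on\<close>, the curve is \<open>C\<^sup>1\<close> up to the end points
  of each of the closed subintervals, so that its speed is integrable.\<close>

definition piecewise_C1_curve :: "('a, 'n::finite) fol_mfd \<Rightarrow> (real \<Rightarrow> 'a) \<Rightarrow> bool" where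
  "piecewise_C1_curve M \<gamma> \<longleftrightarrow>
     pathin (mtop M) \<gamma> \<and>
     (\<exists>K. finite K \<and>
        (\<forall>a b. 0 \<le> a \<and> a < b \<and> b \<le> 1 \<and> {a<..<b} \<inter> K = {} \<longrightarrow> C1_on_interval M \<gamma> a b))"

definition speed :: "('a, 'n::finite) fol_mfd \<Rightarrow> (real \<Rightarrow> 'a) \<Rightarrow> real \<Rightarrow> real" where
  "speed M \<gamma> t =
     (let c = (SOME c. c \<in> atlas M \<and> \<gamma> t \<in> cdom c);
          v = vector_derivative (cmap c \<circ> \<gamma>) (at t within {0..1})
      in sqrt (rmetric M c (\<gamma> t) v v))"

definition curve_length :: "('a, 'n::finite) fol_mfd \<Rightarrow> (real \<Rightarrow> 'a) \<Rightarrow> real" where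
  "curve_length M \<gamma> = integral {0..1} (speed M \<gamma>)"

definition rdist :: "('a, 'n::finite) fol_mfd \<Rightarrow> 'a \<Rightarrow> 'a \<Rightarrow> real" where
  "rdist M x y = Inf {curve_length M \<gamma> | \<gamma>. piecewise_C1_curve M \<gamma> \<and> \<gamma> 0 = x \<and> \<gamma> 1 = y}"


section \<open>Quotients of metric spaces\<close>

definition zero_dist_rel :: "'y set \<Rightarrow> ('y \<Rightarrow> 'y \<Rightarrow> 'r::zero) \<Rightarrow> ('y \<times> 'y) set" where
  "zero_dist_rel Y d = {(x, y). x \<in> Y \<and> y \<in> Y \<and> d x y = 0}"

definition class_dist :: "('y \<Rightarrow> 'y \<Rightarrow> 'r) \<Rightarrow> 'y set \<Rightarrow> 'y set \<Rightarrow> 'r" where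
  "class_dist d C C' = d (SOME x. x \<in> C) (SOME y. y \<in> C')"

definition least_equiv :: "'y set \<Rightarrow> ('y \<times> 'y) set \<Rightarrow> ('y \<times> 'y) set" where
  "least_equiv Y r = \<Inter>{R. equiv Y R \<and> r \<subseteq> R}"

text \<open>Distances that may be infinite take values in \<^typ>\<open>ereal\<close>.\<close>

definition chain_dist :: "'y set \<Rightarrow> ('y \<Rightarrow> 'y \<Rightarrow> ereal) \<Rightarrow> ('y \<times> 'y) set \<Rightarrow> 'y \<Rightarrow> 'y \<Rightarrow> ereal" where
  "chain_dist Y d R x y =
     Inf {\<Sum>i=1..k. d (p i) (q i) | k p q.
       1 \<le> (k::nat) \<and> (\<forall>i\<in>{1..k}. p i \<in> Y \<and> q i \<in> Y) \<and> p 1 = x \<and> q k = y \<and>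
       (\<forall>i. 1 \<le> i \<and> i < k \<longrightarrow> (p (i + 1), q i) \<in> R)}"

definition quotient_space :: "'y set \<Rightarrow> ('y \<Rightarrow> 'y \<Rightarrow> ereal) \<Rightarrow> ('y \<times> 'y) set \<Rightarrow> 'y set set" where
  "quotient_space Y d R = Y // zero_dist_rel Y (chain_dist Y d R)"

definition quotient_dist ::
  "'y set \<Rightarrow> ('y \<Rightarrow> 'y \<Rightarrow> ereal) \<Rightarrow> ('y \<times> 'y) set \<Rightarrow> 'y set \<Rightarrow> 'y set \<Rightarrow> ereal" where
  "quotient_dist Y d R = class_dist (chain_dist Y d R)"

fun sum_dist :: "('x \<Rightarrow> 'x \<Rightarrow> real) \<Rightarrow> ('y \<Rightarrow> 'y \<Rightarrow> real) \<Rightarrow> 'x + 'y \<Rightarrow> 'x + 'y \<Rightarrow> ereal" where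
  "sum_dist d d' (Inl x) (Inl x') = ereal (d x x')"
| "sum_dist d d' (Inr y) (Inr y') = ereal (d' y y')"
| "sum_dist d d' (Inl x) (Inr y) = \<infinity>"
| "sum_dist d d' (Inr y) (Inl x) = \<infinity>"

definition isometric_spaces ::
  "'x set \<Rightarrow> ('x \<Rightarrow> 'x \<Rightarrow> ereal) \<Rightarrow> 'y set \<Rightarrow> ('y \<Rightarrow> 'y \<Rightarrow> ereal) \<Rightarrow> bool" where
  "isometric_spaces X d Y d' \<longleftrightarrow>
     (\<exists>h. bij_betw h X Y \<and> (\<forall>x\<in>X. \<forall>y\<in>X. d' (h x) (h y) = d x y))"


section \<open>The Hausdorff leaf space\<close>

definition set_dist :: "('a, 'n::finite) fol_mfd \<Rightarrow> 'a set \<Rightarrow> 'a set \<Rightarrow> real" where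
  "set_dist M L L' = Inf {rdist M x y | x y. x \<in> L \<and> y \<in> L'}"

definition leaf_dist :: "'n set \<Rightarrow> ('a, 'n::finite) fol_mfd \<Rightarrow> 'a set \<Rightarrow> 'a set \<Rightarrow> real" where
  "leaf_dist Q M L L' =
     Inf {\<Sum>i=1..<n. set_dist M (l i) (l (i + 1)) | n l.
       1 \<le> (n::nat) \<and> (\<forall>i\<in>{1..n}. l i \<in> leaves Q M) \<and> l 1 = L \<and> l n = L'}"

definition HLS :: "'n set \<Rightarrow> ('a, 'n::finite) fol_mfd \<Rightarrow> 'a set set set" where
  "HLS Q M = leaves Q M // zero_dist_rel (leaves Q M) (leaf_dist Q M)"

definition HLS_dist :: "'n set \<Rightarrow> ('a, 'n::finite) fol_mfd \<Rightarrow> 'a set set \<Rightarrow> 'a set set \<Rightarrow> real" where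
  "HLS_dist Q M = class_dist (leaf_dist Q M)"

definition HLS_proj :: "'n set \<Rightarrow> ('a, 'n::finite) fol_mfd \<Rightarrow> 'a \<Rightarrow> 'a set set" where
  "HLS_proj Q M x = zero_dist_rel (leaves Q M) (leaf_dist Q M) `` {leaf Q M (mspace M) x}"


section \<open>Gluing\<close>

definition plus_topology :: "'a topology \<Rightarrow> 'b topology \<Rightarrow> ('a + 'b) topology" where
  "plus_topology X Y = topology (\<lambda>U. openin X (Inl -` U) \<and> openin Y (Inr -` U))"

lemma openin_plus_topology:
  "openin (plus_topology X Y) U \<longleftrightarrow> openin X (Inl -` U) \<and> openin Y (Inr -` U)"
proof -
  have "istopology (\<lambda>U. openin X (Inl -` U) \<and> openin Y (Inr -` U))"
    unfolding istopology_def by (auto simp: vimage_Int vimage_Union)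
  then show ?thesis
    by (simp add: plus_topology_def)
qed

lemma topspace_plus_topology: "topspace (plus_topology X Y) = topspace X <+> topspace Y"
proof
  show "topspace (plus_topology X Y) \<subseteq> topspace X <+> topspace Y"
  proof
    fix z assume "z \<in> topspace (plus_topology X Y)"
    then obtain U where "openin (plus_topology X Y) U" "z \<in> U"
      by (auto simp: topspace_def)
    then show "z \<in> topspace X <+> topspace Y"
      by (cases z) (auto simp: openin_plus_topology dest!: openin_subset)
  qed
  have "Inl -` (topspace X <+> topspace Y) = topspace X"
    "Inr -` (topspace X <+> topspace Y) = topspace Y"
    by auto
  then have "openin (plus_topology X Y) (topspace X <+> topspace Y)"
    by (simp add: openin_plus_topology)
  then show "topspace X <+> topspace Y \<subseteq> topspace (plus_topology X Y)"
    by (rule openin_subset)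
qed

definition glue_class :: "'a topology \<Rightarrow> 'b topology \<Rightarrow> 'a set \<Rightarrow> ('a \<Rightarrow> 'b) \<Rightarrow> 'a + 'b \<Rightarrow> ('a + 'b) set" where
  "glue_class X Y S \<phi> z =
     least_equiv (topspace X <+> topspace Y) {(Inl x, Inr (\<phi> x)) | x. x \<in> S} `` {z}"

text \<open>\<open>M\<close> restricts to \<open>N\<close> along the inclusion \<open>j\<close>, as a smooth manifold, as a Riemannian manifold
  and as a foliated manifold.\<close>

definition restricts_to ::
  "'n set \<Rightarrow> ('b, 'n::finite) fol_mfd \<Rightarrow> ('a, 'n) fol_mfd \<Rightarrow> ('a \<Rightarrow> 'b) \<Rightarrow> bool" where
  "restricts_to Q M N j \<longleftrightarrow>
     smooth_map N (mspace N) M j \<and>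
     preserves_rmetric N (mspace N) (\<lambda>_ _. UNIV) M j \<and>
     (\<forall>c\<in>fol_atlas N. \<forall>d\<in>fol_atlas M. fol_compatible Q (mtop N) j c d)"

text \<open>The quotient map determines the point set and the topology of \<open>M\<close>. The induced foliation of
  \<open>M\<close> is not required to be smooth across the glued boundary: the given data yield only a
  foliation by topological charts, smooth on either side.\<close>

definition glued_manifold ::
  "'n set \<Rightarrow> ('a, 'n::finite) fol_mfd \<Rightarrow> ('b, 'n) fol_mfd \<Rightarrow> 'a set \<Rightarrow> ('a \<Rightarrow> 'b) \<Rightarrow>
   (('a + 'b) set, 'n) fol_mfd \<Rightarrow> bool" where
  "glued_manifold Q M1 M2 S \<phi> M \<longleftrightarrow>
     quotient_map (plus_topology (mtop M1) (mtop M2)) (mtop M) (glue_class (mtop M1) (mtop M2) S \<phi>) \<and>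
     riemannian_manifold M \<and> foliation Q M \<and>
     restricts_to Q M M1 (\<lambda>x. glue_class (mtop M1) (mtop M2) S \<phi> (Inl x)) \<and>
     restricts_to Q M M2 (\<lambda>x. glue_class (mtop M1) (mtop M2) S \<phi> (Inr x))"

definition HLS_glue_rel ::
  "'n set \<Rightarrow> ('a, 'n::finite) fol_mfd \<Rightarrow> ('b, 'n) fol_mfd \<Rightarrow> 'a set \<Rightarrow> ('a \<Rightarrow> 'b) \<Rightarrow>
   (('a set set + 'b set set) \<times> ('a set set + 'b set set)) set" where
  "HLS_glue_rel Q M1 M2 S \<phi> =
     least_equiv (HLS Q M1 <+> HLS Q M2)
       {(Inl (HLS_proj Q M1 x), Inr (HLS_proj Q M2 (\<phi> x))) | x. x \<in> S}"

end

theory Submission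
  imports Defs
begin

text \<open>
  Let \<open>D\<close> be the leaf distance of \<open>M\<close> and \<open>E\<close> the quotient distance of the two leaf spaces, both viewed
  as functions of pairs of points of \<open>M\<^sub>1 \<amalg> M\<^sub>2\<close>. The inclusions \<open>M\<^sub>i \<rightarrow> M\<close> send leaves into leaves and
  curves to curves of the same length, so \<open>D \<le> E\<close>. For the converse, every point \<open>p\<close> of \<open>M\<close> has a
  neighbourhood each of whose points lies with \<open>p\<close> in a common piece \<open>M\<^sub>i\<close>, because the pieces are closed.
  In a boundary chart of that piece, segments are admissible curves, so near \<open>p\<close> the pseudometric \<open>E\<close> is
  bounded, up to a factor \<open>1 + \<epsilon>\<close>, by the norm of the difference in any chart of \<open>M\<close>. A gauge integral
  argument then bounds \<open>E\<close> by the length of every curve of \<open>M\<close>, no matter how often the curve crosses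
  the glued boundary. Likewise, plaques of \<open>M\<close> near \<open>p\<close> meet each piece in a single plaque, so \<open>E\<close>
  vanishes along the leaves of \<open>M\<close>. Hence \<open>E \<le> D\<close>.
\<close>

section \<open>Quotients of pseudometrics\<close>

text \<open>Both distances are extremal: the leaf distance is the largest pseudometric that lies
  below the Riemannian distance and vanishes along leaves, the quotient distance the largest one
  that lies below the distances of the two leaf spaces and vanishes on glued pairs. Each inequality
  thus reduces to testing one distance against the conditions that characterise the other, and no
  chain of one kind is ever translated into a chain of the other kind. The obstacle is that a curve
  of \<open>M\<close> may meet the glued hypersurface in an infinite set, such as a Cantor set, so
  it cannot be cut into finitely many arcs inside the pieces. All estimates are therefore made at a
  fixed centre only; integration assembles them along curves, connectedness along plaques. They are
  stated in charts of \<open>M\<close> because there the points of both sides have coordinates and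
  the curve has its derivative. The factor \<open>1 + \<epsilon>\<close> absorbs two errors: the
  variation of the metric along a segment and the nonlinearity of the inclusion in charts.\<close>

definition pseudometric_on :: "'x set \<Rightarrow> ('x \<Rightarrow> 'x \<Rightarrow> real) \<Rightarrow> bool" where
  "pseudometric_on A d \<longleftrightarrow>
     (\<forall>x\<in>A. d x x = 0) \<and> (\<forall>x\<in>A. \<forall>y\<in>A. 0 \<le> d x y \<and> d x y = d y x) \<and>
     (\<forall>x\<in>A. \<forall>y\<in>A. \<forall>z\<in>A. d x z \<le> d x y + d y z)"

lemma pseudometric_onD:
  assumes "pseudometric_on A d"
  shows "x \<in> A \<Longrightarrow> d x x = 0" "\<lbrakk>x \<in> A; y \<in> A\<rbrakk> \<Longrightarrow> 0 \<le> d x y"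
    "\<lbrakk>x \<in> A; y \<in> A\<rbrakk> \<Longrightarrow> d x y = d y x" "\<lbrakk>x \<in> A; y \<in> A; z \<in> A\<rbrakk> \<Longrightarrow> d x z \<le> d x y + d y z"
  using assms unfolding pseudometric_on_def by blast+

text \<open>Two triangle inequalities in each direction. This justifies every later choice of
  representatives by \<open>SOME\<close>: in classes, in leaves, and in the fibres over points of
  \<open>M\<close>.\<close>

lemma pseudometric_on_cong_zero:
  assumes "pseudometric_on A d" "x \<in> A" "x' \<in> A" "y \<in> A" "y' \<in> A" "d x x' = 0" "d y y' = 0"
  shows "d x y = d x' y'"
  using pseudometric_onD(4)[OF assms(1,2,3,4)] pseudometric_onD(4)[OF assms(1,3,5,4)]
    pseudometric_onD(4)[OF assms(1,3,2,5)] pseudometric_onD(4)[OF assms(1,2,4,5)]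
    pseudometric_onD(3)[OF assms(1,2,3)] pseudometric_onD(3)[OF assms(1,4,5)] assms(6,7)
  by linarith

text \<open>Serves to bound a generated equivalence relation: once the generators have distance
  zero, the least equivalence relation containing them does too.\<close>

lemma equiv_zero_dist_rel:
  assumes pm: "pseudometric_on A d"
  shows "equiv A (zero_dist_rel A d)"
proof (rule equivI)
  show "refl_on A (zero_dist_rel A d)"
    using pseudometric_onD(1)[OF pm] by (auto simp: zero_dist_rel_def intro: refl_onI)
  show "sym (zero_dist_rel A d)"
    by (rule symI) (use pseudometric_onD(3)[OF pm] in \<open>auto simp: zero_dist_rel_def\<close>)
  show "trans (zero_dist_rel A d)"
  proof (rule transI)
    fix x y z assume "(x, y) \<in> zero_dist_rel A d" "(y, z) \<in> zero_dist_rel A d"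
    then have xyz: "x \<in> A" "y \<in> A" "z \<in> A" and zero: "d x y = 0" "d y z = 0"
      unfolding zero_dist_rel_def by auto
    then show "(x, z) \<in> zero_dist_rel A d"
      using pseudometric_onD(4)[OF pm xyz] pseudometric_onD(2)[OF pm xyz(1,3)]
      unfolding zero_dist_rel_def by simp
  qed
qed (auto simp: zero_dist_rel_def)

lemma class_dist_eqI:
  assumes "a \<in> C" "a' \<in> C'" "\<And>x y. x \<in> C \<Longrightarrow> y \<in> C' \<Longrightarrow> d x y = d a a'"
  shows "class_dist d C C' = d a a'"
  unfolding class_dist_def using assms by (metis someI_ex)

text \<open>The set \<open>Z\<close> parametrises both quotients, through \<open>f\<close> and
  through \<open>g\<close>. Equality of classes is characterised on either side by the same
  condition \<open>dA (f z) (f w) = 0\<close>, which makes the map \<open>cA z\<close> to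
  \<open>cB z\<close> well defined and injective. The laws of a pseudometric are assumed for
  \<open>dA\<close> alone and carried over to the extended-real \<open>dB\<close> by
  \<open>eq\<close>.\<close>

lemma quotient_isometry:
  assumes A: "f ` Z = A" and B: "g ` Z = B" and pm: "pseudometric_on A dA"
    and eq: "\<And>z w. z \<in> Z \<Longrightarrow> w \<in> Z \<Longrightarrow> dB (g z) (g w) = ereal (dA (f z) (f w))"
  shows "isometric_spaces (A // zero_dist_rel A dA) (\<lambda>C C'. ereal (class_dist dA C C'))
     (B // zero_dist_rel B dB) (class_dist dB)"
proof -
  define cA where "cA z = zero_dist_rel A dA `` {f z}" for z
  define cB where "cB z = zero_dist_rel B dB `` {g z}" for z
  define h where "h C = cB (SOME z. z \<in> Z \<and> C = cA z)" for C
  have fA: "f z \<in> A" and gB: "g z \<in> B" if "z \<in> Z" for z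
    using that A B by auto
  have memA: "f w \<in> cA z \<longleftrightarrow> dA (f z) (f w) = 0" if "z \<in> Z" "w \<in> Z" for z w
    using that fA unfolding cA_def zero_dist_rel_def by auto
  have memB: "g w \<in> cB z \<longleftrightarrow> dA (f z) (f w) = 0" if "z \<in> Z" "w \<in> Z" for z w
    using that fA gB eq unfolding cB_def zero_dist_rel_def by (auto simp: zero_ereal_def)
  have subA: "cA z \<subseteq> A" and subB: "cB z \<subseteq> B" for z
    unfolding cA_def cB_def zero_dist_rel_def by auto
  have refl: "dA (f z) (f z) = 0" if "z \<in> Z" for z
    by (rule pseudometric_onD(1)[OF pm fA[OF that]])
  have cong: "dA (f z) (f w) = dA (f z') (f w')"
    if "z \<in> Z" "w \<in> Z" "z' \<in> Z" "w' \<in> Z" "dA (f z) (f z') = 0" "dA (f w) (f w') = 0" for z w z' w'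
    by (rule pseudometric_on_cong_zero[OF pm]) (use that fA in auto)
  have cA_eq: "cA z = cA w \<longleftrightarrow> dA (f z) (f w) = 0" if "z \<in> Z" "w \<in> Z" for z w
  proof
    assume "cA z = cA w"
    then show "dA (f z) (f w) = 0"
      using memA[of z w] memA[of w w] refl that by auto
  next
    assume *: "dA (f z) (f w) = 0"
    have "x \<in> cA z \<longleftrightarrow> x \<in> cA w" if "x \<in> A" for x
    proof -
      obtain u where "u \<in> Z" "x = f u"
        using A \<open>x \<in> A\<close> by auto
      then show ?thesis
        using memA[of z u] memA[of w u] cong[of z u w u] * refl[of u] \<open>z \<in> Z\<close> \<open>w \<in> Z\<close> by simp
    qed
    then show "cA z = cA w"
      using subA by blast
  qed
  have cB_eq: "cB z = cB w \<longleftrightarrow> dA (f z) (f w) = 0" if "z \<in> Z" "w \<in> Z" for z w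
  proof
    assume "cB z = cB w"
    then show "dA (f z) (f w) = 0"
      using memB[of z w] memB[of w w] refl that by auto
  next
    assume *: "dA (f z) (f w) = 0"
    have "x \<in> cB z \<longleftrightarrow> x \<in> cB w" if "x \<in> B" for x
    proof -
      obtain u where "u \<in> Z" "x = g u"
        using B \<open>x \<in> B\<close> by auto
      then show ?thesis
        using memB[of z u] memB[of w u] cong[of z u w u] * refl[of u] \<open>z \<in> Z\<close> \<open>w \<in> Z\<close> by simp
    qed
    then show "cB z = cB w"
      using subB by blast
  qed
  have hcA: "h (cA z) = cB z" if "z \<in> Z" for z
  proof -
    define w where "w = (SOME w. w \<in> Z \<and> cA z = cA w)"
    have "w \<in> Z \<and> cA z = cA w"
      unfolding w_def by (rule someI[of _ z]) (use that in simp)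
    then show ?thesis
      using cA_eq[of z w] cB_eq[of z w] that unfolding h_def w_def by simp
  qed
  have dA: "class_dist dA (cA z) (cA w) = dA (f z) (f w)" if "z \<in> Z" "w \<in> Z" for z w
  proof (rule class_dist_eqI)
    show "f z \<in> cA z" "f w \<in> cA w"
      using memA refl that by auto
    fix x y assume xy: "x \<in> cA z" "y \<in> cA w"
    then obtain u v where "u \<in> Z" "v \<in> Z" "x = f u" "y = f v"
      using subA A by blast
    moreover have "dA (f z) (f u) = 0" "dA (f w) (f v) = 0"
      using memA xy calculation that by auto
    ultimately show "dA x y = dA (f z) (f w)"
      using cong[of z w u v] that by metis
  qed
  have dB: "class_dist dB (cB z) (cB w) = dB (g z) (g w)" if "z \<in> Z" "w \<in> Z" for z w
  proof (rule class_dist_eqI)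
    show "g z \<in> cB z" "g w \<in> cB w"
      using memB refl that by auto
    fix x y assume xy: "x \<in> cB z" "y \<in> cB w"
    then obtain u v where "u \<in> Z" "v \<in> Z" "x = g u" "y = g v"
      using subB B by blast
    moreover have "dA (f z) (f u) = 0" "dA (f w) (f v) = 0"
      using memB xy calculation that by auto
    ultimately show "dB x y = dB (g z) (g w)"
      using cong[of z w u v] that eq by metis
  qed
  have qA: "A // zero_dist_rel A dA = cA ` Z"
    unfolding quotient_def cA_def using A by auto
  have qB: "B // zero_dist_rel B dB = cB ` Z"
    unfolding quotient_def cB_def using B by auto
  have "bij_betw h (cA ` Z) (cB ` Z)"
    unfolding bij_betw_def
  proof
    show "inj_on h (cA ` Z)"
    proof (rule inj_onI)
      fix C C' assume "C \<in> cA ` Z" "C' \<in> cA ` Z" "h C = h C'"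
      then obtain z w where zw: "z \<in> Z" "w \<in> Z" "C = cA z" "C' = cA w"
        by blast
      then have "cB z = cB w"
        using hcA \<open>h C = h C'\<close> by metis
      then show "C = C'"
        using cA_eq cB_eq zw by metis
    qed
    show "h ` cA ` Z = cB ` Z"
      using hcA by (auto simp: image_image cong: image_cong_simp)
  qed
  moreover have "class_dist dB (h C) (h C') = ereal (class_dist dA C C')"
    if "C \<in> cA ` Z" "C' \<in> cA ` Z" for C C'
  proof -
    from that obtain z w where zw: "z \<in> Z" "w \<in> Z" "C = cA z" "C' = cA w"
      by auto
    show ?thesis
      unfolding zw(3,4) hcA[OF zw(1)] hcA[OF zw(2)] dA[OF zw(1,2)] dB[OF zw(1,2)] eq[OF zw(1,2)] ..
  qed
  ultimately show ?thesis
    unfolding isometric_spaces_def qA qB by blast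
qed

section \<open>Least equivalence relations\<close>

lemma equiv_least_equiv:
  assumes "r \<subseteq> Y \<times> Y"
  shows "equiv Y (least_equiv Y r)"
proof -
  \<comment> \<open>The family that is intersected contains the full relation; the intersection of
    an empty family would be \<open>UNIV\<close>.\<close>
  have "equiv Y (Y \<times> Y)"
    by (auto simp: equiv_def refl_on_def sym_def trans_def)
  then have "least_equiv Y r \<subseteq> Y \<times> Y"
    unfolding least_equiv_def using assms by blast
  moreover have "refl_on Y (least_equiv Y r)" "sym (least_equiv Y r)"
    unfolding least_equiv_def equiv_def refl_on_def sym_def by blast+
  moreover have "trans (least_equiv Y r)"
  proof (rule transI)
    fix x y z assume "(x, y) \<in> least_equiv Y r" "(y, z) \<in> least_equiv Y r"
    then have "(x, z) \<in> R" if "equiv Y R" "r \<subseteq> R" for R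
      using that unfolding least_equiv_def by (blast elim: equivE dest: transD)
    then show "(x, z) \<in> least_equiv Y r"
      unfolding least_equiv_def by auto
  qed
  ultimately show ?thesis
    by (auto simp: equiv_def)
qed

lemma subset_least_equiv: "r \<subseteq> least_equiv Y r"
  unfolding least_equiv_def by auto

lemma least_equiv_minimal: "equiv Y R \<Longrightarrow> r \<subseteq> R \<Longrightarrow> least_equiv Y r \<subseteq> R"
  unfolding least_equiv_def by auto

section \<open>Chain distances with jumps along a relation\<close>

definition chain_sums :: "'y set \<Rightarrow> ('y \<Rightarrow> 'y \<Rightarrow> ereal) \<Rightarrow> ('y \<times> 'y) set \<Rightarrow> 'y \<Rightarrow> 'y \<Rightarrow> ereal set" where
  "chain_sums Y d R x y = {\<Sum>i=1..k. d (p i) (q i) | k p q.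
       1 \<le> (k::nat) \<and> (\<forall>i\<in>{1..k}. p i \<in> Y \<and> q i \<in> Y) \<and> p 1 = x \<and> q k = y \<and>
       (\<forall>i. 1 \<le> i \<and> i < k \<longrightarrow> (p (i + 1), q i) \<in> R)}"

lemma chain_dist_eq_Inf: "chain_dist Y d R x y = Inf (chain_sums Y d R x y)"
  unfolding chain_dist_def chain_sums_def ..

text \<open>The junction becomes one more admissible jump. Its order \<open>(y', y)\<close> follows
  that of \<open>(p (i + 1), q i)\<close>: the start of the next link comes before the end of the
  previous one.\<close>

lemma chain_sums_append:
  assumes "s \<in> chain_sums Y d R x y" "s' \<in> chain_sums Y d R y' z" "(y', y) \<in> R"
  shows "s + s' \<in> chain_sums Y d R x z"
proof -
  obtain k :: nat and p q where 1: "s = (\<Sum>i=1..k. d (p i) (q i))" "1 \<le> k"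
      "\<forall>i\<in>{1..k}. p i \<in> Y \<and> q i \<in> Y" "p 1 = x" "q k = y"
      "\<forall>i. 1 \<le> i \<and> i < k \<longrightarrow> (p (i + 1), q i) \<in> R"
    using assms(1) unfolding chain_sums_def by blast
  obtain k' :: nat and p' q' where 2: "s' = (\<Sum>i=1..k'. d (p' i) (q' i))" "1 \<le> k'"
      "\<forall>i\<in>{1..k'}. p' i \<in> Y \<and> q' i \<in> Y" "p' 1 = y'" "q' k' = z"
      "\<forall>i. 1 \<le> i \<and> i < k' \<longrightarrow> (p' (i + 1), q' i) \<in> R"
    using assms(2) unfolding chain_sums_def by blast
  define P where "P i = (if i \<le> k then p i else p' (i - k))" for i
  define T where "T i = (if i \<le> k then q i else q' (i - k))" for i
  have "(\<Sum>i=1..k+k'. d (P i) (T i)) = (\<Sum>i=1..k. d (P i) (T i)) + (\<Sum>i=k+1..k+k'. d (P i) (T i))"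
    by (rule sum.ub_add_nat) simp
  also have "(\<Sum>i=1..k. d (P i) (T i)) = s"
    unfolding 1 by (rule sum.cong) (auto simp: P_def T_def)
  also have "(\<Sum>i=k+1..k+k'. d (P i) (T i)) = (\<Sum>i=1..k'. d (P (i + k)) (T (i + k)))"
    using sum.shift_bounds_cl_nat_ivl[of "\<lambda>i. d (P i) (T i)" 1 k k'] by (simp add: add.commute)
  also have "\<dots> = s'"
    unfolding 2 by (rule sum.cong) (auto simp: P_def T_def)
  finally have "s + s' = (\<Sum>i=1..k+k'. d (P i) (T i))" ..
  moreover have "\<forall>i\<in>{1..k+k'}. P i \<in> Y \<and> T i \<in> Y"
    using 1(3) by (auto simp: P_def T_def intro!: bspec[OF 2(3), THEN conjunct1] bspec[OF 2(3), THEN conjunct2])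
  moreover have "(P (i + 1), T i) \<in> R" if "1 \<le> i" "i < k + k'" for i
  proof -
    consider "i < k" | "i = k" | "i > k" by linarith
    then show ?thesis
    proof cases
      case 3
      then have "(p' (i - k + 1), q' (i - k)) \<in> R"
        using 2(6)[rule_format, of "i - k"] that by linarith
      then show ?thesis
        using 3 by (simp add: P_def T_def Suc_diff_le)
    qed (use 1 2 that assms(3) in \<open>auto simp: P_def T_def\<close>)
  qed
  moreover have "P 1 = x" "T (k + k') = z"
    using 1 2 by (auto simp: P_def T_def)
  moreover have "1 \<le> k + k'"
    using 1 by simp
  ultimately show ?thesis
    unfolding chain_sums_def by blast
qed

lemma chain_dist_le:
  assumes "x \<in> Y" "y \<in> Y"
  shows "chain_dist Y d R x y \<le> d x y"
proof -
  have "d x y \<in> chain_sums Y d R x y"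
    unfolding chain_sums_def mem_Collect_eq using assms
    by (intro exI[of _ 1] exI[of _ "\<lambda>_. x"] exI[of _ "\<lambda>_. y"]) auto
  then show ?thesis
    unfolding chain_dist_eq_Inf by (rule Inf_lower)
qed

text \<open>Strict real bounds avoid sums of possibly infinite values. With \<open>y' = y\<close>
  this is the triangle inequality; with two trivial links it shows that related points have distance
  at most zero.\<close>

lemma chain_dist_triangle_less:
  assumes "chain_dist Y d R x y < ereal a" "chain_dist Y d R y' z < ereal b" "(y', y) \<in> R"
  shows "chain_dist Y d R x z < ereal (a + b)"
proof -
  obtain s s' where s: "s \<in> chain_sums Y d R x y" "s < ereal a"
      "s' \<in> chain_sums Y d R y' z" "s' < ereal b"
    using assms(1,2) unfolding chain_dist_eq_Inf Inf_less_iff by blast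
  have "s + s' < ereal a + ereal b"
    using s by (intro ereal_add_strict_mono2) auto
  then show ?thesis
    unfolding chain_dist_eq_Inf Inf_less_iff using chain_sums_append s assms(3) by fastforce
qed

text \<open>Maximality of the chain distance. The triangle inequality along a chain bounds each link
  by \<open>d\<close> and drops each jump. A jump leads from \<open>q i\<close> to
  \<open>p (i + 1)\<close>, hence the reversed arguments in \<open>R\<close>; no symmetry of
  \<open>\<delta>\<close> is involved.\<close>

lemma le_chain_dist:
  fixes \<delta> :: "'y \<Rightarrow> 'y \<Rightarrow> real"
  assumes le: "\<And>p q. p \<in> Y \<Longrightarrow> q \<in> Y \<Longrightarrow> ereal (\<delta> p q) \<le> d p q"
    and tri: "\<And>p q r. p \<in> Y \<Longrightarrow> q \<in> Y \<Longrightarrow> r \<in> Y \<Longrightarrow> \<delta> p r \<le> \<delta> p q + \<delta> q r"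
    and R: "\<And>p q. (p, q) \<in> R \<Longrightarrow> \<delta> q p \<le> 0"
  shows "ereal (\<delta> x y) \<le> chain_dist Y d R x y"
  unfolding chain_dist_def
proof (rule Inf_greatest, clarify)
  fix k p q
  assume k: "1 \<le> (k::nat)" and Y: "\<forall>i\<in>{1..k}. p i \<in> Y \<and> q i \<in> Y"
    and r: "\<forall>i. 1 \<le> i \<and> i < k \<longrightarrow> (p (i + 1), q i) \<in> R"
  have "ereal (\<delta> (p 1) (q m)) \<le> (\<Sum>i=1..m. d (p i) (q i))" if "1 \<le> m" "m \<le> k" for m
    using that
  proof (induction m rule: nat_induct_at_least)
    case base
    then show ?case using le Y by simp
  next
    case (Suc m)
    have "p (Suc m) \<in> Y" "q (Suc m) \<in> Y" "q m \<in> Y" "p 1 \<in> Y"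
      using Y Suc k by auto
    then have "\<delta> (p 1) (q (Suc m)) \<le> \<delta> (p 1) (q m) + \<delta> (q m) (p (Suc m)) + \<delta> (p (Suc m)) (q (Suc m))"
      using tri[of "p 1" "q m" "q (Suc m)"] tri[of "q m" "p (Suc m)" "q (Suc m)"] by linarith
    also have "\<dots> \<le> \<delta> (p 1) (q m) + \<delta> (p (Suc m)) (q (Suc m))"
      using R[of "p (Suc m)" "q m"] r Suc by simp
    finally have "ereal (\<delta> (p 1) (q (Suc m))) \<le> ereal (\<delta> (p 1) (q m)) + ereal (\<delta> (p (Suc m)) (q (Suc m)))"
      by simp
    also have "\<dots> \<le> (\<Sum>i=1..m. d (p i) (q i)) + d (p (Suc m)) (q (Suc m))"
      using Suc le \<open>p (Suc m) \<in> Y\<close> \<open>q (Suc m) \<in> Y\<close> by (intro add_mono) auto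
    finally show ?case
      using Suc by simp
  qed
  then show "ereal (\<delta> (p 1) (q k)) \<le> (\<Sum>i=1..k. d (p i) (q i))"
    using k by blast
qed

section \<open>Infima over finite sequences of leaves\<close>

definition path_sums :: "'x set \<Rightarrow> ('x \<Rightarrow> 'x \<Rightarrow> real) \<Rightarrow> 'x \<Rightarrow> 'x \<Rightarrow> real set" where
  "path_sums A s x y = {\<Sum>i=1..<n. s (l i) (l (i + 1)) | n l.
       1 \<le> (n::nat) \<and> (\<forall>i\<in>{1..n}. l i \<in> A) \<and> l 1 = x \<and> l n = y}"

lemma leaf_dist_eq_Inf: "leaf_dist Q M L L' = Inf (path_sums (leaves Q M) (set_dist M) L L')"
  unfolding leaf_dist_def path_sums_def ..

lemma path_sums_append:
  assumes "a \<in> path_sums A s x y" "b \<in> path_sums A s y z"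
  shows "a + b \<in> path_sums A s x z"
proof -
  obtain n :: nat and l where 1: "a = (\<Sum>i=1..<n. s (l i) (l (i + 1)))" "1 \<le> n"
      "\<forall>i\<in>{1..n}. l i \<in> A" "l 1 = x" "l n = y"
    using assms(1) unfolding path_sums_def by blast
  obtain m :: nat and l' where 2: "b = (\<Sum>i=1..<m. s (l' i) (l' (i + 1)))" "1 \<le> m"
      "\<forall>i\<in>{1..m}. l' i \<in> A" "l' 1 = y" "l' m = z"
    using assms(2) unfolding path_sums_def by blast
  \<comment> \<open>The point \<open>y\<close> ends one sequence and starts the other, so the joined
    sequence has \<open>n + m - 1\<close> entries. At index \<open>n\<close> the two branches of
    \<open>L\<close> agree, both giving \<open>y\<close>; this is what \<open>L'\<close>
    exploits.\<close>
  define N where "N = n + (m - 1)"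
  define L where "L i = (if i \<le> n then l i else l' (i - (n - 1)))" for i
  have L': "L i = l' (i - (n - 1))" if "i \<ge> n" for i
    using that 1 2 by (cases "i = n") (auto simp: L_def)
  have "(\<Sum>i=1..<N. s (L i) (L (i + 1))) = (\<Sum>i=1..<n. s (L i) (L (i + 1))) + (\<Sum>i=n..<N. s (L i) (L (i + 1)))"
    using 1 by (intro sum.atLeastLessThan_concat[symmetric]) (auto simp: N_def)
  also have "(\<Sum>i=1..<n. s (L i) (L (i + 1))) = a"
    unfolding 1 by (rule sum.cong) (auto simp: L_def)
  also have "(\<Sum>i=n..<N. s (L i) (L (i + 1))) = (\<Sum>i=1+(n-1)..<m+(n-1). s (L i) (L (i + 1)))"
    using 1 2 by (intro sum.cong) (auto simp: N_def)
  also have "\<dots> = (\<Sum>i=1..<m. s (L (i + (n - 1))) (L (i + (n - 1) + 1)))"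
    by (rule sum.shift_bounds_nat_ivl)
  also have "\<dots> = b"
    unfolding 2
  proof (rule sum.cong)
    fix i assume "i \<in> {1..<m}"
    then have "L (i + (n - 1)) = l' i" "L (i + (n - 1) + 1) = l' (i + 1)"
      using 1 by (auto simp: L' Suc_diff_le)
    then show "s (L (i + (n - 1))) (L (i + (n - 1) + 1)) = s (l' i) (l' (i + 1))"
      by (simp only:)
  qed simp
  finally have "a + b = (\<Sum>i=1..<N. s (L i) (L (i + 1)))" ..
  moreover have "L i \<in> A" if "i \<in> {1..N}" for i
  proof (cases "i \<le> n")
    case False
    then have "i - (n - 1) \<in> {1..m}"
      using that 1 2 by (auto simp: N_def)
    then show ?thesis
      using 2 False by (auto simp: L_def)
  qed (use that 1 in \<open>auto simp: L_def\<close>)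
  moreover have "L 1 = x" "1 \<le> N"
    using 1 by (auto simp: L_def N_def)
  moreover have "L N = z"
    using 1 2 L'[of N] by (simp add: N_def)
  ultimately show ?thesis
    unfolding path_sums_def by blast
qed

lemma path_sums_reverse:
  assumes "a \<in> path_sums A s x y" and sym: "\<And>u v. u \<in> A \<Longrightarrow> v \<in> A \<Longrightarrow> s u v = s v u"
  shows "a \<in> path_sums A s y x"
proof -
  obtain n :: nat and l where 1: "a = (\<Sum>i=1..<n. s (l i) (l (i + 1)))" "1 \<le> n"
      "\<forall>i\<in>{1..n}. l i \<in> A" "l 1 = x" "l n = y"
    using assms(1) unfolding path_sums_def by blast
  have "a = (\<Sum>i=1..<n. s (l (n - i + 1)) (l (n - i)))"
    unfolding 1
  proof (rule sum.reindex_bij_witness[of _ "\<lambda>i. n - i" "\<lambda>i. n - i"])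
    fix i assume "i \<in> {1..<n}"
    then show "s (l (n - (n - i) + 1)) (l (n - (n - i))) = s (l i) (l (i + 1))"
      using sym[of "l i" "l (i + 1)"] 1 by auto
  qed auto
  also have "\<dots> = (\<Sum>i=1..<n. s (l (n + 1 - i)) (l (n + 1 - (i + 1))))"
    by (rule sum.cong) (auto simp: Suc_diff_le)
  finally have "a = (\<Sum>i=1..<n. s (l (n + 1 - i)) (l (n + 1 - (i + 1))))" .
  then show ?thesis
    unfolding path_sums_def mem_Collect_eq using 1
    by (intro exI[of _ n] exI[of _ "\<lambda>i. l (n + 1 - i)"])
      (auto intro!: bspec[OF 1(3)])
qed

lemma path_sums_single:
  assumes "x \<in> A" "y \<in> A"
  shows "s x y \<in> path_sums A s x y"
  unfolding path_sums_def mem_Collect_eq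
  using assms by (intro exI[of _ 2] exI[of _ "\<lambda>i. if i = 1 then x else y"]) (auto simp: numeral_2_eq_2)

text \<open>The sequence with a single entry has an empty sum, whatever the value of
  \<open>s x x\<close>.\<close>

lemma path_sums_refl: "x \<in> A \<Longrightarrow> 0 \<in> path_sums A s x x"
  unfolding path_sums_def mem_Collect_eq
  by (intro exI[of _ 1] exI[of _ "\<lambda>i. x"]) auto

text \<open>The analogue of \<open>le_chain_dist\<close> for sequences without jumps: telescoping by
  the triangle inequality. The assumption \<open>zero\<close> covers sequences with one
  entry.\<close>

lemma path_sums_lower:
  assumes le: "\<And>p q. p \<in> A \<Longrightarrow> q \<in> A \<Longrightarrow> \<delta> p q \<le> s p q"
    and tri: "\<And>p q r. p \<in> A \<Longrightarrow> q \<in> A \<Longrightarrow> r \<in> A \<Longrightarrow> \<delta> p r \<le> \<delta> p q + \<delta> q r"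
    and zero: "\<And>p. p \<in> A \<Longrightarrow> \<delta> p p \<le> 0"
    and a: "a \<in> path_sums A s x y"
  shows "\<delta> x y \<le> a"
proof -
  obtain n :: nat and l where 1: "a = (\<Sum>i=1..<n. s (l i) (l (i + 1)))" "1 \<le> n"
      "\<forall>i\<in>{1..n}. l i \<in> A" "l 1 = x" "l n = y"
    using a unfolding path_sums_def by blast
  have "\<delta> (l 1) (l m) \<le> (\<Sum>i=1..<m. s (l i) (l (i + 1)))" if "1 \<le> m" "m \<le> n" for m
    using that
  proof (induction m rule: nat_induct_at_least)
    case base
    then show ?case using zero[of "l 1"] 1 by simp
  next
    case (Suc m)
    then have "l 1 \<in> A" "l m \<in> A" "l (m + 1) \<in> A"
      using 1 by auto
    then have "\<delta> (l 1) (l (m + 1)) \<le> (\<Sum>i=1..<m. s (l i) (l (i + 1))) + s (l m) (l (m + 1))"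
      using tri[of "l 1" "l m" "l (m + 1)"] le[of "l m" "l (m + 1)"] Suc by auto
    then show ?case
      using Suc by simp
  qed
  then show ?thesis
    using 1 by auto
qed

lemma le_leaf_dist:
  assumes "\<And>p q. p \<in> leaves Q M \<Longrightarrow> q \<in> leaves Q M \<Longrightarrow> \<delta> p q \<le> set_dist M p q"
    and "\<And>p q r. p \<in> leaves Q M \<Longrightarrow> q \<in> leaves Q M \<Longrightarrow> r \<in> leaves Q M \<Longrightarrow> \<delta> p r \<le> \<delta> p q + \<delta> q r"
    and "\<And>p. p \<in> leaves Q M \<Longrightarrow> \<delta> p p \<le> 0"
    and "L \<in> leaves Q M" "L' \<in> leaves Q M"
  shows "\<delta> L L' \<le> leaf_dist Q M L L'"
  unfolding leaf_dist_eq_Inf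
proof (rule cInf_greatest)
  show "path_sums (leaves Q M) (set_dist M) L L' \<noteq> {}"
    using path_sums_single[OF assms(4,5)] by blast
qed (rule path_sums_lower[OF assms(1-3)])

lemma path_sums_nonneg:
  assumes "\<And>p q. p \<in> A \<Longrightarrow> q \<in> A \<Longrightarrow> (0::real) \<le> s p q" "a \<in> path_sums A s x y"
  shows "0 \<le> a"
  using path_sums_lower[of A "\<lambda>_ _. 0" s a x y] assms by auto

text \<open>A real \<open>Inf\<close> is informative only for a nonempty set that is bounded below.
  Two-term sequences give the former, nonnegativity of \<open>set_dist\<close> the latter; symmetry
  comes from reversing sequences and the triangle inequality from joining them.\<close>

lemma
  assumes nonneg: "\<And>p q. p \<in> leaves Q M \<Longrightarrow> q \<in> leaves Q M \<Longrightarrow> 0 \<le> set_dist M p q"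
    and sym: "\<And>p q. p \<in> leaves Q M \<Longrightarrow> q \<in> leaves Q M \<Longrightarrow> set_dist M p q = set_dist M q p"
  shows pseudometric_on_leaf_dist: "pseudometric_on (leaves Q M) (leaf_dist Q M)"
    and leaf_dist_le_set_dist: "\<lbrakk>L \<in> leaves Q M; L' \<in> leaves Q M\<rbrakk> \<Longrightarrow> leaf_dist Q M L L' \<le> set_dist M L L'"
proof -
  let ?P = "path_sums (leaves Q M) (set_dist M)"
  have bdd: "bdd_below (?P x y)" for x y
    using path_sums_nonneg[of "leaves Q M" "set_dist M"] nonneg by (intro bdd_belowI[of _ 0]) blast
  have ne: "?P x y \<noteq> {}" if "x \<in> leaves Q M" "y \<in> leaves Q M" for x y
    using path_sums_single[OF that] by blast
  show "leaf_dist Q M L L' \<le> set_dist M L L'" if "L \<in> leaves Q M" "L' \<in> leaves Q M" for L L'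
    unfolding leaf_dist_eq_Inf by (rule cInf_lower[OF path_sums_single[OF that] bdd])
  have ge0: "0 \<le> leaf_dist Q M x y" if "x \<in> leaves Q M" "y \<in> leaves Q M" for x y
    unfolding leaf_dist_eq_Inf
    by (rule cInf_greatest[OF ne[OF that]]) (rule path_sums_nonneg[OF nonneg])
  have "leaf_dist Q M x x \<le> 0" if "x \<in> leaves Q M" for x
    unfolding leaf_dist_eq_Inf by (rule cInf_lower[OF path_sums_refl[OF that] bdd])
  then have refl: "leaf_dist Q M x x = 0" if "x \<in> leaves Q M" for x
    using ge0 that by (simp add: order_antisym)
  have "?P x y = ?P y x" for x y
    using path_sums_reverse[of _ "leaves Q M" "set_dist M"] sym by blast
  then have sm: "leaf_dist Q M x y = leaf_dist Q M y x" for x y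
    unfolding leaf_dist_eq_Inf by simp
  have tri: "leaf_dist Q M x z \<le> leaf_dist Q M x y + leaf_dist Q M y z"
    if xyz: "x \<in> leaves Q M" "y \<in> leaves Q M" "z \<in> leaves Q M" for x y z
  proof (rule field_le_epsilon)
    fix e :: real assume "e > 0"
    have "\<exists>a\<in>?P u v. a < leaf_dist Q M u v + e / 2" if "u \<in> leaves Q M" "v \<in> leaves Q M" for u v
      unfolding leaf_dist_eq_Inf by (rule cInf_lessD[OF ne[OF that]]) (use \<open>e > 0\<close> in simp)
    then obtain a b where ab: "a \<in> ?P x y" "a < leaf_dist Q M x y + e / 2"
        "b \<in> ?P y z" "b < leaf_dist Q M y z + e / 2"
      using xyz by metis
    then have "leaf_dist Q M x z \<le> a + b"
      unfolding leaf_dist_eq_Inf by (intro cInf_lower bdd path_sums_append)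
    then show "leaf_dist Q M x z \<le> leaf_dist Q M x y + leaf_dist Q M y z + e"
      using ab by simp
  qed
  show "pseudometric_on (leaves Q M) (leaf_dist Q M)"
    unfolding pseudometric_on_def using refl ge0 sm tri by blast
qed

section \<open>Charts and plaques\<close>

lemma is_chart_openin: "is_chart X c \<Longrightarrow> openin X (cdom c)"
  and is_chart_subset: "is_chart X c \<Longrightarrow> cdom c \<subseteq> topspace X"
  unfolding is_chart_def using openin_subset by auto

lemma is_chart_homeomorphic_map:
  "is_chart X c \<Longrightarrow> homeomorphic_map (subtopology X (cdom c)) (top_of_set (cmap c ` cdom c)) (cmap c)"
  unfolding is_chart_def by auto

lemma is_chart_inj_on:
  assumes "is_chart X c"
  shows "inj_on (cmap c) (cdom c)"
  using homeomorphic_imp_injective_map[OF is_chart_homeomorphic_map[OF assms]] is_chart_subset[OF assms]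
  by (simp add: Int_absorb1)

lemma is_chart_continuous_map:
  assumes "is_chart X c"
  shows "continuous_map (subtopology X (cdom c)) euclidean (cmap c)"
  using homeomorphic_imp_continuous_map[OF is_chart_homeomorphic_map[OF assms]]
  by (simp add: continuous_map_in_subtopology)

lemma is_chart_inv_continuous_map:
  assumes "is_chart X c"
  shows "continuous_map (top_of_set (cmap c ` cdom c)) X (inv_into (cdom c) (cmap c))"
proof -
  obtain g where g: "homeomorphic_maps (subtopology X (cdom c)) (top_of_set (cmap c ` cdom c)) (cmap c) g"
    using is_chart_homeomorphic_map[OF assms] by (auto simp: homeomorphic_map_maps)
  have "continuous_map (top_of_set (cmap c ` cdom c)) X g"
    using g by (auto simp: homeomorphic_maps_def continuous_map_in_subtopology)
  moreover have "inv_into (cdom c) (cmap c) z = g z" if z: "z \<in> cmap c ` cdom c" for z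
  proof -
    obtain x where "x \<in> cdom c" "z = cmap c x"
      using z by blast
    then show ?thesis
      using g is_chart_inj_on[OF assms] is_chart_subset[OF assms]
      by (auto simp: homeomorphic_maps_def)
  qed
  ultimately show ?thesis
    by (auto intro: continuous_map_eq)
qed

lemma is_chart_openin_preimage:
  assumes "is_chart X c" "open V"
  shows "openin X {y \<in> cdom c. cmap c y \<in> V}"
proof -
  have "openin (subtopology X (cdom c)) {y \<in> topspace (subtopology X (cdom c)). cmap c y \<in> V}"
    using openin_continuous_map_preimage[OF is_chart_continuous_map[OF assms(1)]] assms(2) by simp
  then have "openin X {y \<in> topspace (subtopology X (cdom c)). cmap c y \<in> V}"
    using openin_trans_full is_chart_openin[OF assms(1)] by blast
  then show ?thesis
    using is_chart_subset[OF assms(1)] by (simp add: Int_absorb1)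
qed

text \<open>\<open>H\<close> is the whole space or a half space; only its convexity matters.\<close>

lemma is_chart_convex_nbhd:
  assumes "is_chart X c" "x \<in> cdom c"
  obtains H r where "convex H" "0 < r" "cmap c ` cdom c \<subseteq> H" "H \<inter> ball (cmap c x) r \<subseteq> cmap c ` cdom c"
proof -
  let ?I = "cmap c ` cdom c"
  have "\<exists>H. convex H \<and> openin (top_of_set H) ?I"
    using assms(1) unfolding is_chart_def
  proof (elim conjE disjE exE)
    fix i assume "openin (top_of_set (half_space i)) ?I"
    moreover have "convex (half_space i)"
      unfolding half_space_def convex_alt by auto
    ultimately show ?thesis by blast
  qed auto
  then obtain H where H: "convex H" "openin (top_of_set H) ?I"
    by blast
  then obtain r where "0 < r" "ball (cmap c x) r \<inter> H \<subseteq> ?I"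
    using assms(2) openin_contains_ball[of H ?I] by auto
  then show thesis
    using that[of H r] H openin_imp_subset by blast
qed

lemma foliation_is_chart: "foliation Q M \<Longrightarrow> c \<in> fol_atlas M \<Longrightarrow> is_chart (mtop M) c"
  unfolding foliation_def is_atlas_def by auto

lemma foliation_chart_at:
  assumes "foliation Q M" "x \<in> mspace M"
  obtains c where "c \<in> fol_atlas M" "x \<in> cdom c"
  using assms unfolding foliation_def is_atlas_def by auto

text \<open>In the chart image, the slice of a small ball through \<open>x\<close> with fixed
  transverse coordinates is convex, also in a half space. Its preimage is therefore a connected
  piece of a plaque, and points in it are reached in a single step.\<close>

lemma plaque_step_local:
  assumes "foliation Q M" "c \<in> fol_atlas M" "x \<in> cdom c"
  obtains B where "openin (mtop M) B" "x \<in> B" "B \<subseteq> cdom c"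
    "\<And>y. y \<in> B \<Longrightarrow> plaque_eq Q c x y \<Longrightarrow> plaque_step Q M (mspace M) x y"
proof -
  note c = foliation_is_chart[OF assms(1,2)]
  obtain H r where H: "convex H" "0 < r" "cmap c ` cdom c \<subseteq> H"
      "H \<inter> ball (cmap c x) r \<subseteq> cmap c ` cdom c"
    using is_chart_convex_nbhd[OF c assms(3)] .
  define K where "K = H \<inter> ball (cmap c x) r \<inter> {w. \<forall>j\<in>Q. w $ j = cmap c x $ j}"
  define P where "P = inv_into (cdom c) (cmap c) ` K"
  have "convex {w. \<forall>j\<in>Q. w $ j = cmap c x $ j}"
    unfolding convex_alt by (auto simp: algebra_simps)
  then have "connected K"
    unfolding K_def by (intro convex_connected convex_Int H(1) convex_ball)
  moreover have "K \<subseteq> cmap c ` cdom c"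
    unfolding K_def using H by blast
  ultimately have conn: "connectedin (mtop M) P"
    unfolding P_def
    by (intro connectedin_continuous_map_image[OF is_chart_inv_continuous_map[OF c]])
       (auto simp: connectedin_subtopology)
  have P: "P \<subseteq> cdom c \<inter> mspace M" "\<forall>z\<in>P. plaque_eq Q c x z"
  proof -
    have "z \<in> cdom c \<and> cmap c z \<in> K" if z: "z \<in> P" for z
    proof -
      obtain w where w: "w \<in> K" "z = inv_into (cdom c) (cmap c) w"
        using z unfolding P_def by auto
      then have "w \<in> cmap c ` cdom c"
        using \<open>K \<subseteq> cmap c ` cdom c\<close> by auto
      then show ?thesis
        using w by (simp add: inv_into_into f_inv_into_f)
    qed
    then show "P \<subseteq> cdom c \<inter> mspace M" "\<forall>z\<in>P. plaque_eq Q c x z"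
      using is_chart_subset[OF c] unfolding K_def plaque_eq_def by auto
  qed
  have mem: "y \<in> P" if "y \<in> cdom c" "cmap c y \<in> ball (cmap c x) r" "plaque_eq Q c x y" for y
  proof -
    have "cmap c y \<in> K"
      unfolding K_def using that H(3) by (auto simp: plaque_eq_def)
    then show ?thesis
      unfolding P_def using inv_into_f_f[OF is_chart_inj_on[OF c] that(1)] by force
  qed
  have "x \<in> P"
    using mem assms(3) H(2) by (auto simp: plaque_eq_def)
  show thesis
  proof
    show "openin (mtop M) {y \<in> cdom c. cmap c y \<in> ball (cmap c x) r}"
      by (rule is_chart_openin_preimage[OF c open_ball])
  next
    fix y assume "y \<in> {y \<in> cdom c. cmap c y \<in> ball (cmap c x) r}" "plaque_eq Q c x y"
    then have "y \<in> P"
      using mem by auto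
    then show "plaque_step Q M (mspace M) x y"
      unfolding plaque_step_def using assms(2) conn P \<open>x \<in> P\<close> by blast
  qed (use assms H(2) in auto)
qed

section \<open>Leaves as classes of chains of plaques\<close>

lemma plaque_step_sym: "plaque_step Q M S x y \<Longrightarrow> plaque_step Q M S y x"
  unfolding plaque_step_def plaque_eq_def by metis

lemma plaque_step_in: "plaque_step Q M S x y \<Longrightarrow> x \<in> S \<and> y \<in> S"
  unfolding plaque_step_def by auto

lemma leaf_refl: "x \<in> leaf Q M S x"
  unfolding leaf_def by simp

lemma leaf_eq: "y \<in> leaf Q M S x \<Longrightarrow> leaf Q M S y = leaf Q M S x"
proof -
  assume "y \<in> leaf Q M S x"
  then have "(plaque_step Q M S)\<^sup>*\<^sup>* x y"
    unfolding leaf_def by simp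
  then have "(plaque_step Q M S)\<^sup>*\<^sup>* x y" "(plaque_step Q M S)\<^sup>*\<^sup>* y x"
    using sympD[OF symp_rtranclp[OF sympI]] plaque_step_sym by metis+
  then show ?thesis
    unfolding leaf_def by (auto intro: rtranclp_trans)
qed

lemma plaque_step_leaf_eq: "plaque_step Q M S x y \<Longrightarrow> leaf Q M S y = leaf Q M S x"
  by (rule leaf_eq) (auto simp: leaf_def)

lemma leaf_subset: "x \<in> S \<Longrightarrow> leaf Q M S x \<subseteq> S"
proof
  fix y assume "y \<in> leaf Q M S x" "x \<in> S"
  then have "(plaque_step Q M S)\<^sup>*\<^sup>* x y" "x \<in> S"
    unfolding leaf_def by auto
  then show "y \<in> S"
    by (induction rule: rtranclp_induct) (auto dest: plaque_step_in)
qed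

lemma leavesD:
  assumes "L \<in> leaves Q M" "x \<in> L"
  shows "x \<in> mspace M" "L = leaf Q M (mspace M) x"
proof -
  obtain z where z: "z \<in> mspace M" "L = leaf Q M (mspace M) z"
    using assms(1) unfolding leaves_def by auto
  show "x \<in> mspace M"
    using leaf_subset[OF z(1)] assms(2) z(2) by auto
  show "L = leaf Q M (mspace M) x"
    using leaf_eq assms(2) z(2) by metis
qed

lemma leaves_nonempty: "L \<in> leaves Q M \<Longrightarrow> \<exists>x\<in>L. x \<in> mspace M"
  unfolding leaves_def using leaf_refl by fastforce

text \<open>An equivalence relation whose classes are locally everything is total on a connected
  set: neighbourhoods of the points related to \<open>x\<close> and of the others would separate
  \<open>P\<close>. It replaces subdivision arguments for plaques and also yields curves between any
  two points. Reflexivity is part of \<open>loc\<close>, with \<open>w = z\<close>.\<close>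

lemma connectedin_equivalence:
  assumes conn: "connectedin X P"
    and loc: "\<And>z. z \<in> P \<Longrightarrow> \<exists>B. openin X B \<and> z \<in> B \<and> (\<forall>w\<in>P \<inter> B. T z w)"
    and sym: "\<And>u v. u \<in> P \<Longrightarrow> v \<in> P \<Longrightarrow> T u v \<Longrightarrow> T v u"
    and trans: "\<And>u v w. u \<in> P \<Longrightarrow> v \<in> P \<Longrightarrow> w \<in> P \<Longrightarrow> T u v \<Longrightarrow> T v w \<Longrightarrow> T u w"
    and x: "x \<in> P" and y: "y \<in> P"
  shows "T x y"
proof (rule ccontr)
  assume n: "\<not> T x y"
  obtain B where B: "\<And>z. z \<in> P \<Longrightarrow> openin X (B z)" "\<And>z. z \<in> P \<Longrightarrow> z \<in> B z"
      "\<And>z w. z \<in> P \<Longrightarrow> w \<in> P \<Longrightarrow> w \<in> B z \<Longrightarrow> T z w"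
  proof -
    have "\<forall>z\<in>P. \<exists>B. openin X B \<and> z \<in> B \<and> (\<forall>w\<in>P \<inter> B. T z w)"
      using loc by blast
    from bchoice[OF this] show thesis
      using that by blast
  qed
  define E1 where "E1 = \<Union>(B ` {z \<in> P. T x z})"
  define E2 where "E2 = \<Union>(B ` {z \<in> P. \<not> T x z})"
  have "openin X E1" "openin X E2"
    unfolding E1_def E2_def using B(1) by auto
  moreover have "P \<subseteq> E1 \<union> E2"
    unfolding E1_def E2_def using B(2) by blast
  moreover have "E1 \<inter> E2 \<inter> P = {}"
  proof (rule ccontr)
    assume "E1 \<inter> E2 \<inter> P \<noteq> {}"
    then obtain w z z' where w: "w \<in> P" "z \<in> P" "T x z" "w \<in> B z" "z' \<in> P" "\<not> T x z'" "w \<in> B z'"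
      unfolding E1_def E2_def by blast
    have "T x w"
      using trans[of x z w] x w B(3)[of z w] by blast
    then have "T x z'"
      using trans[of x w z'] sym[of z' w] x w B(3)[of z' w] by blast
    then show False
      using w by blast
  qed
  moreover have "T x x"
    using B(2,3) x by blast
  then have "E1 \<inter> P \<noteq> {}"
    unfolding E1_def using x B(2) by blast
  moreover have "E2 \<inter> P \<noteq> {}"
    unfolding E2_def using y B(2) n by blast
  ultimately show False
    using conn unfolding connectedin by blast
qed

lemma fol_compatibleE:
  assumes "fol_compatible Q X f c d" "x \<in> cdom c" "f x \<in> cdom d"
  obtains W where "openin X W" "x \<in> W"
    "\<And>y y'. y \<in> W \<Longrightarrow> y' \<in> W \<Longrightarrow> plaque_eq Q c y y' \<longleftrightarrow> plaque_eq Q d (f y) (f y')"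
proof -
  have "\<exists>W. openin X W \<and> x \<in> W \<and> W \<subseteq> cdom c \<and> f ` W \<subseteq> cdom d \<and>
         (\<forall>y\<in>W. \<forall>y'\<in>W. plaque_eq Q c y y' \<longleftrightarrow> plaque_eq Q d (f y) (f y'))"
    using assms unfolding fol_compatible_def by simp
  then show thesis
    using that by (elim exE conjE) simp
qed

text \<open>Compatibility of charts is local, and the image of a plaque of \<open>N\<close> may
  leave the domain of every single foliated chart of \<open>M\<close>. But lying in the same leaf of
  \<open>M\<close> is locally constant along a connected plaque.\<close>

lemma leaf_image_eq:
  assumes fol: "foliation Q M" and cont: "continuous_map (mtop N) (mtop M) j"
    and comp: "\<And>c d. c \<in> fol_atlas N \<Longrightarrow> d \<in> fol_atlas M \<Longrightarrow> fol_compatible Q (mtop N) j c d"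
    and y: "y \<in> leaf Q N (mspace N) x"
  shows "leaf Q M (mspace M) (j y) = leaf Q M (mspace M) (j x)"
proof -
  have step: "leaf Q M (mspace M) (j x) = leaf Q M (mspace M) (j y)"
    if xy: "plaque_step Q N (mspace N) x y" for x y
  proof -
    obtain c P where c: "c \<in> fol_atlas N" "connectedin (mtop N) P" "P \<subseteq> cdom c \<inter> mspace N"
        "x \<in> P" "y \<in> P" "\<forall>z\<in>P. plaque_eq Q c x z"
      using xy unfolding plaque_step_def by blast
    show ?thesis
    proof (rule connectedin_equivalence[OF c(2) _ _ _ c(4,5),
        where T = "\<lambda>u v. leaf Q M (mspace M) (j u) = leaf Q M (mspace M) (j v)"])
      fix z assume z: "z \<in> P"
      then have jz: "j z \<in> mspace M"
        using c(3) continuous_map_image_subset_topspace[OF cont] by blast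
      obtain d where d: "d \<in> fol_atlas M" "j z \<in> cdom d"
        using foliation_chart_at[OF fol jz] .
      have "z \<in> cdom c"
        using z c(3) by auto
      then obtain W where W: "openin (mtop N) W" "z \<in> W"
          "\<And>y y'. y \<in> W \<Longrightarrow> y' \<in> W \<Longrightarrow> plaque_eq Q c y y' \<longleftrightarrow> plaque_eq Q d (j y) (j y')"
        using fol_compatibleE[OF comp[OF c(1) d(1)] _ d(2)] by metis
      obtain B where B: "openin (mtop M) B" "j z \<in> B" "B \<subseteq> cdom d"
          "\<And>y. y \<in> B \<Longrightarrow> plaque_eq Q d (j z) y \<Longrightarrow> plaque_step Q M (mspace M) (j z) y"
        by (rule plaque_step_local[OF fol d]) (rule that; assumption)
      define O' where "O' = W \<inter> {w \<in> mspace N. j w \<in> B}"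
      have "openin (mtop N) O'"
        unfolding O'_def by (intro openin_Int W openin_continuous_map_preimage[OF cont B(1)])
      moreover have "z \<in> O'"
        unfolding O'_def using W B z c(3) by auto
      moreover have "leaf Q M (mspace M) (j z) = leaf Q M (mspace M) (j w)" if "w \<in> P \<inter> O'" for w
      proof -
        have "plaque_eq Q c z w"
          using bspec[OF c(6) z] bspec[OF c(6), of w] that by (simp add: plaque_eq_def)
        then have "plaque_eq Q d (j z) (j w)"
          using W(3)[of z w] W(2) that unfolding O'_def by simp
        then show ?thesis
          using plaque_step_leaf_eq[OF B(4)[of "j w"]] that unfolding O'_def by simp
      qed
      ultimately show "\<exists>B. openin (mtop N) B \<and> z \<in> B \<and>
          (\<forall>w\<in>P \<inter> B. leaf Q M (mspace M) (j z) = leaf Q M (mspace M) (j w))"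
        by blast
    qed simp_all
  qed
  have "(plaque_step Q N (mspace N))\<^sup>*\<^sup>* x y"
    using y unfolding leaf_def by simp
  then show ?thesis
    by (induction rule: rtranclp_induct) (auto dest: step)
qed

lemma closed_map_openin_nbhd:
  assumes "closed_map X Y f" "openin X U" "inj_on f (topspace X)" "x \<in> U"
    and "f ` topspace X \<subseteq> topspace Y"
  obtains V where "openin Y V" "f x \<in> V" "\<And>y. y \<in> topspace X \<Longrightarrow> f y \<in> V \<Longrightarrow> y \<in> U"
proof
  have U: "U \<subseteq> topspace X"
    using assms(2) openin_subset by blast
  show "openin Y (topspace Y - f ` (topspace X - U))"
    using assms(1,2) unfolding closed_map_def by blast
  show "f x \<in> topspace Y - f ` (topspace X - U)"
    using assms U by (auto dest: inj_onD)
  show "y \<in> U" if "y \<in> topspace X" "f y \<in> topspace Y - f ` (topspace X - U)" for y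
    using that by blast
qed

text \<open>This reads the equivalence in \<open>fol_compatible\<close> backwards: near
  \<open>x\<close>, equal transverse coordinates in \<open>M\<close> force equal transverse
  coordinates in \<open>N\<close>. The connected set joining \<open>x\<close> to \<open>y\<close> is
  then taken in a chart of \<open>N\<close>, so nothing need be known about how the plaque of
  \<open>M\<close> meets the image of \<open>N\<close>.\<close>

lemma leaf_eq_near:
  assumes fol: "foliation Q N" and closed: "closed_map (mtop N) (mtop M) j" and inj: "inj_on j (mspace N)"
    and into: "j ` mspace N \<subseteq> mspace M"
    and comp: "\<And>c d. c \<in> fol_atlas N \<Longrightarrow> d \<in> fol_atlas M \<Longrightarrow> fol_compatible Q (mtop N) j c d"
    and x: "x \<in> mspace N" and d: "d \<in> fol_atlas M" "j x \<in> cdom d"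
  obtains U where "openin (mtop M) U" "j x \<in> U"
    "\<And>y. y \<in> mspace N \<Longrightarrow> j y \<in> U \<Longrightarrow> plaque_eq Q d (j x) (j y) \<Longrightarrow>
       leaf Q N (mspace N) y = leaf Q N (mspace N) x"
proof -
  obtain c where c: "c \<in> fol_atlas N" "x \<in> cdom c"
    using foliation_chart_at[OF fol x] .
  obtain W where W: "openin (mtop N) W" "x \<in> W"
      "\<And>y y'. y \<in> W \<Longrightarrow> y' \<in> W \<Longrightarrow> plaque_eq Q c y y' \<longleftrightarrow> plaque_eq Q d (j y) (j y')"
    using fol_compatibleE[OF comp[OF c(1) d(1)] c(2) d(2)] by metis
  obtain B where B: "openin (mtop N) B" "x \<in> B" "B \<subseteq> cdom c"
      "\<And>y. y \<in> B \<Longrightarrow> plaque_eq Q c x y \<Longrightarrow> plaque_step Q N (mspace N) x y"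
    by (rule plaque_step_local[OF fol c]) (rule that; assumption)
  obtain U where U: "openin (mtop M) U" "j x \<in> U"
      "\<And>y. y \<in> mspace N \<Longrightarrow> j y \<in> U \<Longrightarrow> y \<in> W \<inter> B"
    using closed_map_openin_nbhd[OF closed openin_Int[OF W(1) B(1)] inj _ into, of x] W(2) B(2)
    by (metis IntI)
  show thesis
  proof
    show "leaf Q N (mspace N) y = leaf Q N (mspace N) x"
      if "y \<in> mspace N" "j y \<in> U" "plaque_eq Q d (j x) (j y)" for y
    proof (rule plaque_step_leaf_eq)
      show "plaque_step Q N (mspace N) x y"
        using B(4)[of y] W(3)[of x y] W(2) U(3)[OF that(1,2)] that(3) by simp
    qed
  qed (use U in auto)
qed

section \<open>Smooth maps in charts\<close>

lemma smooth_fun_on_extension: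
  assumes "smooth_fun_on A f" "z \<in> A"
  obtains V F where "open V" "z \<in> V"
    "\<And>w. w \<in> V \<Longrightarrow> (F has_derivative frechet_derivative F (at w)) (at w)"
    "\<And>v. continuous_on V (\<lambda>w. frechet_derivative F (at w) v)"
    "\<And>w. w \<in> A \<Longrightarrow> w \<in> V \<Longrightarrow> F w = f w"
proof -
  obtain V F where V: "open V" "z \<in> V" "\<forall>k. Ck_on k F V" "\<forall>w\<in>A \<inter> V. F w = f w"
    using bspec[OF assms(1)[unfolded smooth_fun_on_def] assms(2)] by blast
  have "Ck_on (Suc 0) F V"
    using V(3) by blast
  then have 1: "\<forall>w\<in>V. F differentiable (at w)" "\<forall>v. continuous_on V (\<lambda>w. frechet_derivative F (at w) v)"
    by simp_all
  show thesis
  proof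
    show "(F has_derivative frechet_derivative F (at w)) (at w)" if "w \<in> V" for w
      using 1(1) that frechet_derivative_works by auto
  qed (use V 1 in auto)
qed

lemma riemannian_manifoldD:
  assumes "riemannian_manifold M"
  shows "smooth_map M (mspace M) M id" "preserves_rmetric M (mspace M) (\<lambda>_ _. UNIV) M id"
    "\<And>c. c \<in> atlas M \<Longrightarrow> is_chart (mtop M) c"
    "\<And>c x. c \<in> atlas M \<Longrightarrow> x \<in> cdom c \<Longrightarrow> bilinear (rmetric M c x)"
    "\<And>c x u v. c \<in> atlas M \<Longrightarrow> x \<in> cdom c \<Longrightarrow> rmetric M c x u v = rmetric M c x v u"
    "\<And>c x u. c \<in> atlas M \<Longrightarrow> x \<in> cdom c \<Longrightarrow> u \<noteq> 0 \<Longrightarrow> rmetric M c x u u > 0"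
    "\<And>c u v. c \<in> atlas M \<Longrightarrow> smooth_fun_on (cmap c ` cdom c) (\<lambda>z. rmetric M c (inv_into (cdom c) (cmap c) z) u v)"
    "Hausdorff_space (mtop M)"
  using assms unfolding riemannian_manifold_def is_atlas_def by (elim conjE; simp)+

lemma riemannian_chart_at:
  assumes "riemannian_manifold M" "x \<in> mspace M"
  obtains c where "c \<in> atlas M" "x \<in> cdom c"
  using assms unfolding riemannian_manifold_def is_atlas_def by auto

lemma smooth_map_continuous: "smooth_map N (mspace N) M f \<Longrightarrow> continuous_map (mtop N) (mtop M) f"
  unfolding smooth_map_def by simp

text \<open>In the charts \<open>c\<close> and \<open>d\<close>, the map \<open>f\<close> is given by \<open>F\<close>, with differential \<open>D y\<close> at \<open>y\<close>. At a
  boundary point \<open>F\<close> is an extension to a full neighbourhood, so that \<open>D y\<close> is a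
  two-sided derivative.\<close>

lemma smooth_isometry_local:
  fixes N :: "('a, 'n::finite) fol_mfd" and M :: "('b, 'm::finite) fol_mfd"
  assumes N: "riemannian_manifold N"
    and sm: "smooth_map N (mspace N) M f" and pr: "preserves_rmetric N (mspace N) (\<lambda>_ _. UNIV) M f"
    and d_chart: "is_chart (mtop M) d"
    and c: "c \<in> atlas N" "x \<in> cdom c" and d: "d \<in> atlas M" "f x \<in> cdom d"
  obtains O' F D where "openin (mtop N) O'" "x \<in> O'" "O' \<subseteq> cdom c"
    "\<And>y. y \<in> O' \<Longrightarrow> f y \<in> cdom d" "\<And>y. y \<in> O' \<Longrightarrow> cmap d (f y) = F (cmap c y)"
    "\<And>y. y \<in> O' \<Longrightarrow> (F has_derivative D y) (at (cmap c y))"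
    "\<And>y u v. y \<in> O' \<Longrightarrow> rmetric M d (f y) (D y u) (D y v) = rmetric N c y u v"
    "\<And>v. continuous_map (subtopology (mtop N) O') euclidean (\<lambda>y. D y v)"
proof -
  note c_chart = riemannian_manifoldD(3)[OF N c(1)]
  note inj = is_chart_inj_on[OF c_chart]
  let ?A = "local_dom (mspace N) c d f"
  have cN: "y \<in> mspace N" if "y \<in> cdom c" for y
    using is_chart_subset[OF c_chart] that by auto
  have A: "cmap c y \<in> ?A" if "y \<in> cdom c" "f y \<in> cdom d" for y
    using that cN unfolding local_dom_def by auto
  have rep: "local_rep c d f (cmap c y) = cmap d (f y)" if "y \<in> cdom c" for y
    using inv_into_f_f[OF inj that] unfolding local_rep_def by simp
  have "smooth_fun_on ?A (local_rep c d f)"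
    using sm c(1) d(1) unfolding smooth_map_def by blast
  from smooth_fun_on_extension[OF this A[OF c(2) d(2)]]
  obtain V F where V: "open V" "cmap c x \<in> V"
    "\<And>w. w \<in> V \<Longrightarrow> (F has_derivative frechet_derivative F (at w)) (at w)"
    "\<And>v. continuous_on V (\<lambda>w. frechet_derivative F (at w) v)"
    "\<And>w. w \<in> ?A \<Longrightarrow> w \<in> V \<Longrightarrow> F w = local_rep c d f w"
    by metis
  define D where "D y = frechet_derivative F (at (cmap c y))" for y
  define O' where "O' = {y \<in> cdom c. cmap c y \<in> V} \<inter> {y \<in> mspace N. f y \<in> cdom d}"
  have O'D: "y \<in> cdom c" "cmap c y \<in> V" "f y \<in> cdom d" if "y \<in> O'" for y
    using that unfolding O'_def by auto
  show thesis
  proof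
    show "openin (mtop N) O'"
      unfolding O'_def
      by (intro openin_Int is_chart_openin_preimage[OF c_chart V(1)]
          openin_continuous_map_preimage[OF smooth_map_continuous[OF sm] is_chart_openin[OF d_chart]])
    show "x \<in> O'" "O' \<subseteq> cdom c"
      unfolding O'_def using c d V(2) cN by auto
    show "f y \<in> cdom d" if "y \<in> O'" for y
      using O'D(3)[OF that] .
    show "cmap d (f y) = F (cmap c y)" if "y \<in> O'" for y
      using V(5)[OF A] O'D[OF that] rep by simp
    show der: "(F has_derivative D y) (at (cmap c y))" if "y \<in> O'" for y
      unfolding D_def using V(3) O'D[OF that] by simp
    show "rmetric M d (f y) (D y u) (D y v) = rmetric N c y u v" if y: "y \<in> O'" for y u v
    proof -
      obtain e where e: "e > 0" "ball (cmap c y) e \<subseteq> V"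
        using V(1) O'D(2)[OF y] open_contains_ball by blast
      \<comment> \<open>\<open>preserves_rmetric\<close> speaks of every derivative within the local
        domain. The two-sided derivative of the extension \<open>F\<close> is one of them, since
        \<open>F\<close> agrees with the local representation on that domain.\<close>
      have "(local_rep c d f has_derivative D y) (at (cmap c y) within ?A)"
      proof (rule has_derivative_transform_within[OF has_derivative_at_withinI[OF der[OF y]] e(1)])
        show "cmap c y \<in> ?A"
          using A O'D[OF y] by simp
        show "F w = local_rep c d f w" if "w \<in> ?A" "dist w (cmap c y) < e" for w
          using V(5) that e(2) by (auto simp: dist_commute subset_iff)
      qed
      moreover have "\<forall>D. (local_rep c d f has_derivative D) (at (cmap c y) within ?A) \<longrightarrow>
         (\<forall>u\<in>UNIV. \<forall>v\<in>UNIV. rmetric M d (f y) (D u) (D v) = rmetric N c y u v)"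
        using pr c(1) d(1) O'D[OF y] cN unfolding preserves_rmetric_def by simp
      ultimately show ?thesis
        by simp
    qed
    show "continuous_map (subtopology (mtop N) O') euclidean (\<lambda>y. D y v)" for v
    proof -
      have "continuous_map (subtopology (mtop N) O') (top_of_set V) (cmap c)"
        using continuous_map_from_subtopology_mono[OF is_chart_continuous_map[OF c_chart], of O'] O'D
        by (auto simp: continuous_map_in_subtopology)
      moreover have "continuous_map (top_of_set V) euclidean (\<lambda>w. frechet_derivative F (at w) v)"
        using V(4) by simp
      ultimately have "continuous_map (subtopology (mtop N) O') euclidean
          ((\<lambda>w. frechet_derivative F (at w) v) \<circ> cmap c)"
        by (rule continuous_map_compose)
      then show ?thesis
        by (simp add: D_def o_def)
    qed
  qed
qed

text \<open>Expanding \<open>u t\<close> in the finite basis reduces the claim to continuity of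
  \<open>A\<close> on the basis vectors and of the coefficients of \<open>u\<close>.\<close>

lemma continuous_on_linear_apply:
  fixes A :: "'x::topological_space \<Rightarrow> 'v::euclidean_space \<Rightarrow> 'w::real_normed_vector"
  assumes "\<And>t. t \<in> T \<Longrightarrow> linear (A t)" "\<And>v. continuous_on T (\<lambda>t. A t v)" "continuous_on T u"
  shows "continuous_on T (\<lambda>t. A t (u t))"
proof -
  have "A t (u t) = (\<Sum>b\<in>Basis. (u t \<bullet> b) *\<^sub>R A t b)" if "t \<in> T" for t
  proof -
    have "A t (u t) = A t (\<Sum>b\<in>Basis. (u t \<bullet> b) *\<^sub>R b)"
      by (simp add: euclidean_representation)
    also have "\<dots> = (\<Sum>b\<in>Basis. (u t \<bullet> b) *\<^sub>R A t b)"
      using assms(1)[OF that] by (simp add: linear_sum linear_scale)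
    finally show ?thesis .
  qed
  moreover have "continuous_on T (\<lambda>t. \<Sum>b\<in>Basis. (u t \<bullet> b) *\<^sub>R A t b)"
    by (intro continuous_intros assms)
  ultimately show ?thesis
    by (simp cong: continuous_on_cong)
qed

lemma continuous_on_locally:
  fixes S :: "'x::t2_space set"
  assumes "\<And>t. t \<in> S \<Longrightarrow> \<exists>U. openin (top_of_set S) U \<and> t \<in> U \<and> continuous_on U g"
  shows "continuous_on S g"
  unfolding continuous_on_eq_continuous_within
proof
  fix t assume t: "t \<in> S"
  then obtain U where U: "openin (top_of_set S) U" "t \<in> U" "continuous_on U g"
    using assms by blast
  then obtain W where W: "open W" "U = S \<inter> W"
    by (auto simp: openin_open)
  then have "at t within U = at t within S"
    using U(2) by (intro at_within_nhd[of _ W]) auto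
  then show "continuous (at t within S) g"
    using U(2,3) by (auto simp: continuous_on_eq_continuous_within)
qed

section \<open>Curves\<close>

abbreviation curve_in :: "('a, 'n::finite) fol_mfd \<Rightarrow> real set \<Rightarrow> (real \<Rightarrow> 'a) \<Rightarrow> bool" where
  "curve_in N T \<gamma> \<equiv> continuous_map (top_of_set T) (mtop N) \<gamma>"

lemma curve_in_mspace: "curve_in N T \<gamma> \<Longrightarrow> t \<in> T \<Longrightarrow> \<gamma> t \<in> mspace N"
  using continuous_map_image_subset_topspace by fastforce

lemma curve_in_openin:
  assumes "curve_in N T \<gamma>" "openin (mtop N) U"
  shows "openin (top_of_set T) {t \<in> T. \<gamma> t \<in> U}"
  using openin_continuous_map_preimage[OF assms] by simp

lemma curve_in_eventually:
  assumes "curve_in N T \<gamma>" "openin (mtop N) U" "t \<in> T" "\<gamma> t \<in> U"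
  obtains e where "e > 0" "\<And>s. s \<in> T \<Longrightarrow> dist s t < e \<Longrightarrow> \<gamma> s \<in> U"
proof -
  have "t \<in> {t \<in> T. \<gamma> t \<in> U}"
    using assms by simp
  then obtain e where "e > 0" "\<forall>s\<in>T. dist s t < e \<longrightarrow> s \<in> {t \<in> T. \<gamma> t \<in> U}"
    using curve_in_openin[OF assms(1,2)] unfolding openin_euclidean_subtopology_iff by blast
  then show thesis
    using that by auto
qed

lemma chart_curve_derivative:
  assumes curve: "curve_in N T \<gamma>" and t: "t \<in> T"
    and O': "openin (mtop N) O'" "\<gamma> t \<in> O'"
    and F: "\<And>y. y \<in> O' \<Longrightarrow> cmap d (f y) = F (cmap c y)"
    and D: "(F has_derivative D) (at (cmap c (\<gamma> t)))"
    and u: "((cmap c \<circ> \<gamma>) has_vector_derivative u) (at t within T)"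
  shows "((cmap d \<circ> (f \<circ> \<gamma>)) has_vector_derivative D u) (at t within T)"
proof -
  obtain e where e: "e > 0" "\<And>s. s \<in> T \<Longrightarrow> dist s t < e \<Longrightarrow> \<gamma> s \<in> O'"
    using curve_in_eventually[OF curve O'(1) t O'(2)] by blast
  have "((F \<circ> (cmap c \<circ> \<gamma>)) has_vector_derivative D u) (at t within T)"
  proof -
    have "((F \<circ> (cmap c \<circ> \<gamma>)) has_derivative D \<circ> (\<lambda>x. x *\<^sub>R u)) (at t within T)"
      using u D unfolding has_vector_derivative_def
      by (intro diff_chain_within) (auto intro: has_derivative_at_withinI)
    moreover have "D \<circ> (\<lambda>x. x *\<^sub>R u) = (\<lambda>x. x *\<^sub>R D u)"
      using has_derivative_linear[OF D] by (auto simp: linear_scale)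
    ultimately show ?thesis
      unfolding has_vector_derivative_def by simp
  qed
  then show ?thesis
    by (rule has_vector_derivative_transform_within[OF _ e(1) t]) (use e(2) F in auto)
qed

text \<open>The hypothesis asks for one good chart at each parameter, whereas
  \<open>C1_on_interval\<close> demands a continuous derivative in all charts. So the case
  \<open>f = id\<close> is useful too: it upgrades a segment that is \<open>C1\<close> in one
  chart.\<close>

lemma C1_on_interval_image:
  assumes N: "riemannian_manifold N" and M: "\<And>d. d \<in> atlas M \<Longrightarrow> is_chart (mtop M) d"
    and sm: "smooth_map N (mspace N) M f" and pr: "preserves_rmetric N (mspace N) (\<lambda>_ _. UNIV) M f"
    and curve: "curve_in N {a..b} \<gamma>" and ab: "a < b"
    and C1: "\<And>t. t \<in> {a..b} \<Longrightarrow> \<exists>c\<in>atlas N. \<gamma> t \<in> cdom c \<and>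
       (\<exists>v. continuous_on {s\<in>{a..b}. \<gamma> s \<in> cdom c} v \<and>
        (\<forall>s\<in>{a..b}. \<gamma> s \<in> cdom c \<longrightarrow> ((cmap c \<circ> \<gamma>) has_vector_derivative v s) (at s within {a..b})))"
  shows "C1_on_interval M (f \<circ> \<gamma>) a b"
  unfolding C1_on_interval_def
proof
  fix d assume d: "d \<in> atlas M"
  let ?T = "{t \<in> {a..b}. (f \<circ> \<gamma>) t \<in> cdom d}"
  \<comment> \<open>A global choice: on a nondegenerate interval the derivative is unique, so
    \<open>w\<close> agrees with each of the local expressions \<open>D (\<gamma> s) (v s)\<close>,
    whose continuity is then inherited.\<close>
  define w where "w s = vector_derivative (cmap d \<circ> (f \<circ> \<gamma>)) (at s within {a..b})" for s
  have loc: "\<exists>U. openin (top_of_set {a..b}) U \<and> t \<in> U \<and> U \<subseteq> ?T \<and> continuous_on U w \<and>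
      ((cmap d \<circ> (f \<circ> \<gamma>)) has_vector_derivative w t) (at t within {a..b})" if t: "t \<in> ?T" for t
  proof -
    have t': "t \<in> {a..b}" "f (\<gamma> t) \<in> cdom d"
      using t by auto
    obtain c v where c: "c \<in> atlas N" "\<gamma> t \<in> cdom c"
      and v: "continuous_on {s\<in>{a..b}. \<gamma> s \<in> cdom c} v"
        "\<And>s. s \<in> {a..b} \<Longrightarrow> \<gamma> s \<in> cdom c \<Longrightarrow> ((cmap c \<circ> \<gamma>) has_vector_derivative v s) (at s within {a..b})"
      using C1[OF t'(1)] by blast
    obtain O' F D where O': "openin (mtop N) O'" "\<gamma> t \<in> O'" "O' \<subseteq> cdom c"
      "\<And>y. y \<in> O' \<Longrightarrow> f y \<in> cdom d" "\<And>y. y \<in> O' \<Longrightarrow> cmap d (f y) = F (cmap c y)"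
      "\<And>y. y \<in> O' \<Longrightarrow> (F has_derivative D y) (at (cmap c y))"
      "\<And>v. continuous_map (subtopology (mtop N) O') euclidean (\<lambda>y. D y v)"
      using smooth_isometry_local[OF N sm pr M[OF d] c d t'(2)] by metis
    define U where "U = {s \<in> {a..b}. \<gamma> s \<in> O'}"
    have der: "((cmap d \<circ> (f \<circ> \<gamma>)) has_vector_derivative D (\<gamma> s) (v s)) (at s within {a..b})" if s: "s \<in> U" for s
    proof (rule chart_curve_derivative[OF curve _ O'(1) _ O'(5) O'(6)])
      show "((cmap c \<circ> \<gamma>) has_vector_derivative v s) (at s within {a..b})"
        using v(2)[of s] s O'(3) unfolding U_def by auto
    qed (use s in \<open>auto simp: U_def\<close>)
    have w: "w s = D (\<gamma> s) (v s)" if "s \<in> U" for s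
      unfolding w_def using vector_derivative_within_cbox[OF ab, of s] der[OF that] that
      by (auto simp: U_def)
    have "continuous_on U (\<lambda>s. D (\<gamma> s) (v s))"
    proof (rule continuous_on_linear_apply[where A = "\<lambda>s. D (\<gamma> s)"])
      show "linear (D (\<gamma> s))" if "s \<in> U" for s
        using has_derivative_linear[OF O'(6)] that unfolding U_def by auto
      show "continuous_on U v"
        by (rule continuous_on_subset[OF v(1)]) (use O'(3) in \<open>auto simp: U_def\<close>)
      show "continuous_on U (\<lambda>t. D (\<gamma> t) z)" for z
      proof -
        have "continuous_map (top_of_set U) (subtopology (mtop N) O') \<gamma>"
        proof -
          have "U \<subseteq> {a..b}" "\<gamma> ` U \<subseteq> O'"
            unfolding U_def by auto
          then show ?thesis
            using continuous_map_from_subtopology_mono[OF curve, of U]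
            by (simp add: continuous_map_in_subtopology image_subset_iff_funcset)
        qed
        from continuous_map_compose[OF this O'(7)[of z]] show ?thesis
          by (simp add: o_def)
      qed
    qed
    then have "continuous_on U w"
      using w by (simp cong: continuous_on_cong)
    moreover have "t \<in> U" "U \<subseteq> ?T"
      using t' O'(2,4) unfolding U_def by auto
    moreover have "openin (top_of_set {a..b}) U"
      unfolding U_def by (rule curve_in_openin[OF curve O'(1)])
    ultimately show ?thesis
      using der[of t] w[of t] by auto
  qed
  have "continuous_on ?T w"
  proof (rule continuous_on_locally)
    fix t assume t: "t \<in> ?T"
    then obtain U where U: "openin (top_of_set {a..b}) U" "t \<in> U" "U \<subseteq> ?T" "continuous_on U w"
      using loc[OF t] by blast
    have "openin (top_of_set ?T) U"
      by (rule openin_subset_trans[OF U(1,3)]) auto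
    then show "\<exists>U. openin (top_of_set ?T) U \<and> t \<in> U \<and> continuous_on U w"
      using U by blast
  qed
  moreover have "((cmap d \<circ> (f \<circ> \<gamma>)) has_vector_derivative w t) (at t within {a..b})"
    if "t \<in> {a..b}" "(f \<circ> \<gamma>) t \<in> cdom d" for t
    using loc[of t] that by auto
  ultimately show "\<exists>v. continuous_on ?T v \<and> (\<forall>t\<in>{a..b}. (f \<circ> \<gamma>) t \<in> cdom d \<longrightarrow>
           ((cmap d \<circ> (f \<circ> \<gamma>)) has_vector_derivative v t) (at t within {a..b}))"
    by blast
qed

text \<open>For \<open>f = id\<close> this is the independence of the speed from the chart, required
  because \<open>speed\<close> selects its chart by \<open>SOME\<close>.\<close>

lemma rmetric_curve_derivative_image:
  assumes N: "riemannian_manifold N" and M: "\<And>d. d \<in> atlas M \<Longrightarrow> is_chart (mtop M) d"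
    and sm: "smooth_map N (mspace N) M f" and pr: "preserves_rmetric N (mspace N) (\<lambda>_ _. UNIV) M f"
    and curve: "curve_in N {a..b} \<gamma>" and ab: "a < b" and t: "t \<in> {a..b}"
    and c: "c \<in> atlas N" "\<gamma> t \<in> cdom c" and d: "d \<in> atlas M" "f (\<gamma> t) \<in> cdom d"
    and u: "((cmap c \<circ> \<gamma>) has_vector_derivative u) (at t within {a..b})"
    and w: "w = vector_derivative (cmap d \<circ> (f \<circ> \<gamma>)) (at t within {a..b})"
  shows "rmetric M d (f (\<gamma> t)) w w = rmetric N c (\<gamma> t) u u"
proof -
  obtain O' F D where O': "openin (mtop N) O'" "\<gamma> t \<in> O'"
    "\<And>y. y \<in> O' \<Longrightarrow> cmap d (f y) = F (cmap c y)"
    "\<And>y. y \<in> O' \<Longrightarrow> (F has_derivative D y) (at (cmap c y))"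
    "\<And>y u v. y \<in> O' \<Longrightarrow> rmetric M d (f y) (D y u) (D y v) = rmetric N c y u v"
    using smooth_isometry_local[OF N sm pr M[OF d(1)] c d] by metis
  have "((cmap d \<circ> (f \<circ> \<gamma>)) has_vector_derivative D (\<gamma> t) u) (at t within {a..b})"
    by (rule chart_curve_derivative[OF curve t O'(1,2,3) O'(4)[OF O'(2)] u])
  then have "w = D (\<gamma> t) u"
    unfolding w using vector_derivative_within_cbox[OF ab, of t] t by auto
  then show ?thesis
    using O'(5)[OF O'(2)] by simp
qed

lemma speed_eq:
  assumes N: "riemannian_manifold N" and curve: "curve_in N {0..1} \<gamma>" and t: "t \<in> {0..1}"
    and c: "c \<in> atlas N" "\<gamma> t \<in> cdom c"
    and u: "((cmap c \<circ> \<gamma>) has_vector_derivative u) (at t within {0..1})"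
  shows "speed N \<gamma> t = sqrt (rmetric N c (\<gamma> t) u u)"
proof -
  define d where "d = (SOME c. c \<in> atlas N \<and> \<gamma> t \<in> cdom c)"
  have "d \<in> atlas N \<and> \<gamma> t \<in> cdom d"
    unfolding d_def by (rule someI[of _ c]) (use c in simp)
  then show ?thesis
    using rmetric_curve_derivative_image[OF N riemannian_manifoldD(3)[OF N] riemannian_manifoldD(1,2)[OF N] curve _ t c _ _ u refl, of d]
    unfolding speed_def Let_def d_def[symmetric] by simp
qed

lemma bilinearD:
  assumes "bilinear B"
  shows "linear (B u)" "linear (\<lambda>u. B u v)"
  using assms unfolding bilinear_def by auto

lemma rmetric_nonneg:
  assumes "riemannian_manifold N" "c \<in> atlas N" "x \<in> cdom c"
  shows "0 \<le> rmetric N c x u u"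
proof (cases "u = 0")
  case True
  then show ?thesis
    using bilinear_lzero[OF riemannian_manifoldD(4)[OF assms]] by simp
next
  case False
  then show ?thesis
    using riemannian_manifoldD(6)[OF assms] by (simp add: less_imp_le)
qed

lemma rmetric_uminus:
  assumes "riemannian_manifold N" "c \<in> atlas N" "x \<in> cdom c"
  shows "rmetric N c x (- u) (- u) = rmetric N c x u u"
  using riemannian_manifoldD(4)[OF assms] by (simp add: bilinear_lneg bilinear_rneg)

lemma smooth_fun_on_continuous_on:
  assumes "smooth_fun_on A f"
  shows "continuous_on A f"
proof (rule continuous_on_locally)
  fix z assume z: "z \<in> A"
  obtain V F where V: "open V" "z \<in> V"
    "\<And>w. w \<in> V \<Longrightarrow> (F has_derivative frechet_derivative F (at w)) (at w)"
    "\<And>w. w \<in> A \<Longrightarrow> w \<in> V \<Longrightarrow> F w = f w"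
    using smooth_fun_on_extension[OF assms z] by metis
  have "continuous_on V F"
    using V(3) by (meson continuous_at_imp_continuous_on has_derivative_continuous)
  then have "continuous_on (A \<inter> V) F"
    by (rule continuous_on_subset) auto
  then have "continuous_on (A \<inter> V) f"
    by (rule continuous_on_eq) (use V(4) in auto)
  then show "\<exists>U. openin (top_of_set A) U \<and> z \<in> U \<and> continuous_on U f"
    using V(1,2) z by (intro exI[of _ "A \<inter> V"]) (auto simp: openin_open)
qed

lemma rmetric_continuous_on:
  assumes "riemannian_manifold N" "c \<in> atlas N"
  shows "continuous_on (cmap c ` cdom c) (\<lambda>z. rmetric N c (inv_into (cdom c) (cmap c) z) u v)"
  by (rule smooth_fun_on_continuous_on[OF riemannian_manifoldD(7)[OF assms]])

lemma rmetric_continuous_map: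
  assumes "riemannian_manifold N" "c \<in> atlas N"
  shows "continuous_map (subtopology (mtop N) (cdom c)) euclidean (\<lambda>y. rmetric N c y u v)"
proof -
  note ch = riemannian_manifoldD(3)[OF assms]
  have "continuous_map (subtopology (mtop N) (cdom c)) (top_of_set (cmap c ` cdom c)) (cmap c)"
    using homeomorphic_imp_continuous_map[OF is_chart_homeomorphic_map[OF ch]] .
  moreover have "continuous_map (top_of_set (cmap c ` cdom c)) euclidean
      (\<lambda>z. rmetric N c (inv_into (cdom c) (cmap c) z) u v)"
    using rmetric_continuous_on[OF assms] by simp
  ultimately have "continuous_map (subtopology (mtop N) (cdom c)) euclidean
      ((\<lambda>z. rmetric N c (inv_into (cdom c) (cmap c) z) u v) \<circ> cmap c)"
    by (rule continuous_map_compose)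
  then show ?thesis
    by (rule continuous_map_eq) (auto simp: inv_into_f_f[OF is_chart_inj_on[OF ch]])
qed

lemma rmetric_continuous_along:
  assumes N: "riemannian_manifold N" and c: "c \<in> atlas N"
    and curve: "curve_in N T \<gamma>" and T: "\<And>t. t \<in> T \<Longrightarrow> \<gamma> t \<in> cdom c" and v: "continuous_on T v"
  shows "continuous_on T (\<lambda>t. rmetric N c (\<gamma> t) (v t) (v t))"
proof -
  have bil: "bilinear (rmetric N c (\<gamma> t))" if "t \<in> T" for t
    using riemannian_manifoldD(4)[OF N c T[OF that]] .
  have "continuous_map (top_of_set T) (subtopology (mtop N) (cdom c)) \<gamma>"
    using curve T by (auto simp: continuous_map_in_subtopology)
  then have "continuous_map (top_of_set T) euclidean ((\<lambda>y. rmetric N c y u w) \<circ> \<gamma>)" for u w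
    by (rule continuous_map_compose[OF _ rmetric_continuous_map[OF N c]])
  then have uw: "continuous_on T (\<lambda>t. rmetric N c (\<gamma> t) u w)" for u w
    by (simp add: o_def)
  have uv: "continuous_on T (\<lambda>t. rmetric N c (\<gamma> t) u (v t))" for u
    by (rule continuous_on_linear_apply[where A = "\<lambda>t. rmetric N c (\<gamma> t) u", OF bilinearD(1)[OF bil] uw v])
  show ?thesis
    by (rule continuous_on_linear_apply[where A = "\<lambda>t u. rmetric N c (\<gamma> t) u (v t)", OF bilinearD(2)[OF bil] uv v])
qed

lemma C1_on_interval_derivative:
  assumes "C1_on_interval N \<gamma> a b" "c \<in> atlas N" "a < t" "t < b" "\<gamma> t \<in> cdom c"
  obtains u where "((cmap c \<circ> \<gamma>) has_vector_derivative u) (at t)"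
proof -
  obtain v where "\<And>t. t \<in> {a..b} \<Longrightarrow> \<gamma> t \<in> cdom c \<Longrightarrow> ((cmap c \<circ> \<gamma>) has_vector_derivative v t) (at t within {a..b})"
    using assms(1,2) unfolding C1_on_interval_def by blast
  then have "((cmap c \<circ> \<gamma>) has_vector_derivative v t) (at t within {a..b})"
    using assms by auto
  moreover have "at t within {a..b} = at t"
    using at_within_Icc_at assms by blast
  ultimately show thesis
    using that by simp
qed

lemma finite_avoiding_ball:
  fixes t :: real
  assumes "finite K"
  obtains m where "m > 0" "{t - m<..<t + m} \<inter> (K - {t}) = {}"
proof -
  have "open (- (K - {t}))"
    using assms by (intro open_Compl finite_imp_closed) auto
  then obtain e where e: "e > 0" "ball t e \<subseteq> - (K - {t})"
    by (metis ComplI Diff_iff insertI1 open_contains_ball)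
  then show thesis
    using that[of e] by (force simp: dist_real_def subset_iff)
qed

lemma piecewise_C1_curveE:
  assumes "piecewise_C1_curve N \<gamma>"
  obtains K where "finite K"
    "\<And>a b. 0 \<le> a \<Longrightarrow> a < b \<Longrightarrow> b \<le> 1 \<Longrightarrow> {a<..<b} \<inter> K = {} \<Longrightarrow> C1_on_interval N \<gamma> a b"
  using assms unfolding piecewise_C1_curve_def by blast

lemma piecewise_C1_curveI:
  assumes "curve_in N {0..1} \<gamma>" "finite K"
    and "\<And>a b. 0 \<le> a \<Longrightarrow> a < b \<Longrightarrow> b \<le> 1 \<Longrightarrow> {a<..<b} \<inter> K = {} \<Longrightarrow> C1_on_interval N \<gamma> a b"
  shows "piecewise_C1_curve N \<gamma>"
  unfolding piecewise_C1_curve_def pathin_def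
  using assms by (intro conjI exI[of _ K]) auto

lemma piecewise_C1_curve_in: "piecewise_C1_curve N \<gamma> \<Longrightarrow> curve_in N {0..1} \<gamma>"
  unfolding piecewise_C1_curve_def pathin_def by simp

text \<open>The end points are added to the exceptional set so that all remaining derivatives are
  two-sided. Such a derivative is the same within \<open>{0..1}\<close>, which \<open>speed\<close>
  uses, and within any smaller interval around the point.\<close>

lemma piecewise_C1_derivative:
  assumes "piecewise_C1_curve N \<gamma>"
  obtains K where "finite K" "0 \<in> K" "1 \<in> K"
    "\<And>t c. t \<in> {0..1} \<Longrightarrow> t \<notin> K \<Longrightarrow> c \<in> atlas N \<Longrightarrow> \<gamma> t \<in> cdom c \<Longrightarrow>
       \<exists>u. ((cmap c \<circ> \<gamma>) has_vector_derivative u) (at t)"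
proof -
  obtain K where K: "finite K"
    "\<And>a b. 0 \<le> a \<Longrightarrow> a < b \<Longrightarrow> b \<le> 1 \<Longrightarrow> {a<..<b} \<inter> K = {} \<Longrightarrow> C1_on_interval N \<gamma> a b"
    using piecewise_C1_curveE[OF assms] by metis
  show thesis
  proof
    show "finite (K \<union> {0, 1})"
      using K by simp
    fix t c assume t: "t \<in> {0..1}" "t \<notin> K \<union> {0, 1}" and c: "c \<in> atlas N" "\<gamma> t \<in> cdom c"
    then have t': "0 < t" "t < 1" "t \<notin> K"
      by auto
    obtain m where m: "m > 0" "{t - m<..<t + m} \<inter> (K - {t}) = {}"
      using finite_avoiding_ball[OF K(1)] by metis
    define a where "a = max 0 (t - m)"
    define b where "b = min 1 (t + m)"
    have ab: "0 \<le> a" "a < t" "t < b" "b \<le> 1"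
      using m(1) t'(1,2) by (auto simp: a_def b_def)
    have "{a<..<b} \<subseteq> {t - m<..<t + m}"
      by (auto simp: a_def b_def)
    then have "{a<..<b} \<inter> K = {}"
      using m(2) t'(3) by blast
    then have "C1_on_interval N \<gamma> a b"
      using K(2)[of a b] ab by auto
    then show "\<exists>u. ((cmap c \<circ> \<gamma>) has_vector_derivative u) (at t)"
      using C1_on_interval_derivative[of N \<gamma> a b c t] c ab(2,3) by metis
  qed auto
qed

lemma vector_derivative_at_within:
  assumes "(f has_vector_derivative u) (at t)" "t \<in> {a..b}" "a < b"
  shows "vector_derivative f (at t within {a..b}) = u"
  using vector_derivative_within_cbox[OF assms(3), of t f u] assms
  by (simp add: has_vector_derivative_at_within)

text \<open>Off a finite set both the curve and its image have derivatives in charts, and there the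
  two speeds agree because the differential preserves the metric. Finitely many parameters do not
  affect the integral.\<close>

lemma
  assumes N: "riemannian_manifold N" and M: "riemannian_manifold M"
    and sm: "smooth_map N (mspace N) M f" and pr: "preserves_rmetric N (mspace N) (\<lambda>_ _. UNIV) M f"
    and \<gamma>: "piecewise_C1_curve N \<gamma>"
  shows piecewise_C1_curve_image: "piecewise_C1_curve M (f \<circ> \<gamma>)"
    and curve_length_image: "curve_length M (f \<circ> \<gamma>) = curve_length N \<gamma>"
proof -
  note Mc = riemannian_manifoldD(3)[OF M]
  note curve = piecewise_C1_curve_in[OF \<gamma>]
  have curve': "curve_in M {0..1} (f \<circ> \<gamma>)"
    by (rule continuous_map_compose[OF curve smooth_map_continuous[OF sm]])
  have "C1_on_interval M (f \<circ> \<gamma>) a b" if ab: "0 \<le> a" "a < b" "b \<le> 1" and C1: "C1_on_interval N \<gamma> a b" for a b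
  proof (rule C1_on_interval_image[OF N Mc sm pr _ ab(2)])
    show curve_ab: "curve_in N {a..b} \<gamma>"
      by (rule continuous_map_from_subtopology_mono[OF curve]) (use ab in auto)
    fix t assume t: "t \<in> {a..b}"
    then have "\<gamma> t \<in> mspace N"
      by (rule curve_in_mspace[OF curve_ab])
    then obtain c where c: "c \<in> atlas N" "\<gamma> t \<in> cdom c"
      by (rule riemannian_chart_at[OF N])
    then show "\<exists>c\<in>atlas N. \<gamma> t \<in> cdom c \<and>
       (\<exists>v. continuous_on {s\<in>{a..b}. \<gamma> s \<in> cdom c} v \<and>
        (\<forall>s\<in>{a..b}. \<gamma> s \<in> cdom c \<longrightarrow> ((cmap c \<circ> \<gamma>) has_vector_derivative v s) (at s within {a..b})))"
      using bspec[OF C1[unfolded C1_on_interval_def] c(1)] by (intro bexI[OF _ c(1)] conjI)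
  qed
  note C1_image = this
  obtain K0 where K0: "finite K0"
    "\<And>a b. 0 \<le> a \<Longrightarrow> a < b \<Longrightarrow> b \<le> 1 \<Longrightarrow> {a<..<b} \<inter> K0 = {} \<Longrightarrow> C1_on_interval N \<gamma> a b"
    using piecewise_C1_curveE[OF \<gamma>] by metis
  show pc: "piecewise_C1_curve M (f \<circ> \<gamma>)"
    by (rule piecewise_C1_curveI[OF curve' K0(1)]) (rule C1_image; use K0(2) in auto)
  obtain K where K: "finite K"
    "\<And>t c. t \<in> {0..1} \<Longrightarrow> t \<notin> K \<Longrightarrow> c \<in> atlas N \<Longrightarrow> \<gamma> t \<in> cdom c \<Longrightarrow>
       \<exists>u. ((cmap c \<circ> \<gamma>) has_vector_derivative u) (at t)"
    using piecewise_C1_derivative[OF \<gamma>] by metis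
  obtain K' where K': "finite K'"
    "\<And>t c. t \<in> {0..1} \<Longrightarrow> t \<notin> K' \<Longrightarrow> c \<in> atlas M \<Longrightarrow> (f \<circ> \<gamma>) t \<in> cdom c \<Longrightarrow>
       \<exists>u. ((cmap c \<circ> (f \<circ> \<gamma>)) has_vector_derivative u) (at t)"
    using piecewise_C1_derivative[OF pc] by metis
  have "speed M (f \<circ> \<gamma>) t = speed N \<gamma> t" if t: "t \<in> {0..1} - (K \<union> K')" for t
  proof -
    have t01: "t \<in> {0..1}"
      using t by auto
    obtain c where c: "c \<in> atlas N" "\<gamma> t \<in> cdom c"
      using riemannian_chart_at[OF N curve_in_mspace[OF curve t01]] by metis
    obtain d where d: "d \<in> atlas M" "(f \<circ> \<gamma>) t \<in> cdom d"
      using riemannian_chart_at[OF M curve_in_mspace[OF curve' t01]] by metis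
    obtain u where u: "((cmap c \<circ> \<gamma>) has_vector_derivative u) (at t)"
      using K(2)[OF t01 _ c] t by auto
    obtain w where w: "((cmap d \<circ> (f \<circ> \<gamma>)) has_vector_derivative w) (at t)"
      using K'(2)[OF t01 _ d] t by auto
    have "w = vector_derivative (cmap d \<circ> (f \<circ> \<gamma>)) (at t within {0..1})"
      using vector_derivative_at_within[OF w t01] by simp
    then have "rmetric M d ((f \<circ> \<gamma>) t) w w = rmetric N c (\<gamma> t) u u"
      using rmetric_curve_derivative_image[OF N Mc sm pr curve _ t01 c d(1) _ has_vector_derivative_at_within[OF u]] d(2)
      by simp
    then show ?thesis
      using speed_eq[OF N curve t01 c has_vector_derivative_at_within[OF u]]
        speed_eq[OF M curve' t01 d has_vector_derivative_at_within[OF w]] by simp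
  qed
  then show "curve_length M (f \<circ> \<gamma>) = curve_length N \<gamma>"
    unfolding curve_length_def
    by (intro integral_spike[OF negligible_finite, of "K \<union> K'"]) (use K(1) K'(1) in auto)
qed

text \<open>Induction on the number of exceptional points in the open interval, splitting at one of
  them.\<close>

lemma integrable_on_piecewise:
  fixes f :: "real \<Rightarrow> real"
  assumes "finite K"
    and "\<And>a b. l \<le> a \<Longrightarrow> a < b \<Longrightarrow> b \<le> h \<Longrightarrow> {a<..<b} \<inter> K = {} \<Longrightarrow> f integrable_on {a..b}"
  shows "f integrable_on {l..h}"
proof -
  have "f integrable_on {a..b}" if "l \<le> a" "a \<le> b" "b \<le> h" "n = card ({a<..<b} \<inter> K)" for n a b
    using that
  proof (induction n arbitrary: a b rule: less_induct)
    case (less n)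
    show ?case
    proof (cases "a = b \<or> {a<..<b} \<inter> K = {}")
      case True
      then show ?thesis
        using assms(2)[of a b] less.prems integrable_on_refl[of f b] by (cases "a = b") auto
    next
      case False
      then obtain k where k: "k \<in> K" "a < k" "k < b"
        by auto
      have "card ({a<..<k} \<inter> K) < n" "card ({k<..<b} \<inter> K) < n"
        unfolding less.prems(4) using k assms(1) by (auto intro!: psubset_card_mono)
      then have "f integrable_on {a..k}" "f integrable_on {k..b}"
        using less.IH k less.prems by auto
      then show ?thesis
        using k by (meson Henstock_Kurzweil_Integration.integrable_combine less_imp_le)
    qed
  qed
  then show ?thesis
    by (cases "l \<le> h") auto
qed

text \<open>At \<open>a\<close> and \<open>b\<close> the derivative within \<open>{0..1}\<close>
  used by \<open>speed\<close> may fail to exist. The function \<open>\<sigma>\<close> takes the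
  derivative within \<open>{a..b}\<close> instead; it is continuous up to the end points and differs
  from the speed at most there.\<close>

lemma speed_integrable_C1:
  assumes N: "riemannian_manifold N" and curve: "curve_in N {0..1} \<gamma>"
    and ab: "0 \<le> a" "a < b" "b \<le> 1" and C1: "C1_on_interval N \<gamma> a b"
  shows "speed N \<gamma> integrable_on {a..b}"
proof -
  note Nc = riemannian_manifoldD(3)[OF N]
  have curve_ab: "curve_in N {a..b} \<gamma>"
    by (rule continuous_map_from_subtopology_mono[OF curve]) (use ab in auto)
  define d where "d t = (SOME c. c \<in> atlas N \<and> \<gamma> t \<in> cdom c)" for t
  have d: "d t \<in> atlas N" "\<gamma> t \<in> cdom (d t)" if t: "t \<in> {a..b}" for t
  proof -
    obtain c where "c \<in> atlas N \<and> \<gamma> t \<in> cdom c"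
      using riemannian_chart_at[OF N curve_in_mspace[OF curve_ab t]] by metis
    then have "d t \<in> atlas N \<and> \<gamma> t \<in> cdom (d t)"
      unfolding d_def by (rule someI)
    then show "d t \<in> atlas N" "\<gamma> t \<in> cdom (d t)"
      by auto
  qed
  define u where "u t = vector_derivative (cmap (d t) \<circ> \<gamma>) (at t within {a..b})" for t
  define \<sigma> where "\<sigma> t = sqrt (rmetric N (d t) (\<gamma> t) (u t) (u t))" for t
  have "continuous_on {a..b} \<sigma>"
  proof (rule continuous_on_locally)
    fix t0 assume t0: "t0 \<in> {a..b}"
    let ?c = "d t0"
    let ?T = "{t \<in> {a..b}. \<gamma> t \<in> cdom ?c}"
    note c = d[OF t0]
    obtain v where v: "continuous_on ?T v"
      "\<And>t. t \<in> {a..b} \<Longrightarrow> \<gamma> t \<in> cdom ?c \<Longrightarrow> ((cmap ?c \<circ> \<gamma>) has_vector_derivative v t) (at t within {a..b})"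
      using C1 c(1) unfolding C1_on_interval_def by blast
    \<comment> \<open>The chosen chart \<open>d t\<close> may jump with \<open>t\<close>. By
      independence of the chart, \<open>\<sigma>\<close> can be computed near \<open>t0\<close> in
      the fixed chart \<open>d t0\<close>.\<close>
    have "sqrt (rmetric N ?c (\<gamma> t) (v t) (v t)) = \<sigma> t" if t: "t \<in> ?T" for t
      using rmetric_curve_derivative_image[OF N Nc riemannian_manifoldD(1,2)[OF N] curve_ab ab(2) _ c(1) _ _ _ v(2) refl, of t "d t"]
        t d[of t] unfolding \<sigma>_def u_def by simp
    moreover have "continuous_on ?T (\<lambda>t. sqrt (rmetric N ?c (\<gamma> t) (v t) (v t)))"
      by (intro continuous_on_real_sqrt rmetric_continuous_along[OF N c(1) _ _ v(1)])
         (auto intro: continuous_map_from_subtopology_mono[OF curve_ab])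
    ultimately have "continuous_on ?T \<sigma>"
      using continuous_on_eq by blast
    then show "\<exists>U. openin (top_of_set {a..b}) U \<and> t0 \<in> U \<and> continuous_on U \<sigma>"
      using curve_in_openin[OF curve_ab is_chart_openin[OF Nc[OF c(1)]]] t0 c(2)
      by (intro exI[of _ ?T]) auto
  qed
  then have "\<sigma> integrable_on {a..b}"
    by (rule integrable_continuous_real)
  moreover have "speed N \<gamma> t = \<sigma> t" if t: "t \<in> {a..b} - {a, b}" for t
  proof -
    have t': "a < t" "t < b" "t \<in> {a..b}" "t \<in> {0..1}"
      using t ab by auto
    obtain w where w: "((cmap (d t) \<circ> \<gamma>) has_vector_derivative w) (at t)"
      using C1_on_interval_derivative[OF C1 d(1)[OF t'(3)] t'(1,2) d(2)[OF t'(3)]] by metis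
    then have "u t = w"
      unfolding u_def using vector_derivative_at_within[OF w t'(3) ab(2)] by simp
    then show ?thesis
      unfolding \<sigma>_def
      using speed_eq[OF N curve t'(4) d[OF t'(3)] has_vector_derivative_at_within[OF w]] by simp
  qed
  ultimately show ?thesis
    by (intro integrable_spike_finite[of "{a, b}" _ "speed N \<gamma>" \<sigma>]) auto
qed

lemma speed_integrable:
  assumes N: "riemannian_manifold N" and \<gamma>: "piecewise_C1_curve N \<gamma>"
  shows "speed N \<gamma> integrable_on {0..1}"
proof -
  obtain K where K: "finite K"
    "\<And>a b. 0 \<le> a \<Longrightarrow> a < b \<Longrightarrow> b \<le> 1 \<Longrightarrow> {a<..<b} \<inter> K = {} \<Longrightarrow> C1_on_interval N \<gamma> a b"
    using piecewise_C1_curveE[OF \<gamma>] by metis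
  show ?thesis
    by (rule integrable_on_piecewise[OF K(1)])
       (rule speed_integrable_C1[OF N piecewise_C1_curve_in[OF \<gamma>]]; use K(2) in auto)
qed

lemma curve_length_nonneg:
  assumes N: "riemannian_manifold N" and \<gamma>: "piecewise_C1_curve N \<gamma>"
  shows "0 \<le> curve_length N \<gamma>"
  unfolding curve_length_def
proof (rule integral_nonneg[OF speed_integrable[OF assms]])
  fix t :: real assume t: "t \<in> {0..1}"
  define d where "d = (SOME c. c \<in> atlas N \<and> \<gamma> t \<in> cdom c)"
  obtain c where "c \<in> atlas N \<and> \<gamma> t \<in> cdom c"
    using riemannian_chart_at[OF N curve_in_mspace[OF piecewise_C1_curve_in[OF \<gamma>] t]] by metis
  then have "d \<in> atlas N \<and> \<gamma> t \<in> cdom d"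
    unfolding d_def by (rule someI)
  then show "0 \<le> speed N \<gamma> t"
    unfolding speed_def Let_def d_def[symmetric] by (simp add: rmetric_nonneg[OF N])
qed

section \<open>Reparametrisation, reversal and concatenation of curves\<close>

lemma C1_on_interval_cong:
  assumes "C1_on_interval N \<gamma> a b" "\<And>t. t \<in> {a..b} \<Longrightarrow> \<gamma>' t = \<gamma> t"
  shows "C1_on_interval N \<gamma>' a b"
  unfolding C1_on_interval_def
proof
  fix c assume "c \<in> atlas N"
  then obtain v where v: "continuous_on {t\<in>{a..b}. \<gamma> t \<in> cdom c} v"
      "\<And>t. t \<in> {a..b} \<Longrightarrow> \<gamma> t \<in> cdom c \<Longrightarrow> ((cmap c \<circ> \<gamma>) has_vector_derivative v t) (at t within {a..b})"
    using assms(1) unfolding C1_on_interval_def by blast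
  have "{t\<in>{a..b}. \<gamma>' t \<in> cdom c} = {t\<in>{a..b}. \<gamma> t \<in> cdom c}"
    using assms(2) by auto
  moreover have "((cmap c \<circ> \<gamma>') has_vector_derivative v t) (at t within {a..b})"
    if t: "t \<in> {a..b}" "\<gamma>' t \<in> cdom c" for t
    by (rule has_vector_derivative_transform[OF t(1) _ v(2)]) (use t assms(2) in auto)
  ultimately show "\<exists>v. continuous_on {t\<in>{a..b}. \<gamma>' t \<in> cdom c} v \<and>
        (\<forall>t\<in>{a..b}. \<gamma>' t \<in> cdom c \<longrightarrow>
           ((cmap c \<circ> \<gamma>') has_vector_derivative v t) (at t within {a..b}))"
    using v(1) by auto
qed

lemma C1_on_interval_affine:
  assumes C1: "C1_on_interval N \<gamma> a b" and sub: "(\<lambda>t. m * t + q) ` {a'..b'} \<subseteq> {a..b}"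
  shows "C1_on_interval N (\<lambda>t. \<gamma> (m * t + q)) a' b'"
  unfolding C1_on_interval_def
proof
  fix c assume "c \<in> atlas N"
  then obtain v where v: "continuous_on {t\<in>{a..b}. \<gamma> t \<in> cdom c} v"
      "\<And>t. t \<in> {a..b} \<Longrightarrow> \<gamma> t \<in> cdom c \<Longrightarrow> ((cmap c \<circ> \<gamma>) has_vector_derivative v t) (at t within {a..b})"
    using C1 unfolding C1_on_interval_def by blast
  have sub': "m * t + q \<in> {a..b}" if "t \<in> {a'..b'}" for t
    using sub that by blast
  have "continuous_on {t\<in>{a'..b'}. \<gamma> (m * t + q) \<in> cdom c} (\<lambda>t. m *\<^sub>R v (m * t + q))"
    by (intro continuous_intros continuous_on_compose2[OF v(1)]) (use sub' in auto)
  moreover have "((cmap c \<circ> (\<lambda>t. \<gamma> (m * t + q))) has_vector_derivative m *\<^sub>R v (m * t + q)) (at t within {a'..b'})"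
    if t: "t \<in> {a'..b'}" "\<gamma> (m * t + q) \<in> cdom c" for t
  proof -
    have "((cmap c \<circ> \<gamma>) has_vector_derivative v (m * t + q)) (at (m * t + q) within (\<lambda>t. m * t + q) ` {a'..b'})"
      by (rule has_vector_derivative_within_subset[OF v(2)[OF sub'[OF t(1)] t(2)] sub])
    moreover have "((\<lambda>t. m * t + q) has_vector_derivative m) (at t within {a'..b'})"
      by (auto intro!: derivative_eq_intros simp: has_real_derivative_iff_has_vector_derivative[symmetric])
    ultimately show ?thesis
      using vector_diff_chain_within[of "\<lambda>t. m * t + q" m t "{a'..b'}" "cmap c \<circ> \<gamma>" "v (m * t + q)"]
      by (simp add: o_def)
  qed
  ultimately show "\<exists>v. continuous_on {t\<in>{a'..b'}. \<gamma> (m * t + q) \<in> cdom c} v \<and>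
        (\<forall>t\<in>{a'..b'}. \<gamma> (m * t + q) \<in> cdom c \<longrightarrow>
           ((cmap c \<circ> (\<lambda>t. \<gamma> (m * t + q))) has_vector_derivative v t) (at t within {a'..b'}))"
    by (intro exI[of _ "\<lambda>t. m *\<^sub>R v (m * t + q)"]) auto
qed

lemma curve_in_affine:
  assumes "curve_in N T \<gamma>" "(\<lambda>t. m * t + q) ` T' \<subseteq> T"
  shows "curve_in N T' (\<lambda>t. \<gamma> (m * t + q))"
proof -
  have "continuous_map (top_of_set T') (top_of_set T) (\<lambda>t. m * t + q)"
    using assms(2) by (auto simp: continuous_map_in_subtopology image_subset_iff_funcset intro!: continuous_intros)
  from continuous_map_compose[OF this assms(1)] show ?thesis
    by (simp add: o_def)
qed

text \<open>The velocity changes its sign and the metric does not notice. The term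
  \<open>- 1 * t + 1\<close> keeps the shape \<open>m * t + q\<close> of the affine lemmas.\<close>

lemma
  assumes N: "riemannian_manifold N" and \<gamma>: "piecewise_C1_curve N \<gamma>"
  shows piecewise_C1_curve_reverse: "piecewise_C1_curve N (\<lambda>t. \<gamma> (- 1 * t + 1))"
    and curve_length_reverse: "curve_length N (\<lambda>t. \<gamma> (- 1 * t + 1)) = curve_length N \<gamma>"
proof -
  let ?r = "\<lambda>t. \<gamma> (- 1 * t + 1)"
  note curve = piecewise_C1_curve_in[OF \<gamma>]
  have curve': "curve_in N {0..1} ?r"
    by (rule curve_in_affine[OF curve]) auto
  obtain K where K: "finite K"
    "\<And>a b. 0 \<le> a \<Longrightarrow> a < b \<Longrightarrow> b \<le> 1 \<Longrightarrow> {a<..<b} \<inter> K = {} \<Longrightarrow> C1_on_interval N \<gamma> a b"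
    using piecewise_C1_curveE[OF \<gamma>] by metis
  have "C1_on_interval N ?r a b" if ab: "0 \<le> a" "a < b" "b \<le> 1" "{a<..<b} \<inter> (\<lambda>t. 1 - t) ` K = {}" for a b
  proof (rule C1_on_interval_affine)
    show "C1_on_interval N \<gamma> (1 - b) (1 - a)"
    proof (rule K(2))
      show "{1 - b<..<1 - a} \<inter> K = {}"
      proof (rule ccontr)
        assume "{1 - b<..<1 - a} \<inter> K \<noteq> {}"
        then obtain k where "k \<in> K" "1 - b < k" "k < 1 - a"
          by auto
        then have "1 - k \<in> {a<..<b} \<inter> (\<lambda>t. 1 - t) ` K"
          by auto
        then show False
          using ab(4) by blast
      qed
    qed (use ab in auto)
  qed auto
  then show pc: "piecewise_C1_curve N ?r"
    by (rule piecewise_C1_curveI[OF curve' finite_imageI[OF K(1)]])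
  obtain K1 where K1: "finite K1"
    "\<And>t c. t \<in> {0..1} \<Longrightarrow> t \<notin> K1 \<Longrightarrow> c \<in> atlas N \<Longrightarrow> \<gamma> t \<in> cdom c \<Longrightarrow>
       \<exists>u. ((cmap c \<circ> \<gamma>) has_vector_derivative u) (at t)"
    using piecewise_C1_derivative[OF \<gamma>] by metis
  have sp: "speed N ?r t = speed N \<gamma> (- 1 * t + 1)" if t: "t \<in> {0..1} - (\<lambda>t. 1 - t) ` K1" for t
  proof -
    have t01: "t \<in> {0..1}" "- 1 * t + 1 \<in> {0..1}"
      using t by auto
    have nK: "- 1 * t + 1 \<notin> K1"
    proof
      assume "- 1 * t + 1 \<in> K1"
      then have "1 - (- 1 * t + 1) \<in> (\<lambda>t. 1 - t) ` K1"
        by (rule imageI)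
      then show False
        using t by simp
    qed
    obtain c where c: "c \<in> atlas N" "\<gamma> (- 1 * t + 1) \<in> cdom c"
      using riemannian_chart_at[OF N curve_in_mspace[OF curve t01(2)]] by metis
    obtain u where u: "((cmap c \<circ> \<gamma>) has_vector_derivative u) (at (- 1 * t + 1))"
      using K1(2)[OF t01(2) nK c] by auto
    have "((\<lambda>t. - 1 * t + 1) has_vector_derivative - 1) (at t within {0..1})"
      by (auto intro!: derivative_eq_intros simp: has_real_derivative_iff_has_vector_derivative[symmetric])
    then have "(((cmap c \<circ> \<gamma>) \<circ> (\<lambda>t. - 1 * t + 1)) has_vector_derivative - 1 *\<^sub>R u) (at t within {0..1})"
      by (rule vector_diff_chain_within) (rule has_vector_derivative_at_within[OF u])
    then have "((cmap c \<circ> ?r) has_vector_derivative - u) (at t within {0..1})"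
      by (simp add: o_def)
    from speed_eq[OF N curve' t01(1) c this]
    show ?thesis
      using speed_eq[OF N curve t01(2) c has_vector_derivative_at_within[OF u]]
        rmetric_uminus[OF N c] by simp
  qed
  have "((\<lambda>t. speed N \<gamma> (- 1 * t + 1)) has_integral curve_length N \<gamma>) {0..1}"
  proof -
    have "(speed N \<gamma> has_integral curve_length N \<gamma>) (cbox 0 1)"
      unfolding curve_length_def using integrable_integral[OF speed_integrable[OF N \<gamma>]] by simp
    from has_integral_affinity[OF this, of "- 1" 1]
    have "((\<lambda>t. speed N \<gamma> (- 1 * t + 1)) has_integral curve_length N \<gamma>) ((\<lambda>x. 1 - x) ` {0..1})"
      by (simp add: o_def)
    moreover have "(\<lambda>x. 1 - x) ` {0..1::real} = {0..1}"
      by (auto intro!: image_eqI[where x = "1 - _"])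
    ultimately show ?thesis
      by simp
  qed
  then have "integral {0..1} (\<lambda>t. speed N \<gamma> (- 1 * t + 1)) = curve_length N \<gamma>"
    by (rule integral_unique)
  moreover have "integral {0..1} (\<lambda>t. speed N \<gamma> (- 1 * t + 1)) = integral {0..1} (speed N ?r)"
    by (rule integral_spike[OF negligible_finite, of "(\<lambda>t. 1 - t) ` K1"]) (use K1(1) sp in auto)
  ultimately show "curve_length N ?r = curve_length N \<gamma>"
    unfolding curve_length_def by simp
qed

text \<open>The corner at \<open>1 / 2\<close> joins the break points. Only the existence of the
  joined curve matters: its length is never computed, since the triangle inequality for leaves comes
  from joining sequences of leaves.\<close>

lemma piecewise_C1_curve_join:
  assumes \<gamma>1: "piecewise_C1_curve N \<gamma>1" and \<gamma>2: "piecewise_C1_curve N \<gamma>2" and eq: "\<gamma>1 1 = \<gamma>2 0"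
  shows "piecewise_C1_curve N (\<lambda>t. if t \<le> 1 / 2 then \<gamma>1 (2 * t + 0) else \<gamma>2 (2 * t + - 1))" (is "piecewise_C1_curve N ?\<gamma>")
proof -
  obtain K1 where K1: "finite K1"
    "\<And>a b. 0 \<le> a \<Longrightarrow> a < b \<Longrightarrow> b \<le> 1 \<Longrightarrow> {a<..<b} \<inter> K1 = {} \<Longrightarrow> C1_on_interval N \<gamma>1 a b"
    using piecewise_C1_curveE[OF \<gamma>1] by metis
  obtain K2 where K2: "finite K2"
    "\<And>a b. 0 \<le> a \<Longrightarrow> a < b \<Longrightarrow> b \<le> 1 \<Longrightarrow> {a<..<b} \<inter> K2 = {} \<Longrightarrow> C1_on_interval N \<gamma>2 a b"
    using piecewise_C1_curveE[OF \<gamma>2] by metis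
  define K where "K = insert (1 / 2) ((\<lambda>k. k / 2) ` K1 \<union> (\<lambda>k. (k + 1) / 2) ` K2)"
  have 2: "?\<gamma> t = \<gamma>2 (2 * t + - 1)" if "t \<ge> 1 / 2" for t
  proof (cases "t = 1 / 2")
    case True
    then show ?thesis
      unfolding True using eq by simp
  qed (use that in auto)
  have "C1_on_interval N ?\<gamma> a b" if ab: "0 \<le> a" "a < b" "b \<le> 1" "{a<..<b} \<inter> K = {}" for a b
  proof -
    have no: "k \<notin> K" if "a < k" "k < b" for k
      using that ab(4) by auto
    consider "b \<le> 1 / 2" | "1 / 2 \<le> a"
      using no[of "1 / 2"] unfolding K_def by (cases "b \<le> 1 / 2"; cases "1 / 2 \<le> a") auto
    then show ?thesis
    proof cases
      case 1
      have "k \<notin> {2 * a<..<2 * b}" if "k \<in> K1" for k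
        using no[of "k / 2"] that unfolding K_def by auto
      then have "{2 * a<..<2 * b} \<inter> K1 = {}"
        by blast
      then have "C1_on_interval N \<gamma>1 (2 * a) (2 * b)"
        using K1(2)[of "2 * a" "2 * b"] ab 1 by auto
      then have "C1_on_interval N (\<lambda>t. \<gamma>1 (2 * t + 0)) a b"
        by (rule C1_on_interval_affine) auto
      then show ?thesis
        by (rule C1_on_interval_cong) (use 1 in auto)
    next
      case 22: 2
      have "k \<notin> {2 * a - 1<..<2 * b - 1}" if "k \<in> K2" for k
        using no[of "(k + 1) / 2"] that unfolding K_def by auto
      then have "{2 * a - 1<..<2 * b - 1} \<inter> K2 = {}"
        by blast
      then have "C1_on_interval N \<gamma>2 (2 * a - 1) (2 * b - 1)"
        using K2(2)[of "2 * a - 1" "2 * b - 1"] ab 22 by auto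
      then have "C1_on_interval N (\<lambda>t. \<gamma>2 (2 * t + - 1)) a b"
        by (rule C1_on_interval_affine) auto
      then show ?thesis
        by (rule C1_on_interval_cong) (rule 2, use 22 in auto)
    qed
  qed
  moreover have "finite K"
    unfolding K_def using K1(1) K2(1) by simp
  moreover have "curve_in N {0..1} ?\<gamma>"
  proof (rule continuous_map_cases_le)
    show "continuous_map (subtopology (top_of_set {0..1}) {x \<in> topspace (top_of_set {0..1}). x \<le> 1 / 2}) (mtop N) (\<lambda>t. \<gamma>1 (2 * t + 0))"
      unfolding subtopology_subtopology
      by (rule curve_in_affine[OF piecewise_C1_curve_in[OF \<gamma>1]]) auto
    show "continuous_map (subtopology (top_of_set {0..1}) {x \<in> topspace (top_of_set {0..1}). 1 / 2 \<le> x}) (mtop N) (\<lambda>t. \<gamma>2 (2 * t + - 1))"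
      unfolding subtopology_subtopology
      by (rule curve_in_affine[OF piecewise_C1_curve_in[OF \<gamma>2]]) auto
    show "\<gamma>1 (2 * t + 0) = \<gamma>2 (2 * t + - 1)" if "t = 1 / 2" for t
      unfolding that using eq by simp
  qed auto
  ultimately show ?thesis
    using piecewise_C1_curveI by blast
qed

section \<open>Inner products\<close>

text \<open>The metric at a point is an inner product on coordinate vectors that differs from the
  standard one of the type, so the facts of Euclidean geometry are derived for general
  forms.\<close>

definition inner_form :: "('v::real_vector \<Rightarrow> 'v \<Rightarrow> real) \<Rightarrow> bool" where
  "inner_form B \<longleftrightarrow> bilinear B \<and> (\<forall>u v. B u v = B v u) \<and> (\<forall>u. u \<noteq> 0 \<longrightarrow> 0 < B u u)"

lemma rmetric_inner_form:
  "riemannian_manifold N \<Longrightarrow> c \<in> atlas N \<Longrightarrow> x \<in> cdom c \<Longrightarrow> inner_form (rmetric N c x)"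
  unfolding inner_form_def by (simp add: riemannian_manifoldD(4-6))

lemma inner_form_nonneg:
  assumes "inner_form B"
  shows "0 \<le> B u u"
  using assms unfolding inner_form_def by (cases "u = 0") (auto simp: bilinear_lzero less_imp_le)

lemma inner_form_Cauchy_Schwarz:
  assumes B: "inner_form B"
  shows "(B u v)\<^sup>2 \<le> B u u * B v v"
proof (cases "v = 0")
  case True
  then show ?thesis
    using B unfolding inner_form_def by (simp add: bilinear_lzero bilinear_rzero)
next
  case False
  have bil: "bilinear B" and sym: "B v u = B u v" and pos: "0 < B v v"
    using B False unfolding inner_form_def by auto
  \<comment> \<open>The minimiser of the quadratic polynomial \<open>B (u - t v) (u - t v)\<close>
    in \<open>t\<close>.\<close>
  define t where "t = B u v / B v v"
  have "0 \<le> B (u - t *\<^sub>R v) (u - t *\<^sub>R v)"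
    by (rule inner_form_nonneg[OF B])
  also have "\<dots> = B u u - 2 * t * B u v + t * t * B v v"
    by (simp add: bilinear_lsub[OF bil] bilinear_rsub[OF bil] bilinear_lmul[OF bil] bilinear_rmul[OF bil] sym algebra_simps)
  also have "\<dots> = B u u - (B u v)\<^sup>2 / B v v"
    using pos by (simp add: t_def power2_eq_square field_simps)
  finally show ?thesis
    using pos by (simp add: field_simps)
qed

lemma inner_form_triangle:
  assumes B: "inner_form B"
  shows "sqrt (B (u + v) (u + v)) \<le> sqrt (B u u) + sqrt (B v v)"
proof (rule real_le_lsqrt)
  have bil: "bilinear B" and sym: "B v u = B u v"
    using B unfolding inner_form_def by auto
  have "B u v \<le> sqrt (B u u * B v v)"
    by (rule real_le_rsqrt[OF inner_form_Cauchy_Schwarz[OF B]])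
  then show "B (u + v) (u + v) \<le> (sqrt (B u u) + sqrt (B v v))\<^sup>2"
    using inner_form_nonneg[OF B]
    by (simp add: bilinear_ladd[OF bil] bilinear_radd[OF bil] sym power2_sum real_sqrt_mult)
qed (use inner_form_nonneg[OF B] in simp)

lemma inner_form_scale:
  assumes B: "inner_form B"
  shows "sqrt (B (t *\<^sub>R u) (t *\<^sub>R u)) = \<bar>t\<bar> * sqrt (B u u)"
proof -
  have bil: "bilinear B"
    using B unfolding inner_form_def by auto
  have "B (t *\<^sub>R u) (t *\<^sub>R u) = t\<^sup>2 * B u u"
    by (simp add: bilinear_lmul[OF bil] bilinear_rmul[OF bil] power2_eq_square)
  then show ?thesis
    by (simp add: real_sqrt_mult)
qed

lemma inner_form_upper:
  fixes B :: "'v::euclidean_space \<Rightarrow> 'v \<Rightarrow> real"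
  assumes B: "inner_form B"
  obtains C where "C > 0" "\<And>u. sqrt (B u u) \<le> C * norm u"
proof -
  obtain b where b: "b > 0" "\<And>x y. norm (B x y) \<le> b * norm x * norm y"
    using bilinear_bounded_pos[of B] B unfolding inner_form_def by blast
  show thesis
  proof
    show "sqrt b > 0"
      using b by simp
    show "sqrt (B u u) \<le> sqrt b * norm u" for u
    proof -
      have "B u u \<le> b * (norm u)\<^sup>2"
        using b(2)[of u u] by (simp add: power2_eq_square mult.assoc)
      then have "sqrt (B u u) \<le> sqrt (b * (norm u)\<^sup>2)"
        by simp
      then show ?thesis
        by (simp add: real_sqrt_mult)
    qed
  qed
qed

text \<open>The form attains a positive minimum on the compact unit sphere; homogeneity does the
  rest.\<close>

lemma inner_form_lower:
  fixes B :: "'v::euclidean_space \<Rightarrow> 'v \<Rightarrow> real"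
  assumes B: "inner_form B"
  obtains m where "m > 0" "\<And>u. m * norm u \<le> sqrt (B u u)"
proof -
  have bb: "bounded_bilinear B"
    using B unfolding inner_form_def bilinear_conv_bounded_bilinear by auto
  have "continuous_on (sphere 0 1) (\<lambda>u. B u u)"
    by (intro bounded_bilinear.continuous_on[OF bb] continuous_on_id)
  then obtain u0 where u0: "u0 \<in> sphere 0 1" "\<And>u. u \<in> sphere 0 1 \<Longrightarrow> B u0 u0 \<le> B u u"
    using continuous_attains_inf[of "sphere (0::'v) 1" "\<lambda>u. B u u"] by auto
  have "u0 \<noteq> 0"
    using u0(1) by auto
  then have pos: "0 < B u0 u0"
    using B unfolding inner_form_def by auto
  show thesis
  proof
    show "sqrt (B u0 u0) > 0"
      using pos by simp
    show "sqrt (B u0 u0) * norm u \<le> sqrt (B u u)" for u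
    proof (cases "u = 0")
      case False
      have "sqrt (B u0 u0) \<le> sqrt (B ((1 / norm u) *\<^sub>R u) ((1 / norm u) *\<^sub>R u))"
        using u0(2)[of "(1 / norm u) *\<^sub>R u"] False by simp
      also have "\<dots> = sqrt (B u u) / norm u"
        by (subst inner_form_scale[OF B]) simp
      finally show ?thesis
        using False by (simp add: field_simps)
    qed (use inner_form_nonneg[OF B] in simp)
  qed
qed

lemma bilinear_expand:
  fixes B :: "'v::euclidean_space \<Rightarrow> 'v \<Rightarrow> real"
  assumes "bilinear B"
  shows "B u u = (\<Sum>b\<in>Basis. \<Sum>b'\<in>Basis. (u \<bullet> b) * (u \<bullet> b') * B b b')"
proof -
  have "B u u = B (\<Sum>b\<in>Basis. (u \<bullet> b) *\<^sub>R b) u"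
    by (simp add: euclidean_representation)
  also have "\<dots> = (\<Sum>b\<in>Basis. (u \<bullet> b) * B b u)"
    using linear_sum[OF bilinearD(2)[OF assms, of u], of "\<lambda>b. (u \<bullet> b) *\<^sub>R b" Basis]
    by (simp add: bilinear_lmul[OF assms])
  also have "\<dots> = (\<Sum>b\<in>Basis. (u \<bullet> b) * (\<Sum>b'\<in>Basis. (u \<bullet> b') * B b b'))"
  proof (rule sum.cong)
    fix b :: 'v
    have "B b u = B b (\<Sum>b'\<in>Basis. (u \<bullet> b') *\<^sub>R b')"
      by (simp add: euclidean_representation)
    also have "\<dots> = (\<Sum>b'\<in>Basis. (u \<bullet> b') * B b b')"
      using linear_sum[OF bilinearD(1)[OF assms, of b], of "\<lambda>b'. (u \<bullet> b') *\<^sub>R b'" Basis]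
      by (simp add: bilinear_rmul[OF assms])
    finally show "(u \<bullet> b) * B b u = (u \<bullet> b) * (\<Sum>b'\<in>Basis. (u \<bullet> b') * B b b')"
      by simp
  qed simp
  finally show ?thesis
    by (simp add: sum_distrib_left mult.assoc)
qed

text \<open>A crude bound by the entries of the matrices. If \<open>B\<close> varies with the base
  point and \<open>B'\<close> is its value at the centre, the double sum is continuous and vanishes
  at the centre, which gives a bound uniform in \<open>u\<close>.\<close>

lemma bilinear_diff_le:
  fixes B B' :: "'v::euclidean_space \<Rightarrow> 'v \<Rightarrow> real"
  assumes "bilinear B" "bilinear B'"
  shows "B u u - B' u u \<le> (\<Sum>b\<in>Basis. \<Sum>b'\<in>Basis. \<bar>B b b' - B' b b'\<bar>) * (norm u)\<^sup>2"
proof -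
  have "B u u - B' u u = (\<Sum>b\<in>Basis. \<Sum>b'\<in>Basis. (u \<bullet> b) * (u \<bullet> b') * (B b b' - B' b b'))"
    unfolding bilinear_expand[OF assms(1), of u] bilinear_expand[OF assms(2), of u]
    by (simp add: sum_subtractf right_diff_distrib)
  also have "\<dots> \<le> (\<Sum>b\<in>Basis. \<Sum>b'\<in>Basis. \<bar>B b b' - B' b b'\<bar> * (norm u)\<^sup>2)"
  proof (intro sum_mono)
    fix b b' :: 'v assume "b \<in> Basis" "b' \<in> Basis"
    then have "\<bar>u \<bullet> b\<bar> * \<bar>u \<bullet> b'\<bar> \<le> norm u * norm u"
      by (intro mult_mono Basis_le_norm) auto
    then have "\<bar>(u \<bullet> b) * (u \<bullet> b')\<bar> * \<bar>B b b' - B' b b'\<bar> \<le> (norm u)\<^sup>2 * \<bar>B b b' - B' b b'\<bar>"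
      by (intro mult_right_mono) (auto simp: abs_mult power2_eq_square)
    then have "\<bar>(u \<bullet> b) * (u \<bullet> b') * (B b b' - B' b b')\<bar> \<le> \<bar>B b b' - B' b b'\<bar> * (norm u)\<^sup>2"
      by (simp only: abs_mult[of "(u \<bullet> b) * (u \<bullet> b')"] mult.commute[of _ "(norm u)\<^sup>2"])
    then show "(u \<bullet> b) * (u \<bullet> b') * (B b b' - B' b b') \<le> \<bar>B b b' - B' b b'\<bar> * (norm u)\<^sup>2"
      by (rule order_trans[OF abs_ge_self])
  qed
  finally show ?thesis
    by (simp add: sum_distrib_right)
qed

section \<open>The Riemannian distance\<close>

abbreviation joins :: "('a, 'n::finite) fol_mfd \<Rightarrow> (real \<Rightarrow> 'a) \<Rightarrow> 'a \<Rightarrow> 'a \<Rightarrow> bool" where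
  "joins N \<gamma> x y \<equiv> piecewise_C1_curve N \<gamma> \<and> \<gamma> 0 = x \<and> \<gamma> 1 = y"

lemma rdist_le_curve_length:
  assumes "riemannian_manifold N" "joins N \<gamma> x y"
  shows "rdist N x y \<le> curve_length N \<gamma>"
  unfolding rdist_def
  by (rule cInf_lower)
     (use assms curve_length_nonneg[OF assms(1)] in \<open>auto intro!: bdd_belowI[of _ 0]\<close>)

lemma rdist_sym:
  assumes N: "riemannian_manifold N"
  shows "rdist N x y = rdist N y x"
proof -
  have "\<exists>\<gamma>'. joins N \<gamma>' y x \<and> curve_length N \<gamma>' = curve_length N \<gamma>" if "joins N \<gamma> x y" for \<gamma> x y
    using piecewise_C1_curve_reverse[OF N, of \<gamma>] curve_length_reverse[OF N, of \<gamma>] that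
    by (intro exI[of _ "\<lambda>t. \<gamma> (- 1 * t + 1)"]) auto
  then have "{curve_length N \<gamma> | \<gamma>. joins N \<gamma> x y} = {curve_length N \<gamma> | \<gamma>. joins N \<gamma> y x}"
    by (intro set_eqI iffI; clarsimp; metis)
  then show ?thesis
    unfolding rdist_def by simp
qed

text \<open>The curve is a straight line in the chart.\<close>

lemma short_chart_curves:
  assumes N: "riemannian_manifold N" and c: "c \<in> atlas N" "x \<in> cdom c" and e: "e > 0"
  obtains B where "openin (mtop N) B" "x \<in> B" "B \<subseteq> cdom c"
    "\<And>y. y \<in> B \<Longrightarrow> \<exists>\<gamma>. joins N \<gamma> x y \<and> curve_length N \<gamma> \<le>
       sqrt (rmetric N c x (cmap c y - cmap c x) (cmap c y - cmap c x)) + e * norm (cmap c y - cmap c x)"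
proof -
  note ch = riemannian_manifoldD(3)[OF N]
  let ?I = "cmap c ` cdom c" and ?z0 = "cmap c x"
  define inv where "inv = inv_into (cdom c) (cmap c)"
  define G where "G z = rmetric N c (inv z)" for z
  have inv: "inv z \<in> cdom c" "cmap c (inv z) = z" if "z \<in> ?I" for z
    unfolding inv_def using that by (auto simp: inv_into_into f_inv_into_f)
  have inv0: "inv ?z0 = x"
    unfolding inv_def by (rule inv_into_f_f[OF is_chart_inj_on[OF ch[OF c(1)]] c(2)])
  have form: "inner_form (G z)" if "z \<in> ?I" for z
    unfolding G_def by (rule rmetric_inner_form[OF N c(1) inv(1)[OF that]])
  then have bil: "bilinear (G z)" if "z \<in> ?I" for z
    using that unfolding inner_form_def by auto
  have z0: "?z0 \<in> ?I"
    using c(2) by auto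
  obtain H r where H: "convex H" "0 < r" "?I \<subseteq> H" "H \<inter> ball ?z0 r \<subseteq> ?I"
    using is_chart_convex_nbhd[OF ch[OF c(1)] c(2)] .
  define \<Delta> where "\<Delta> z = (\<Sum>b\<in>Basis. \<Sum>b'\<in>Basis. \<bar>G z b b' - G ?z0 b b'\<bar>)" for z
  have "continuous_on ?I \<Delta>"
    unfolding \<Delta>_def G_def inv_def
    by (intro continuous_intros rmetric_continuous_on[OF N c(1)])
  moreover have "\<Delta> ?z0 = 0"
    unfolding \<Delta>_def by simp
  \<comment> \<open>The threshold is a square because it enters under a root: the squared speed
    exceeds its value at the centre by at most the square of \<open>e * norm u\<close>, and the root
    of a sum is at most the sum of the roots.\<close>
  ultimately obtain \<delta> where \<delta>: "\<delta> > 0" "\<And>z. z \<in> ?I \<Longrightarrow> dist z ?z0 < \<delta> \<Longrightarrow> \<Delta> z < e\<^sup>2"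
    using z0 e unfolding continuous_on_iff
    by (metis abs_less_iff diff_zero dist_real_def zero_less_power)
  define \<rho> where "\<rho> = min r \<delta>"
  show thesis
  proof
    show "openin (mtop N) {y \<in> cdom c. cmap c y \<in> ball ?z0 \<rho>}"
      by (rule is_chart_openin_preimage[OF ch[OF c(1)] open_ball])
    show "x \<in> {y \<in> cdom c. cmap c y \<in> ball ?z0 \<rho>}"
      using c(2) H(2) \<delta>(1) by (simp add: \<rho>_def)
    show "{y \<in> cdom c. cmap c y \<in> ball ?z0 \<rho>} \<subseteq> cdom c"
      by auto
    fix y assume "y \<in> {y \<in> cdom c. cmap c y \<in> ball ?z0 \<rho>}"
    then have y: "y \<in> cdom c" "cmap c y \<in> ball ?z0 \<rho>"
      by auto
    define u where "u = cmap c y - ?z0"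
    define p where "p s = ?z0 + s *\<^sub>R u" for s
    define \<gamma> where "\<gamma> s = inv (p s)" for s
    have p: "p s \<in> ?I" "dist (p s) ?z0 < \<delta>" if s: "s \<in> {0..1}" for s
    proof -
      have "p s = (1 - s) *\<^sub>R ?z0 + s *\<^sub>R cmap c y"
        by (simp add: p_def u_def algebra_simps)
      moreover have "convex (H \<inter> ball ?z0 \<rho>)"
        by (intro convex_Int H(1) convex_ball)
      moreover have "?z0 \<in> H \<inter> ball ?z0 \<rho>" "cmap c y \<in> H \<inter> ball ?z0 \<rho>"
        using H(2,3) \<delta>(1) y z0 by (auto simp: \<rho>_def)
      ultimately have "p s \<in> H \<inter> ball ?z0 \<rho>"
        using s by (auto simp: convex_alt)
      then show "p s \<in> ?I" "dist (p s) ?z0 < \<delta>"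
        using H(4) by (auto simp: \<rho>_def dist_commute)
    qed
    have curve: "curve_in N {0..1} \<gamma>"
    proof -
      have "continuous_map (top_of_set {0..1}) (top_of_set ?I) p"
        using p(1) by (auto simp: continuous_map_in_subtopology p_def intro!: continuous_intros)
      from continuous_map_compose[OF this is_chart_inv_continuous_map[OF ch[OF c(1)]]] show ?thesis
        by (simp add: o_def \<gamma>_def[abs_def] inv_def)
    qed
    have \<gamma>c: "\<gamma> s \<in> cdom c" "cmap c (\<gamma> s) = p s" if "s \<in> {0..1}" for s
      using inv p(1)[OF that] unfolding \<gamma>_def by auto
    have der: "((cmap c \<circ> \<gamma>) has_vector_derivative u) (at s within {a..b})"
      if s: "s \<in> {a..b}" and ab: "0 \<le> a" "b \<le> 1" for s a b
    proof (rule has_vector_derivative_transform[OF s])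
      show "(p has_vector_derivative u) (at s within {a..b})"
        unfolding p_def by (auto intro!: derivative_eq_intros)
      show "(cmap c \<circ> \<gamma>) t = p t" if "t \<in> {a..b}" for t
        using \<gamma>c(2)[of t] that ab by auto
    qed
    have pc: "piecewise_C1_curve N \<gamma>"
    proof (rule piecewise_C1_curveI[OF curve finite.emptyI])
      fix a b :: real assume ab: "0 \<le> a" "a < b" "b \<le> 1"
      have "C1_on_interval N (id \<circ> \<gamma>) a b"
      proof (rule C1_on_interval_image[OF N ch riemannian_manifoldD(1,2)[OF N] _ ab(2)])
        show "curve_in N {a..b} \<gamma>"
          by (rule continuous_map_from_subtopology_mono[OF curve]) (use ab in auto)
        fix t assume t: "t \<in> {a..b}"
        show "\<exists>c\<in>atlas N. \<gamma> t \<in> cdom c \<and>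
          (\<exists>v. continuous_on {s\<in>{a..b}. \<gamma> s \<in> cdom c} v \<and>
           (\<forall>s\<in>{a..b}. \<gamma> s \<in> cdom c \<longrightarrow> ((cmap c \<circ> \<gamma>) has_vector_derivative v s) (at s within {a..b})))"
          using \<gamma>c(1)[of t] t ab der c(1)
          by (intro bexI[of _ c] conjI exI[of _ "\<lambda>_. u"]) auto
      qed
      then show "C1_on_interval N \<gamma> a b"
        by simp
    qed
    let ?L = "sqrt (rmetric N c x u u) + e * norm u"
    have sp: "speed N \<gamma> s \<le> ?L" if s: "s \<in> {0..1}" for s
    proof -
      have "speed N \<gamma> s = sqrt (rmetric N c (\<gamma> s) u u)"
        by (rule speed_eq[OF N curve s c(1) \<gamma>c(1)[OF s] der[OF s]]) auto
      also have "\<dots> = sqrt (G (p s) u u)"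
        by (simp add: G_def \<gamma>_def)
      also have "\<dots> \<le> sqrt (G ?z0 u u + (e * norm u)\<^sup>2)"
      proof -
        have "G (p s) u u - G ?z0 u u \<le> \<Delta> (p s) * (norm u)\<^sup>2"
          unfolding \<Delta>_def by (rule bilinear_diff_le[OF bil[OF p(1)[OF s]] bil[OF z0]])
        also have "\<dots> \<le> e\<^sup>2 * (norm u)\<^sup>2"
          using \<delta>(2)[OF p[OF s]] by (intro mult_right_mono) auto
        finally show ?thesis
          by (simp add: power_mult_distrib)
      qed
      also have "\<dots> \<le> sqrt (G ?z0 u u) + sqrt ((e * norm u)\<^sup>2)"
        by (rule sqrt_add_le_add_sqrt) (use inner_form_nonneg[OF form[OF z0]] in auto)
      finally show ?thesis
        using e by (simp add: G_def inv0)
    qed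
    have "curve_length N \<gamma> \<le> integral {0..1::real} (\<lambda>_. ?L)"
      unfolding curve_length_def
      by (rule Henstock_Kurzweil_Integration.integral_le[OF speed_integrable[OF N pc]]) (use sp in auto)
    moreover have "\<gamma> 0 = x" "\<gamma> 1 = y"
      using inv0 inv_into_f_f[OF is_chart_inj_on[OF ch[OF c(1)]] y(1)]
      by (auto simp: \<gamma>_def p_def u_def inv_def)
    ultimately show "\<exists>\<gamma>. joins N \<gamma> x y \<and> curve_length N \<gamma> \<le>
       sqrt (rmetric N c x (cmap c y - cmap c x) (cmap c y - cmap c x)) + e * norm (cmap c y - cmap c x)"
      using pc unfolding u_def by (intro exI[of _ \<gamma>]) simp
  qed
qed

text \<open>Ensures that the set of lengths in \<open>rdist\<close> is nonempty. Being joined by a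
  curve is an equivalence relation, and segments in charts join all points near a given one.\<close>

lemma curve_exists:
  assumes N: "riemannian_manifold N" and conn: "connected_space (mtop N)"
    and x: "x \<in> mspace N" and y: "y \<in> mspace N"
  shows "\<exists>\<gamma>. joins N \<gamma> x y"
proof (rule connectedin_equivalence[where T = "\<lambda>x y. \<exists>\<gamma>. joins N \<gamma> x y", OF _ _ _ _ x y])
  show "connectedin (mtop N) (mspace N)"
    using conn by (simp add: connectedin_topspace)
  fix z assume "z \<in> mspace N"
  then obtain c where c: "c \<in> atlas N" "z \<in> cdom c"
    by (rule riemannian_chart_at[OF N])
  show "\<exists>B. openin (mtop N) B \<and> z \<in> B \<and> (\<forall>w\<in>mspace N \<inter> B. \<exists>\<gamma>. joins N \<gamma> z w)"
    using short_chart_curves[OF N c zero_less_one] by (metis IntD2)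
next
  fix u v assume "\<exists>\<gamma>. joins N \<gamma> u v"
  then obtain \<gamma> where "joins N \<gamma> u v"
    by blast
  then show "\<exists>\<gamma>. joins N \<gamma> v u"
    using piecewise_C1_curve_reverse[OF N, of \<gamma>] by (intro exI[of _ "\<lambda>t. \<gamma> (- 1 * t + 1)"]) auto
next
  fix u v w assume "\<exists>\<gamma>. joins N \<gamma> u v" "\<exists>\<gamma>. joins N \<gamma> v w"
  then obtain \<gamma>1 \<gamma>2 where "joins N \<gamma>1 u v" "joins N \<gamma>2 v w"
    by blast
  then show "\<exists>\<gamma>. joins N \<gamma> u w"
    using piecewise_C1_curve_join[of N \<gamma>1 \<gamma>2]
    by (intro exI[of _ "\<lambda>t. if t \<le> 1 / 2 then \<gamma>1 (2 * t + 0) else \<gamma>2 (2 * t + - 1)"]) auto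
qed

lemma rdist_nonneg:
  assumes N: "riemannian_manifold N" and conn: "connected_space (mtop N)"
    and x: "x \<in> mspace N" and y: "y \<in> mspace N"
  shows "0 \<le> rdist N x y"
  unfolding rdist_def
  by (rule cInf_greatest) (use curve_exists[OF assms] curve_length_nonneg[OF N] in auto)

lemma rdist_image_le:
  assumes N: "riemannian_manifold N" and M: "riemannian_manifold M" and conn: "connected_space (mtop N)"
    and sm: "smooth_map N (mspace N) M f" and pr: "preserves_rmetric N (mspace N) (\<lambda>_ _. UNIV) M f"
    and x: "x \<in> mspace N" and y: "y \<in> mspace N"
  shows "rdist M (f x) (f y) \<le> rdist N x y"
  unfolding rdist_def[of N]
proof (rule cInf_greatest)
  show "{curve_length N \<gamma> |\<gamma>. joins N \<gamma> x y} \<noteq> {}"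
    using curve_exists[OF N conn x y] by auto
  fix l assume "l \<in> {curve_length N \<gamma> |\<gamma>. joins N \<gamma> x y}"
  then obtain \<gamma> where "joins N \<gamma> x y" "l = curve_length N \<gamma>"
    by auto
  then show "rdist M (f x) (f y) \<le> l"
    using rdist_le_curve_length[OF M, of "f \<circ> \<gamma>"] piecewise_C1_curve_image[OF N M sm pr]
      curve_length_image[OF N M sm pr] by fastforce
qed

text \<open>Let \<open>u\<close> and \<open>w\<close> be the coordinate differences of
  \<open>x\<close> and \<open>y\<close> in a chart of \<open>N\<close> and of their images in
  \<open>d\<close>. The segment in \<open>N\<close> has length close to the norm \<open>a\<close> of
  \<open>u\<close>; as \<open>D x\<close> is isometric, \<open>a\<close> is also the norm of
  \<open>D x u\<close>; and \<open>w\<close> differs from \<open>D x u\<close> by a remainder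
  \<open>R\<close> that is small compared to \<open>u\<close>. Since \<open>j\<close> is closed and
  injective, \<open>j y\<close> near \<open>j x\<close> forces \<open>y\<close> near
  \<open>x\<close>, where these estimates hold.\<close>

lemma rdist_le_chart_image:
  fixes N :: "('a, 'n::finite) fol_mfd" and M :: "('b, 'n) fol_mfd"
  assumes N: "riemannian_manifold N" and M: "riemannian_manifold M"
    and sm: "smooth_map N (mspace N) M j" and pr: "preserves_rmetric N (mspace N) (\<lambda>_ _. UNIV) M j"
    and closed: "closed_map (mtop N) (mtop M) j" and inj: "inj_on j (mspace N)"
    and x: "x \<in> mspace N" and d: "d \<in> atlas M" "j x \<in> cdom d" and \<epsilon>: "\<epsilon> > 0"
  obtains U where "openin (mtop M) U" "j x \<in> U"
    "\<And>y. y \<in> mspace N \<Longrightarrow> j y \<in> U \<Longrightarrow> rdist N x y \<le>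
       (1 + \<epsilon>) * sqrt (rmetric M d (j x) (cmap d (j y) - cmap d (j x)) (cmap d (j y) - cmap d (j x)))"
proof -
  obtain c where c: "c \<in> atlas N" "x \<in> cdom c"
    using riemannian_chart_at[OF N x] .
  obtain O' F D where O': "openin (mtop N) O'" "x \<in> O'"
    "\<And>y. y \<in> O' \<Longrightarrow> cmap d (j y) = F (cmap c y)"
    "\<And>y. y \<in> O' \<Longrightarrow> (F has_derivative D y) (at (cmap c y))"
    "\<And>y u v. y \<in> O' \<Longrightarrow> rmetric M d (j y) (D y u) (D y v) = rmetric N c y u v"
    using smooth_isometry_local[OF N sm pr riemannian_manifoldD(3)[OF M d(1)] c d] by metis
  let ?z0 = "cmap c x"
  let ?g = "rmetric N c x" and ?h = "rmetric M d (j x)"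
  have g: "inner_form ?g" and h: "inner_form ?h"
    by (rule rmetric_inner_form[OF N c], rule rmetric_inner_form[OF M d])
  obtain m where m: "m > 0" "\<And>u. m * norm u \<le> sqrt (?g u u)"
    using inner_form_lower[OF g] by metis
  obtain C where C: "C > 0" "\<And>u. sqrt (?h u u) \<le> C * norm u"
    using inner_form_upper[OF h] by metis
  \<comment> \<open>The solution of \<open>1 + q = (1 + \<epsilon>) * (1 - C * q)\<close>. The
    estimates below give \<open>a \<le> b + C * q * a\<close> and a distance of at most
    \<open>(1 + q) * a\<close>, which together yield the bound
    \<open>(1 + \<epsilon>) * b\<close>.\<close>
  define q where "q = \<epsilon> / (1 + (1 + \<epsilon>) * C)"
  have den: "1 + (1 + \<epsilon>) * C > 0"
    using \<epsilon> C(1) by (intro add_pos_pos mult_pos_pos) auto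
  then have q: "q > 0" "q * (1 + (1 + \<epsilon>) * C) = \<epsilon>"
    using \<epsilon> by (auto simp: q_def)
  \<comment> \<open>The factor \<open>m\<close> converts Euclidean norms into norms of the metric:
    \<open>\<eta> * norm u \<le> q * a\<close>.\<close>
  define \<eta> where "\<eta> = q * m"
  have \<eta>: "\<eta> > 0"
    using q m by (simp add: \<eta>_def)
  obtain \<delta> where \<delta>: "\<delta> > 0"
    "\<And>z. norm (z - ?z0) < \<delta> \<Longrightarrow> norm (F z - F ?z0 - D x (z - ?z0)) \<le> \<eta> * norm (z - ?z0)"
    using O'(4)[OF O'(2)] \<eta> unfolding has_derivative_at_alt by metis
  obtain B where B: "openin (mtop N) B" "x \<in> B" "B \<subseteq> cdom c"
    "\<And>y. y \<in> B \<Longrightarrow> \<exists>\<gamma>. joins N \<gamma> x y \<and> curve_length N \<gamma> \<le>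
       sqrt (?g (cmap c y - ?z0) (cmap c y - ?z0)) + \<eta> * norm (cmap c y - ?z0)"
    using short_chart_curves[OF N c \<eta>] by metis
  define W where "W = O' \<inter> B \<inter> {y \<in> cdom c. cmap c y \<in> ball ?z0 \<delta>}"
  have W: "openin (mtop N) W"
    unfolding W_def
    by (intro openin_Int O'(1) B(1) is_chart_openin_preimage[OF riemannian_manifoldD(3)[OF N c(1)] open_ball])
  have xW: "x \<in> W"
    unfolding W_def using O'(2) B(2) c(2) \<delta>(1) by auto
  have into: "j ` mspace N \<subseteq> mspace M"
    using continuous_map_image_subset_topspace[OF smooth_map_continuous[OF sm]] by auto
  obtain U where U: "openin (mtop M) U" "j x \<in> U" "\<And>y. y \<in> mspace N \<Longrightarrow> j y \<in> U \<Longrightarrow> y \<in> W"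
    using closed_map_openin_nbhd[OF closed W inj xW into] by metis
  show thesis
  proof (rule that[OF U(1,2)])
    fix y assume "y \<in> mspace N" "j y \<in> U"
    then have "y \<in> W"
      by (rule U(3))
    then have y: "y \<in> O'" "y \<in> B" "norm (cmap c y - ?z0) < \<delta>"
      unfolding W_def by (auto simp: dist_norm norm_minus_commute)
    define u where "u = cmap c y - ?z0"
    define w where "w = cmap d (j y) - cmap d (j x)"
    define R where "R = w - D x u"
    define a where "a = sqrt (?g u u)"
    define b where "b = sqrt (?h w w)"
    have "norm R \<le> \<eta> * norm u"
      using \<delta>(2)[OF y(3)] O'(3)[OF y(1)] O'(3)[OF O'(2)] by (simp add: R_def w_def u_def)
    then have "sqrt (?h (- R) (- R)) \<le> C * (\<eta> * norm u)"
      using C(2)[of "- R"] C(1) by (smt (verit) mult_left_mono norm_minus_cancel)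
    also have "\<dots> = C * q * (m * norm u)"
      by (simp add: \<eta>_def)
    also have "\<dots> \<le> C * q * a"
      unfolding a_def using m(2)[of u] C(1) q(1) by (intro mult_left_mono) auto
    finally have R: "sqrt (?h (- R) (- R)) \<le> C * q * a" .
    have "a = sqrt (?h (D x u) (D x u))"
      unfolding a_def using O'(5)[OF O'(2)] by simp
    also have "D x u = w + (- R)"
      by (simp add: R_def)
    also have "sqrt (?h (w + (- R)) (w + (- R))) \<le> b + sqrt (?h (- R) (- R))"
      unfolding b_def by (rule inner_form_triangle[OF h])
    finally have ab: "a \<le> b + C * q * a"
      using R by simp
    obtain \<gamma> where \<gamma>: "joins N \<gamma> x y" "curve_length N \<gamma> \<le> a + \<eta> * norm u"
      using B(4)[OF y(2)] unfolding a_def u_def by blast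
    have "rdist N x y \<le> a + \<eta> * norm u"
      using rdist_le_curve_length[OF N \<gamma>(1)] \<gamma>(2) by simp
    also have "\<dots> = a + q * (m * norm u)"
      by (simp add: \<eta>_def)
    also have "\<dots> \<le> a + q * a"
      using m(2)[of u] q(1) unfolding a_def by (intro add_left_mono mult_left_mono) auto
    also have "\<dots> = (1 + \<epsilon>) * (a - C * q * a)"
    proof -
      have "(1 + \<epsilon>) * (a - C * q * a) = a + (\<epsilon> - q * ((1 + \<epsilon>) * C)) * a"
        by (simp add: algebra_simps)
      also have "\<epsilon> - q * ((1 + \<epsilon>) * C) = q"
        using q(2) by (simp add: algebra_simps)
      finally show ?thesis ..
    qed
    also have "\<dots> \<le> (1 + \<epsilon>) * b"
      using ab \<epsilon> by (intro mult_left_mono) auto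
    finally show "rdist N x y \<le> (1 + \<epsilon>) * sqrt (?h (cmap d (j y) - cmap d (j x)) (cmap d (j y) - cmap d (j x)))"
      unfolding b_def w_def .
  qed
qed

section \<open>Curve length as an upper bound for pseudometrics\<close>

text \<open>A Riemann sum of \<open>f\<close> over a fine tagged division dominates the increments of \<open>F\<close>.\<close>

lemma increment_le_integral:
  fixes F f :: "real \<Rightarrow> real"
  assumes ab: "a \<le> b" and int: "f integrable_on {a..b}"
    and loc: "\<And>t. t \<in> {a..b} \<Longrightarrow> \<exists>\<delta>>0. \<forall>s\<in>{a..b}. \<bar>s - t\<bar> < \<delta> \<longrightarrow> \<bar>F s - F t\<bar> \<le> f t * \<bar>s - t\<bar>"
  shows "F b - F a \<le> integral {a..b} f"
proof (rule field_le_epsilon)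
  fix e :: real assume e: "e > 0"
  have "\<forall>t\<in>{a..b}. \<exists>\<delta>>0. \<forall>s\<in>{a..b}. \<bar>s - t\<bar> < \<delta> \<longrightarrow> \<bar>F s - F t\<bar> \<le> f t * \<bar>s - t\<bar>"
    using loc by blast
  from bchoice[OF this] obtain \<delta> where \<delta>: "\<And>t. t \<in> {a..b} \<Longrightarrow> \<delta> t > 0"
    "\<And>t s. t \<in> {a..b} \<Longrightarrow> s \<in> {a..b} \<Longrightarrow> \<bar>s - t\<bar> < \<delta> t \<Longrightarrow> \<bar>F s - F t\<bar> \<le> f t * \<bar>s - t\<bar>"
    by blast
  obtain \<gamma> where \<gamma>: "gauge \<gamma>" "\<forall>\<D>. \<D> tagged_division_of {a..b} \<and> \<gamma> fine \<D> \<longrightarrow>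
      norm (sum (\<lambda>(x,k). measure lborel k *\<^sub>R f x) \<D> - integral {a..b} f) < e"
    using integrable_integral[OF int, unfolded has_integral_real, rule_format, OF e] by (elim exE conjE)
  \<comment> \<open>The radius 1 outside the interval merely completes the definition to a gauge on
    the whole line.\<close>
  define \<gamma>' where "\<gamma>' t = ball t (if t \<in> {a..b} then \<delta> t else 1)" for t
  have "gauge (\<lambda>t. \<gamma> t \<inter> \<gamma>' t)"
    unfolding \<gamma>'_def using \<delta>(1) by (intro gauge_Int \<gamma>(1) gauge_ball_dependent) auto
  then obtain p where p: "p tagged_division_of {a..b}" "\<gamma> fine p" "\<gamma>' fine p"
    by (rule fine_division_exists_real[of "\<lambda>t. \<gamma> t \<inter> \<gamma>' t" a b, unfolded fine_Int]) (elim conjE, rule that)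
  have "F b - F a = (\<Sum>(x, K)\<in>p. F (Sup K) - F (Inf K))"
    by (rule additive_tagged_division_1[OF ab p(1), symmetric])
  also have "\<dots> \<le> (\<Sum>(x, K)\<in>p. measure lborel K *\<^sub>R f x)"
  proof (rule sum_mono, clarify)
    fix x K assume xK: "(x, K) \<in> p"
    obtain c d where K: "K = {c..d}"
      using tagged_division_ofD(4)[OF p(1) xK] by auto
    have x: "x \<in> K" "K \<subseteq> {a..b}"
      using tagged_division_ofD(2,3)[OF p(1) xK] by auto
    have cd: "c \<le> x" "x \<le> d" "c \<le> d" "x \<in> {a..b}" "c \<in> {a..b}" "d \<in> {a..b}"
      using x unfolding K by auto
    have "K \<subseteq> ball x (\<delta> x)"
      using fineD[OF p(3) xK] cd(4) unfolding \<gamma>'_def by simp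
    then have "\<bar>c - x\<bar> < \<delta> x" "\<bar>d - x\<bar> < \<delta> x"
      using cd(3) unfolding K by (auto simp: dist_real_def subset_iff abs_minus_commute)
    then have "\<bar>F c - F x\<bar> \<le> f x * \<bar>c - x\<bar>" "\<bar>F d - F x\<bar> \<le> f x * \<bar>d - x\<bar>"
      using \<delta>(2)[OF cd(4,5)] \<delta>(2)[OF cd(4,6)] by blast+
    \<comment> \<open>The tag lies between \<open>c\<close> and \<open>d\<close>, so the bounds for
      the two parts add up to \<open>f x\<close> times the length of the interval.\<close>
    then have "F d - F c \<le> f x * (x - c) + f x * (d - x)"
      using cd by (simp add: abs_if split: if_splits)
    also have "\<dots> = (d - c) * f x"
      by (simp add: algebra_simps)
    finally show "F (Sup K) - F (Inf K) \<le> measure lborel K *\<^sub>R f x"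
      using cd unfolding K by simp
  qed
  also have "\<dots> \<le> integral {a..b} f + e"
    using \<gamma>(2)[rule_format, OF conjI[OF p(1,2)]] by (simp add: abs_less_iff)
  finally show "F b - F a \<le> integral {a..b} f + e" .
qed

text \<open>Only pairs containing the centre \<open>p\<close> are bounded, by the metric at
  \<open>p\<close> itself, and \<open>U\<close> may depend on \<open>p\<close>. This is what a
  Riemann sum needs, with the centre as tag, and at a point of the glued boundary it can be verified
  for each side separately.\<close>

definition locally_bounded_by_metric :: "('a, 'n::finite) fol_mfd \<Rightarrow> ('a \<Rightarrow> 'a \<Rightarrow> real) \<Rightarrow> bool" where
  "locally_bounded_by_metric M e \<longleftrightarrow>
     (\<forall>p\<in>mspace M. \<forall>d\<in>atlas M. \<forall>\<epsilon>>0. p \<in> cdom d \<longrightarrow>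
       (\<exists>U. openin (mtop M) U \<and> p \<in> U \<and>
          (\<forall>p'\<in>U. e p p' \<le> (1 + \<epsilon>) * sqrt (rmetric M d p (cmap d p' - cmap d p) (cmap d p' - cmap d p)))))"

text \<open>To first order the coordinate difference along the curve is \<open>s - t\<close> times
  \<open>w\<close>, so the pseudometric grows no faster than the speed. The parameter set
  \<open>T\<close> is arbitrary in order to admit one-sided derivatives at break points.\<close>

lemma locally_bounded_along_curve:
  assumes M: "riemannian_manifold M" and e: "locally_bounded_by_metric M e"
    and curve: "curve_in M T \<gamma>" and t: "t \<in> T" and d: "d \<in> atlas M" "\<gamma> t \<in> cdom d"
    and w: "((cmap d \<circ> \<gamma>) has_vector_derivative w) (at t within T)" and \<epsilon>: "\<epsilon> > 0"
  obtains \<delta> where "\<delta> > 0"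
    "\<And>s. s \<in> T \<Longrightarrow> \<bar>s - t\<bar> < \<delta> \<Longrightarrow>
       e (\<gamma> t) (\<gamma> s) \<le> (sqrt (rmetric M d (\<gamma> t) w w) + \<epsilon>) * \<bar>s - t\<bar>"
proof -
  let ?h = "rmetric M d (\<gamma> t)"
  have h: "inner_form ?h"
    by (rule rmetric_inner_form[OF M d])
  obtain C where C: "C > 0" "\<And>u. sqrt (?h u u) \<le> C * norm u"
    using inner_form_upper[OF h] by metis
  define W where "W = sqrt (?h w w)"
  have W: "W \<ge> 0"
    unfolding W_def using inner_form_nonneg[OF h] by simp
  \<comment> \<open>The cap 1 gives \<open>\<eta> * \<eta> \<le> \<eta>\<close>, so
    \<open>(1 + \<eta>) * (W + C * \<eta>)\<close> is at most
    \<open>W + \<eta> * (W + 2 * C)\<close>, and the quotient makes the last term at most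
    \<open>\<epsilon>\<close>.\<close>
  define \<eta> where "\<eta> = min 1 (\<epsilon> / (W + 2 * C))"
  have pos: "W + 2 * C > 0"
    using W C(1) by simp
  have \<eta>: "\<eta> > 0" "\<eta> \<le> 1"
    using \<epsilon> pos unfolding \<eta>_def by auto
  have "\<eta> \<le> \<epsilon> / (W + 2 * C)"
    unfolding \<eta>_def by simp
  then have \<eta>3: "\<eta> * (W + 2 * C) \<le> \<epsilon>"
    using pos by (simp add: pos_le_divide_eq)
  obtain U where U: "openin (mtop M) U" "\<gamma> t \<in> U"
    "\<forall>p'\<in>U. e (\<gamma> t) p' \<le> (1 + \<eta>) * sqrt (?h (cmap d p' - cmap d (\<gamma> t)) (cmap d p' - cmap d (\<gamma> t)))"
  proof -
    have "\<exists>U. openin (mtop M) U \<and> \<gamma> t \<in> U \<and>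
      (\<forall>p'\<in>U. e (\<gamma> t) p' \<le> (1 + \<eta>) * sqrt (?h (cmap d p' - cmap d (\<gamma> t)) (cmap d p' - cmap d (\<gamma> t))))"
      using e[unfolded locally_bounded_by_metric_def, THEN bspec, OF curve_in_mspace[OF curve t], THEN bspec, OF d(1)]
        \<eta>(1) d(2) by blast
    then show thesis
      using that by (elim exE conjE)
  qed
  obtain \<delta>1 where \<delta>1: "\<delta>1 > 0" "\<And>s. s \<in> T \<Longrightarrow> dist s t < \<delta>1 \<Longrightarrow> \<gamma> s \<in> U"
    using curve_in_eventually[OF curve U(1) t U(2)] by metis
  obtain \<delta>2 where \<delta>2: "\<delta>2 > 0" "\<forall>s\<in>T. norm (s - t) < \<delta>2 \<longrightarrow>
      norm ((cmap d \<circ> \<gamma>) s - (cmap d \<circ> \<gamma>) t - (s - t) *\<^sub>R w) \<le> \<eta> * norm (s - t)"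
    using w \<eta>(1) unfolding has_vector_derivative_def has_derivative_within_alt by blast
  show thesis
  proof (rule that[of "min \<delta>1 \<delta>2"])
    show "min \<delta>1 \<delta>2 > 0"
      using \<delta>1 \<delta>2 by simp
    fix s assume s: "s \<in> T" "\<bar>s - t\<bar> < min \<delta>1 \<delta>2"
    define v where "v = cmap d (\<gamma> s) - cmap d (\<gamma> t)"
    define R where "R = v - (s - t) *\<^sub>R w"
    have "norm R \<le> \<eta> * \<bar>s - t\<bar>"
      using \<delta>2(2) s by (simp add: R_def v_def)
    then have R: "sqrt (?h R R) \<le> C * (\<eta> * \<bar>s - t\<bar>)"
      using C(2)[of R] mult_left_mono[of "norm R" "\<eta> * \<bar>s - t\<bar>" C] C(1) by linarith
    have "sqrt (?h v v) = sqrt (?h ((s - t) *\<^sub>R w + R) ((s - t) *\<^sub>R w + R))"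
      by (simp add: R_def)
    also have "\<dots> \<le> sqrt (?h ((s - t) *\<^sub>R w) ((s - t) *\<^sub>R w)) + sqrt (?h R R)"
      by (rule inner_form_triangle[OF h])
    also have "\<dots> \<le> \<bar>s - t\<bar> * W + C * (\<eta> * \<bar>s - t\<bar>)"
      using R inner_form_scale[OF h, of "s - t" w] by (simp add: W_def)
    finally have v: "sqrt (?h v v) \<le> (W + C * \<eta>) * \<bar>s - t\<bar>"
      by (simp add: algebra_simps)
    have "dist s t < \<delta>1"
      using s(2) by (simp add: dist_real_def)
    then have "e (\<gamma> t) (\<gamma> s) \<le> (1 + \<eta>) * sqrt (?h v v)"
      using U(3) \<delta>1(2)[OF s(1)] unfolding v_def by blast
    also have "\<dots> \<le> (1 + \<eta>) * ((W + C * \<eta>) * \<bar>s - t\<bar>)"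
      using v \<eta>(1) by (intro mult_left_mono) auto
    also have "\<dots> = ((1 + \<eta>) * (W + C * \<eta>)) * \<bar>s - t\<bar>"
      by simp
    also have "\<dots> \<le> (W + \<epsilon>) * \<bar>s - t\<bar>"
    proof (rule mult_right_mono)
      have "\<eta> * \<eta> * C \<le> \<eta> * C"
        using \<eta> C(1) mult_left_mono[of \<eta> 1 \<eta>] by (intro mult_right_mono) auto
      then show "(1 + \<eta>) * (W + C * \<eta>) \<le> W + \<epsilon>"
        using \<eta>3 by (simp add: algebra_simps)
    qed simp
    finally show "e (\<gamma> t) (\<gamma> s) \<le> (sqrt (?h w w) + \<epsilon>) * \<bar>s - t\<bar>"
      unfolding W_def .
  qed
qed

text \<open>A gauge estimate needs a linear bound at every tag, break points included, where the
  curve has only one-sided derivatives. Those exist because it is \<open>C1\<close> up to the ends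
  of each closed subinterval. The size of \<open>L\<close> is irrelevant, since finitely many points
  do not change an integral.\<close>

lemma locally_Lipschitz_along_curve:
  assumes M: "riemannian_manifold M" and e: "locally_bounded_by_metric M e"
    and \<gamma>: "piecewise_C1_curve M \<gamma>" and t: "t \<in> {0..1}"
  obtains L \<delta> where "\<delta> > 0" "\<And>s. s \<in> {0..1} \<Longrightarrow> \<bar>s - t\<bar> < \<delta> \<Longrightarrow> e (\<gamma> t) (\<gamma> s) \<le> L * \<bar>s - t\<bar>"
proof -
  note curve = piecewise_C1_curve_in[OF \<gamma>]
  obtain K where K: "finite K"
    "\<And>a b. 0 \<le> a \<Longrightarrow> a < b \<Longrightarrow> b \<le> 1 \<Longrightarrow> {a<..<b} \<inter> K = {} \<Longrightarrow> C1_on_interval M \<gamma> a b"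
    using piecewise_C1_curveE[OF \<gamma>] by metis
  obtain m where m: "m > 0" "{t - m<..<t + m} \<inter> (K - {t}) = {}"
    using finite_avoiding_ball[OF K(1)] by metis
  obtain d where d: "d \<in> atlas M" "\<gamma> t \<in> cdom d"
    using riemannian_chart_at[OF M curve_in_mspace[OF curve t]] .
  have side: "\<exists>L \<delta>. \<delta> > 0 \<and> (\<forall>s\<in>{a..b}. \<bar>s - t\<bar> < \<delta> \<longrightarrow> e (\<gamma> t) (\<gamma> s) \<le> L * \<bar>s - t\<bar>)"
    if ab: "0 \<le> a" "a < b" "b \<le> 1" "t \<in> {a..b}" and C1: "C1_on_interval M \<gamma> a b" for a b
  proof -
    have curve_ab: "curve_in M {a..b} \<gamma>"
      by (rule continuous_map_from_subtopology_mono[OF curve]) (use ab in auto)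
    obtain w where w: "((cmap d \<circ> \<gamma>) has_vector_derivative w) (at t within {a..b})"
      using C1 d ab(4) unfolding C1_on_interval_def by blast
    show ?thesis
      using locally_bounded_along_curve[OF M e curve_ab ab(4) d w zero_less_one] by metis
  qed
  have left: "\<exists>L \<delta>. \<delta> > 0 \<and> (\<forall>s\<in>{0..t}. \<bar>s - t\<bar> < \<delta> \<longrightarrow> e (\<gamma> t) (\<gamma> s) \<le> L * \<bar>s - t\<bar>)"
    if "t > 0"
  proof -
    let ?a = "max 0 (t - m)"
    have "{?a<..<t} \<subseteq> {t - m<..<t + m} - {t}"
      using m(1) by auto
    then have "{?a<..<t} \<inter> K = {}"
      using m(2) by blast
    then obtain L \<delta> where "\<delta> > 0" "\<forall>s\<in>{?a..t}. \<bar>s - t\<bar> < \<delta> \<longrightarrow> e (\<gamma> t) (\<gamma> s) \<le> L * \<bar>s - t\<bar>"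
      using side[of ?a t] K(2)[of ?a t] \<open>t > 0\<close> t m(1) by auto
    then show ?thesis
      using m(1) by (intro exI[of _ L] exI[of _ "min \<delta> m"]) auto
  qed
  have right: "\<exists>L \<delta>. \<delta> > 0 \<and> (\<forall>s\<in>{t..1}. \<bar>s - t\<bar> < \<delta> \<longrightarrow> e (\<gamma> t) (\<gamma> s) \<le> L * \<bar>s - t\<bar>)"
    if "t < 1"
  proof -
    let ?b = "min 1 (t + m)"
    have "{t<..<?b} \<subseteq> {t - m<..<t + m} - {t}"
      using m(1) by auto
    then have "{t<..<?b} \<inter> K = {}"
      using m(2) by blast
    then obtain L \<delta> where "\<delta> > 0" "\<forall>s\<in>{t..?b}. \<bar>s - t\<bar> < \<delta> \<longrightarrow> e (\<gamma> t) (\<gamma> s) \<le> L * \<bar>s - t\<bar>"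
      using side[of t ?b] K(2)[of t ?b] \<open>t < 1\<close> t m(1) by auto
    then show ?thesis
      using m(1) by (intro exI[of _ L] exI[of _ "min \<delta> m"]) auto
  qed
  \<comment> \<open>At \<open>t = 0\<close> there is no left side; the implication then holds
    vacuously with any positive radius. The same applies on the right at
    \<open>t = 1\<close>.\<close>
  obtain L1 \<delta>1 where 1: "\<delta>1 > 0" "t > 0 \<longrightarrow> (\<forall>s\<in>{0..t}. \<bar>s - t\<bar> < \<delta>1 \<longrightarrow> e (\<gamma> t) (\<gamma> s) \<le> L1 * \<bar>s - t\<bar>)"
    using left zero_less_one by metis
  obtain L2 \<delta>2 where 2: "\<delta>2 > 0" "t < 1 \<longrightarrow> (\<forall>s\<in>{t..1}. \<bar>s - t\<bar> < \<delta>2 \<longrightarrow> e (\<gamma> t) (\<gamma> s) \<le> L2 * \<bar>s - t\<bar>)"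
    using right zero_less_one by metis
  define L where "L = max L1 L2"
  have mono: "L1 * \<bar>s - t\<bar> \<le> L * \<bar>s - t\<bar>" "L2 * \<bar>s - t\<bar> \<le> L * \<bar>s - t\<bar>" for s
    unfolding L_def by (auto intro!: mult_right_mono)
  show thesis
  proof (rule that[of "min \<delta>1 \<delta>2" L])
    show "min \<delta>1 \<delta>2 > 0"
      using 1 2 by simp
    fix s assume s: "s \<in> {0..1}" "\<bar>s - t\<bar> < min \<delta>1 \<delta>2"
    have "s \<in> {0..t} \<and> t > 0 \<or> s \<in> {t..1} \<and> t < 1"
      using s(1) t by auto
    then show "e (\<gamma> t) (\<gamma> s) \<le> L * \<bar>s - t\<bar>"
    proof (elim disjE conjE)
      assume "s \<in> {0..t}" "t > 0"
      then have "e (\<gamma> t) (\<gamma> s) \<le> L1 * \<bar>s - t\<bar>"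
        using 1(2) s(2) by simp
      then show ?thesis
        using mono(1)[of s] by linarith
    next
      assume "s \<in> {t..1}" "t < 1"
      then have "e (\<gamma> t) (\<gamma> s) \<le> L2 * \<bar>s - t\<bar>"
        using 2(2) s(2) by simp
      then show ?thesis
        using mono(2)[of s] by linarith
    qed
  qed
qed

text \<open>The increments of the distance to the starting point are bounded, by the reverse
  triangle inequality, by the local growth of \<open>e\<close>; the gauge integral estimate then
  compares their total with the integral of the speed.\<close>

lemma le_curve_length:
  assumes M: "riemannian_manifold M" and e: "locally_bounded_by_metric M e"
    and pm: "pseudometric_on (mspace M) e" and \<gamma>: "piecewise_C1_curve M \<gamma>"
  shows "e (\<gamma> 0) (\<gamma> 1) \<le> curve_length M \<gamma>"
proof (rule field_le_epsilon)
  fix \<epsilon> :: real assume \<epsilon>: "\<epsilon> > 0"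
  note curve = piecewise_C1_curve_in[OF \<gamma>]
  have in_M: "\<gamma> t \<in> mspace M" if "t \<in> {0..1}" for t
    by (rule curve_in_mspace[OF curve that])
  obtain K where K: "finite K"
    "\<And>t c. t \<in> {0..1} \<Longrightarrow> t \<notin> K \<Longrightarrow> c \<in> atlas M \<Longrightarrow> \<gamma> t \<in> cdom c \<Longrightarrow>
       \<exists>u. ((cmap c \<circ> \<gamma>) has_vector_derivative u) (at t)"
    using piecewise_C1_derivative[OF \<gamma>] by metis
  have "\<forall>t\<in>{0..1}. \<exists>L. \<exists>\<delta>>0. \<forall>s\<in>{0..1}. \<bar>s - t\<bar> < \<delta> \<longrightarrow> e (\<gamma> t) (\<gamma> s) \<le> L * \<bar>s - t\<bar>"
  proof
    fix t :: real assume "t \<in> {0..1}"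
    from locally_Lipschitz_along_curve[OF M e \<gamma> this]
    show "\<exists>L. \<exists>\<delta>>0. \<forall>s\<in>{0..1}. \<bar>s - t\<bar> < \<delta> \<longrightarrow> e (\<gamma> t) (\<gamma> s) \<le> L * \<bar>s - t\<bar>"
      by metis
  qed
  from bchoice[OF this] obtain L where L:
    "\<And>t. t \<in> {0..1} \<Longrightarrow> \<exists>\<delta>>0. \<forall>s\<in>{0..1}. \<bar>s - t\<bar> < \<delta> \<longrightarrow> e (\<gamma> t) (\<gamma> s) \<le> L t * \<bar>s - t\<bar>"
    by blast
  \<comment> \<open>At the break points the speed is replaced by a Lipschitz constant, so that the
    local bound holds at every parameter while the integral stays the same.\<close>
  define f where "f t = (if t \<in> K then L t else speed M \<gamma> t + \<epsilon>)" for t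
  have loc: "\<exists>\<delta>>0. \<forall>s\<in>{0..1}. \<bar>s - t\<bar> < \<delta> \<longrightarrow> e (\<gamma> t) (\<gamma> s) \<le> f t * \<bar>s - t\<bar>" if t: "t \<in> {0..1}" for t
  proof (cases "t \<in> K")
    case True
    then show ?thesis
      using L[OF t] by (simp add: f_def)
  next
    case False
    obtain d where d: "d \<in> atlas M" "\<gamma> t \<in> cdom d"
      using riemannian_chart_at[OF M in_M[OF t]] .
    obtain w where "((cmap d \<circ> \<gamma>) has_vector_derivative w) (at t)"
      using K(2)[OF t False d] by blast
    then have w: "((cmap d \<circ> \<gamma>) has_vector_derivative w) (at t within {0..1})"
      by (rule has_vector_derivative_at_within)
    have "f t = sqrt (rmetric M d (\<gamma> t) w w) + \<epsilon>"
      using speed_eq[OF M curve t d w] False by (simp add: f_def)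
    then show ?thesis
      using locally_bounded_along_curve[OF M e curve t d w \<epsilon>] by metis
  qed
  define F where "F t = e (\<gamma> 0) (\<gamma> t)" for t
  have "F 1 - F 0 \<le> integral {0..1} f"
  proof (rule increment_le_integral)
    have "(\<lambda>t. speed M \<gamma> t + \<epsilon>) integrable_on {0..1}"
      by (intro integrable_add speed_integrable[OF M \<gamma>]) auto
    then show "f integrable_on {0..1}"
      by (rule integrable_spike_finite[OF K(1), rotated]) (simp add: f_def)
    fix t :: real assume t: "t \<in> {0..1}"
    then obtain \<delta> where \<delta>: "\<delta> > 0" "\<forall>s\<in>{0..1}. \<bar>s - t\<bar> < \<delta> \<longrightarrow> e (\<gamma> t) (\<gamma> s) \<le> f t * \<bar>s - t\<bar>"
      using loc by blast
    have "\<bar>F s - F t\<bar> \<le> e (\<gamma> t) (\<gamma> s)" if s: "s \<in> {0..1}" for s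
      using pseudometric_onD(4)[OF pm in_M[of 0] in_M[OF s] in_M[OF t]]
        pseudometric_onD(4)[OF pm in_M[of 0] in_M[OF t] in_M[OF s]]
        pseudometric_onD(3)[OF pm in_M[OF s] in_M[OF t]] by (simp add: F_def)
    then show "\<exists>\<delta>>0. \<forall>s\<in>{0..1}. \<bar>s - t\<bar> < \<delta> \<longrightarrow> \<bar>F s - F t\<bar> \<le> f t * \<bar>s - t\<bar>"
      using \<delta> by (intro exI[of _ \<delta>]) force
  qed simp
  moreover have "F 0 = 0"
    unfolding F_def by (rule pseudometric_onD(1)[OF pm in_M]) simp
  moreover have "integral {0..1} f = integral {0..1} (\<lambda>t. speed M \<gamma> t + \<epsilon>)"
    by (rule integral_spike[OF negligible_finite[OF K(1)]]) (simp add: f_def)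
  moreover have "integral {0..1} (\<lambda>t. speed M \<gamma> t + \<epsilon>) = curve_length M \<gamma> + \<epsilon>"
    using Henstock_Kurzweil_Integration.integral_add[OF speed_integrable[OF M \<gamma>], of "\<lambda>_. \<epsilon>"]
    by (simp add: curve_length_def integrable_const_ivl)
  ultimately show "e (\<gamma> 0) (\<gamma> 1) \<le> curve_length M \<gamma> + \<epsilon>"
    by (simp add: F_def)
qed

section \<open>Leaf spaces\<close>

text \<open>On points, the leaf distances of a piece and of \<open>M\<close> can be compared
  directly along the inclusion.\<close>

definition pt_leaf_dist :: "'n set \<Rightarrow> ('a, 'n::finite) fol_mfd \<Rightarrow> 'a \<Rightarrow> 'a \<Rightarrow> real" where
  "pt_leaf_dist Q N x y = leaf_dist Q N (leaf Q N (mspace N) x) (leaf Q N (mspace N) y)"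

lemma leaf_in_leaves: "x \<in> mspace N \<Longrightarrow> leaf Q N (mspace N) x \<in> leaves Q N"
  unfolding leaves_def by simp

lemma set_dist_sym: "riemannian_manifold N \<Longrightarrow> set_dist N L L' = set_dist N L' L"
proof -
  assume N: "riemannian_manifold N"
  have "{rdist N x y | x y. x \<in> L \<and> y \<in> L'} = {rdist N x y | x y. x \<in> L' \<and> y \<in> L}"
    using rdist_sym[OF N] by blast
  then show ?thesis
    unfolding set_dist_def by simp
qed

lemma le_set_dist:
  assumes "L \<in> leaves Q N" "L' \<in> leaves Q N" "\<And>x y. x \<in> L \<Longrightarrow> y \<in> L' \<Longrightarrow> a \<le> rdist N x y"
  shows "a \<le> set_dist N L L'"
  unfolding set_dist_def
proof (rule cInf_greatest)
  obtain x y where "x \<in> L" "y \<in> L'"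
    using leaves_nonempty assms(1,2) by metis
  then show "{rdist N x y | x y. x \<in> L \<and> y \<in> L'} \<noteq> {}"
    by blast
qed (use assms(3) in auto)

context
  fixes Q :: "'n::finite set" and N :: "('a, 'n) fol_mfd"
  assumes N: "riemannian_manifold N" and conn: "connected_space (mtop N)"
begin

lemma rdist_nonneg_leaves:
  "\<lbrakk>L \<in> leaves Q N; L' \<in> leaves Q N; x \<in> L; y \<in> L'\<rbrakk> \<Longrightarrow> 0 \<le> rdist N x y"
  by (rule rdist_nonneg[OF N conn leavesD(1) leavesD(1)])

lemma set_dist_nonneg: "L \<in> leaves Q N \<Longrightarrow> L' \<in> leaves Q N \<Longrightarrow> 0 \<le> set_dist N L L'"
  by (rule le_set_dist) (simp_all add: rdist_nonneg_leaves)

lemma set_dist_le_rdist: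
  assumes "L \<in> leaves Q N" "L' \<in> leaves Q N" "x \<in> L" "y \<in> L'"
  shows "set_dist N L L' \<le> rdist N x y"
  unfolding set_dist_def
proof (rule cInf_lower)
  show "bdd_below {rdist N x y | x y. x \<in> L \<and> y \<in> L'}"
    by (rule bdd_belowI[of _ 0]) (use rdist_nonneg_leaves[OF assms(1,2)] in auto)
qed (use assms in blast)

lemma pseudometric_leaf_dist: "pseudometric_on (leaves Q N) (leaf_dist Q N)"
  by (rule pseudometric_on_leaf_dist[OF set_dist_nonneg set_dist_sym[OF N]])

lemma pseudometric_pt_leaf_dist: "pseudometric_on (mspace N) (pt_leaf_dist Q N)"
  using pseudometric_leaf_dist leaf_in_leaves[of _ N Q] unfolding pseudometric_on_def pt_leaf_dist_def by simp

lemma pt_leaf_dist_le_rdist: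
  assumes "x \<in> mspace N" "y \<in> mspace N"
  shows "pt_leaf_dist Q N x y \<le> rdist N x y"
proof -
  note L = assms[THEN leaf_in_leaves[of _ N Q]]
  have "pt_leaf_dist Q N x y \<le> set_dist N (leaf Q N (mspace N) x) (leaf Q N (mspace N) y)"
    unfolding pt_leaf_dist_def
    by (rule leaf_dist_le_set_dist[OF set_dist_nonneg set_dist_sym[OF N] L])
  also have "\<dots> \<le> rdist N x y"
    by (rule set_dist_le_rdist[OF L leaf_refl leaf_refl])
  finally show ?thesis .
qed

text \<open>Maximality of the leaf distance. Vanishing along leaves lets \<open>e\<close> descend to
  leaves through arbitrary representatives, where telescoping applies. It is used for the pieces,
  with a distance pulled back from \<open>M\<close>, and for \<open>M\<close> itself, with the
  symmetrised quotient distance.\<close>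

lemma le_pt_leaf_dist:
  assumes pm: "pseudometric_on (mspace N) e"
    and le: "\<And>x y. x \<in> mspace N \<Longrightarrow> y \<in> mspace N \<Longrightarrow> e x y \<le> rdist N x y"
    and leaf: "\<And>x y. x \<in> mspace N \<Longrightarrow> y \<in> leaf Q N (mspace N) x \<Longrightarrow> e x y = 0"
    and x: "x \<in> mspace N" and y: "y \<in> mspace N"
  shows "e x y \<le> pt_leaf_dist Q N x y"
proof -
  define pt where "pt L = (SOME x. x \<in> L)" for L :: "'a set"
  have pt: "pt L \<in> L" "pt L \<in> mspace N" if L: "L \<in> leaves Q N" for L
  proof -
    obtain x where "x \<in> L"
      using leaves_nonempty[OF L] by blast
    then show "pt L \<in> L"
      unfolding pt_def by (rule someI)
    then show "pt L \<in> mspace N"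
      by (rule leavesD(1)[OF L])
  qed
  have indep: "e (pt L) (pt L') = e x y" if L: "L \<in> leaves Q N" "L' \<in> leaves Q N" and xy: "x \<in> L" "y \<in> L'" for L L' x y
  proof (rule pseudometric_on_cong_zero[OF pm])
    show "e (pt L) x = 0"
      by (rule leaf[OF pt(2)[OF L(1)]]) (use leavesD(2)[OF L(1) pt(1)[OF L(1)]] xy(1) in simp)
    show "e (pt L') y = 0"
      by (rule leaf[OF pt(2)[OF L(2)]]) (use leavesD(2)[OF L(2) pt(1)[OF L(2)]] xy(2) in simp)
  qed (rule pt(2)[OF L(1)] leavesD(1)[OF L(1) xy(1)] pt(2)[OF L(2)] leavesD(1)[OF L(2) xy(2)])+
  have "e (pt L) (pt L') \<le> leaf_dist Q N L L'" if "L \<in> leaves Q N" "L' \<in> leaves Q N" for L L'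
  proof (rule le_leaf_dist[where \<delta> = "\<lambda>L L'. e (pt L) (pt L')", OF _ _ _ that])
    fix p q assume pq: "p \<in> leaves Q N" "q \<in> leaves Q N"
    show "e (pt p) (pt q) \<le> set_dist N p q"
    proof (rule le_set_dist[OF pq])
      fix x y assume xy: "x \<in> p" "y \<in> q"
      show "e (pt p) (pt q) \<le> rdist N x y"
        using indep[OF pq xy] le[OF leavesD(1)[OF pq(1) xy(1)] leavesD(1)[OF pq(2) xy(2)]] by simp
    qed
    fix r assume "r \<in> leaves Q N"
    then show "e (pt p) (pt r) \<le> e (pt p) (pt q) + e (pt q) (pt r)"
      using pq pt(2) by (intro pseudometric_onD(4)[OF pm])
  next
    fix p assume "p \<in> leaves Q N"
    then show "e (pt p) (pt p) \<le> 0"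
      using pt(2) pseudometric_onD(1)[OF pm] by simp
  qed
  from this[OF leaf_in_leaves[OF x] leaf_in_leaves[OF y]] show ?thesis
    using indep[OF leaf_in_leaves[OF x] leaf_in_leaves[OF y] leaf_refl leaf_refl]
    unfolding pt_leaf_dist_def by simp
qed

lemma HLS_proj_eqD:
  assumes "x \<in> mspace N" "y \<in> mspace N" "HLS_proj Q N x = HLS_proj Q N y"
  shows "pt_leaf_dist Q N x y = 0"
proof -
  have "leaf Q N (mspace N) y \<in> HLS_proj Q N y"
    using pseudometric_onD(1)[OF pseudometric_leaf_dist leaf_in_leaves[OF assms(2)]] leaf_in_leaves[OF assms(2)]
    unfolding HLS_proj_def zero_dist_rel_def by auto
  then have "leaf Q N (mspace N) y \<in> HLS_proj Q N x"
    using assms(3) by simp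
  then show ?thesis
    unfolding HLS_proj_def zero_dist_rel_def pt_leaf_dist_def by auto
qed

lemma HLS_dist_proj:
  assumes "x \<in> mspace N" "y \<in> mspace N"
  shows "HLS_dist Q N (HLS_proj Q N x) (HLS_proj Q N y) = pt_leaf_dist Q N x y"
  unfolding HLS_dist_def pt_leaf_dist_def
proof (rule class_dist_eqI)
  note pm = pseudometric_leaf_dist
  have proj: "L \<in> HLS_proj Q N x \<longleftrightarrow> L \<in> leaves Q N \<and> leaf_dist Q N (leaf Q N (mspace N) x) L = 0"
    if "x \<in> mspace N" for x L
    using leaf_in_leaves[OF that] unfolding HLS_proj_def zero_dist_rel_def by auto
  show "leaf Q N (mspace N) x \<in> HLS_proj Q N x" "leaf Q N (mspace N) y \<in> HLS_proj Q N y"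
    using proj[OF assms(1)] proj[OF assms(2)] leaf_in_leaves[OF assms(1)] leaf_in_leaves[OF assms(2)]
      pseudometric_onD(1)[OF pm leaf_in_leaves[OF assms(1)]]
      pseudometric_onD(1)[OF pm leaf_in_leaves[OF assms(2)]] by auto
  fix L L' assume "L \<in> HLS_proj Q N x" "L' \<in> HLS_proj Q N y"
  then have "L \<in> leaves Q N" "leaf_dist Q N (leaf Q N (mspace N) x) L = 0"
    "L' \<in> leaves Q N" "leaf_dist Q N (leaf Q N (mspace N) y) L' = 0"
    using proj assms by auto
  then show "leaf_dist Q N L L' = leaf_dist Q N (leaf Q N (mspace N) x) (leaf Q N (mspace N) y)"
    using pseudometric_on_cong_zero[OF pm leaf_in_leaves[OF assms(1)] _ leaf_in_leaves[OF assms(2)], of L L'] by simp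
qed

end

lemma HLS_eq_image: "HLS Q N = HLS_proj Q N ` mspace N"
  unfolding HLS_def quotient_def leaves_def HLS_proj_def by auto

lemma HLS_proj_in: "x \<in> mspace N \<Longrightarrow> HLS_proj Q N x \<in> HLS Q N"
  unfolding HLS_eq_image by simp

section \<open>Closed isometric embeddings of foliated manifolds\<close>

text \<open>One piece with its inclusion; the gluing uses two instances. By \<open>closed\<close>
  and \<open>inj\<close>, neighbourhoods of a point in the piece are traces of neighbourhoods of its
  image.\<close>

locale leaf_embedding =
  fixes Q :: "'n::finite set" and N :: "('a, 'n) fol_mfd" and M :: "('b, 'n) fol_mfd" and j :: "'a \<Rightarrow> 'b"
  assumes N: "riemannian_manifold N" and M: "riemannian_manifold M"
    and conn_N: "connected_space (mtop N)" and conn_M: "connected_space (mtop M)"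
    and fol_N: "foliation Q N" and fol_M: "foliation Q M"
    and restr: "restricts_to Q M N j"
    and closed: "closed_map (mtop N) (mtop M) j" and inj: "inj_on j (mspace N)"
begin

lemma smooth: "smooth_map N (mspace N) M j"
  and isometric: "preserves_rmetric N (mspace N) (\<lambda>_ _. UNIV) M j"
  and compatible: "\<And>c d. c \<in> fol_atlas N \<Longrightarrow> d \<in> fol_atlas M \<Longrightarrow> fol_compatible Q (mtop N) j c d"
  using restr unfolding restricts_to_def by auto

lemma into: "j ` mspace N \<subseteq> mspace M"
  using continuous_map_image_subset_topspace[OF smooth_map_continuous[OF smooth]] by auto

text \<open>Maximality of the leaf distance of \<open>N\<close>, tested on the leaf distance of
  \<open>M\<close> pulled back along \<open>j\<close>. The inequality can be strict, as
  \<open>M\<close> offers more curves and larger leaves.\<close>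

lemma pt_leaf_dist_le:
  assumes "x \<in> mspace N" "y \<in> mspace N"
  shows "pt_leaf_dist Q M (j x) (j y) \<le> pt_leaf_dist Q N x y"
proof (rule le_pt_leaf_dist[OF N conn_N, where e = "\<lambda>x y. pt_leaf_dist Q M (j x) (j y)", OF _ _ _ assms])
  show "pseudometric_on (mspace N) (\<lambda>x y. pt_leaf_dist Q M (j x) (j y))"
  proof -
    have jN: "j x \<in> mspace M" if "x \<in> mspace N" for x
      using into that by auto
    show ?thesis
      using pseudometric_pt_leaf_dist[OF M conn_M, of Q] unfolding pseudometric_on_def by (simp add: jN)
  qed
  fix x y assume x: "x \<in> mspace N"
  {
    assume y: "y \<in> mspace N"
    then have "pt_leaf_dist Q M (j x) (j y) \<le> rdist M (j x) (j y)"
      using into x by (intro pt_leaf_dist_le_rdist[OF M conn_M]) auto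
    also have "\<dots> \<le> rdist N x y"
      by (rule rdist_image_le[OF N M conn_N smooth isometric x y])
    finally show "pt_leaf_dist Q M (j x) (j y) \<le> rdist N x y" .
  }
  assume "y \<in> leaf Q N (mspace N) x"
  then have "leaf Q M (mspace M) (j y) = leaf Q M (mspace M) (j x)"
    by (rule leaf_image_eq[OF fol_M smooth_map_continuous[OF smooth] compatible, rotated -1])
  then show "pt_leaf_dist Q M (j x) (j y) = 0"
    using pseudometric_onD(1)[OF pseudometric_leaf_dist[OF M conn_M] leaf_in_leaves, of "j x" Q] into x
    unfolding pt_leaf_dist_def by auto
qed

text \<open>Points near \<open>p\<close> lie in the image only if \<open>p\<close> does, as the image is closed.\<close>

lemma openin_nbhd_cases:
  assumes "p \<in> mspace M"
    and "\<And>x. x \<in> mspace N \<Longrightarrow> j x = p \<Longrightarrow>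
      \<exists>U. openin (mtop M) U \<and> p \<in> U \<and> (\<forall>y\<in>mspace N. j y \<in> U \<longrightarrow> P x y)"
  shows "\<exists>U. openin (mtop M) U \<and> p \<in> U \<and> (\<forall>y\<in>mspace N. j y \<in> U \<longrightarrow> (\<exists>x\<in>mspace N. j x = p \<and> P x y))"
proof (cases "p \<in> j ` mspace N")
  case True
  then obtain x where x: "x \<in> mspace N" "j x = p"
    by auto
  obtain U where "openin (mtop M) U \<and> p \<in> U \<and> (\<forall>y\<in>mspace N. j y \<in> U \<longrightarrow> P x y)"
    using assms(2)[OF x] ..
  then show ?thesis
    using x by (intro exI[of _ U]) auto
next
  case False
  have "closedin (mtop M) (j ` mspace N)"
    using closed unfolding closed_map_def by blast
  then have "openin (mtop M) (mspace M - j ` mspace N)"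
    by blast
  then show ?thesis
    using False assms(1) by (intro exI[of _ "mspace M - j ` mspace N"]) auto
qed

text \<open>The witness \<open>x\<close> stands inside the quantifier over \<open>y\<close>, so that
  the statement also covers a point \<open>p\<close> outside the image of \<open>N\<close>: then
  \<open>U\<close> avoids the image and nothing is claimed.\<close>

lemma pt_leaf_dist_near:
  assumes "p \<in> mspace M" "d \<in> atlas M" "p \<in> cdom d" "\<epsilon> > 0"
  shows "\<exists>U. openin (mtop M) U \<and> p \<in> U \<and> (\<forall>y\<in>mspace N. j y \<in> U \<longrightarrow>
    (\<exists>x\<in>mspace N. j x = p \<and> pt_leaf_dist Q N x y \<le>
       (1 + \<epsilon>) * sqrt (rmetric M d p (cmap d (j y) - cmap d p) (cmap d (j y) - cmap d p))))"
proof (rule openin_nbhd_cases[OF assms(1)])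
  fix x assume x: "x \<in> mspace N" "j x = p"
  have d: "d \<in> atlas M" "j x \<in> cdom d"
    using assms(2,3) x(2) by auto
  obtain U where U: "openin (mtop M) U" "j x \<in> U"
    "\<And>y. y \<in> mspace N \<Longrightarrow> j y \<in> U \<Longrightarrow> rdist N x y \<le>
       (1 + \<epsilon>) * sqrt (rmetric M d (j x) (cmap d (j y) - cmap d (j x)) (cmap d (j y) - cmap d (j x)))"
    using rdist_le_chart_image[OF N M smooth isometric closed inj x(1) d assms(4)] by metis
  show "\<exists>U. openin (mtop M) U \<and> p \<in> U \<and> (\<forall>y\<in>mspace N. j y \<in> U \<longrightarrow> pt_leaf_dist Q N x y \<le>
       (1 + \<epsilon>) * sqrt (rmetric M d p (cmap d (j y) - cmap d p) (cmap d (j y) - cmap d p)))"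
  proof (intro exI[of _ U] conjI ballI impI)
    fix y assume "y \<in> mspace N" "j y \<in> U"
    then show "pt_leaf_dist Q N x y \<le>
       (1 + \<epsilon>) * sqrt (rmetric M d p (cmap d (j y) - cmap d p) (cmap d (j y) - cmap d p))"
      using U(3)[of y] pt_leaf_dist_le_rdist[OF N conn_N x(1), of y Q] x(2) by simp
  qed (use U(1,2) x(2) in auto)
qed

lemma leaf_near:
  assumes "p \<in> mspace M" "d \<in> fol_atlas M" "p \<in> cdom d"
  shows "\<exists>U. openin (mtop M) U \<and> p \<in> U \<and> (\<forall>y\<in>mspace N. j y \<in> U \<longrightarrow>
    (\<exists>x\<in>mspace N. j x = p \<and> (plaque_eq Q d p (j y) \<longrightarrow> pt_leaf_dist Q N x y = 0)))"
proof (rule openin_nbhd_cases[OF assms(1)])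
  fix x assume x: "x \<in> mspace N" "j x = p"
  have d: "d \<in> fol_atlas M" "j x \<in> cdom d"
    using assms(2,3) x(2) by auto
  obtain U where U: "openin (mtop M) U" "j x \<in> U"
    "\<And>y. y \<in> mspace N \<Longrightarrow> j y \<in> U \<Longrightarrow> plaque_eq Q d (j x) (j y) \<Longrightarrow>
       leaf Q N (mspace N) y = leaf Q N (mspace N) x"
    using leaf_eq_near[OF fol_N closed inj into compatible x(1) d] by metis
  show "\<exists>U. openin (mtop M) U \<and> p \<in> U \<and> (\<forall>y\<in>mspace N. j y \<in> U \<longrightarrow>
      (plaque_eq Q d p (j y) \<longrightarrow> pt_leaf_dist Q N x y = 0))"
  proof (intro exI[of _ U] conjI ballI impI)
    fix y assume "y \<in> mspace N" "j y \<in> U" "plaque_eq Q d p (j y)"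
    then have "leaf Q N (mspace N) y = leaf Q N (mspace N) x"
      using U(3)[of y] x(2) by simp
    then show "pt_leaf_dist Q N x y = 0"
      using pseudometric_onD(1)[OF pseudometric_leaf_dist[OF N conn_N] leaf_in_leaves[OF x(1)], of Q]
      unfolding pt_leaf_dist_def by simp
  qed (use U(1,2) x(2) in auto)
qed

end

section \<open>Gluing\<close>

text \<open>The gluing as seen through the two inclusions: \<open>glued\<close> and
  \<open>glued_only\<close> say that the images meet exactly along \<open>\<phi>\<close>. The
  realisation of points of \<open>M\<close> as equivalence classes no longer matters.\<close>

locale glued_pair =
  e1: leaf_embedding Q M1 M j1 + e2: leaf_embedding Q M2 M j2
  for Q :: "'n::finite set" and M1 :: "('a, 'n) fol_mfd" and M2 :: "('b, 'n) fol_mfd"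
    and M :: "('c, 'n) fol_mfd" and j1 j2 +
  fixes S :: "'a set" and \<phi> :: "'a \<Rightarrow> 'b"
  assumes cover: "mspace M = j1 ` mspace M1 \<union> j2 ` mspace M2"
    and S: "S \<subseteq> mspace M1" "S \<noteq> {}" and \<phi>S: "\<phi> ` S \<subseteq> mspace M2"
    and glued: "\<And>x. x \<in> S \<Longrightarrow> j1 x = j2 (\<phi> x)"
    and glued_only: "\<And>x y. x \<in> mspace M1 \<Longrightarrow> y \<in> mspace M2 \<Longrightarrow> j1 x = j2 y \<Longrightarrow> x \<in> S \<and> y = \<phi> x"
begin

text \<open>The common parameter set of both spaces: \<open>q\<close> maps it onto the points of
  \<open>M\<close>, \<open>proj\<close> onto the disjoint union of the two leaf spaces.\<close>

definition Z :: "('a + 'b) set" where "Z = mspace M1 <+> mspace M2"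

definition q :: "'a + 'b \<Rightarrow> 'c" where "q = case_sum j1 j2"

definition proj :: "'a + 'b \<Rightarrow> 'a set set + 'b set set" where
  "proj = case_sum (\<lambda>x. Inl (HLS_proj Q M1 x)) (\<lambda>y. Inr (HLS_proj Q M2 y))"

abbreviation "Y \<equiv> HLS Q M1 <+> HLS Q M2"
abbreviation "dY \<equiv> sum_dist (HLS_dist Q M1) (HLS_dist Q M2)"
abbreviation "R \<equiv> HLS_glue_rel Q M1 M2 S \<phi>"

definition E :: "'a + 'b \<Rightarrow> 'a + 'b \<Rightarrow> ereal" where
  "E z w = chain_dist Y dY R (proj z) (proj w)"

definition D :: "'a + 'b \<Rightarrow> 'a + 'b \<Rightarrow> real" where
  "D z w = pt_leaf_dist Q M (q z) (q w)"

lemma q_simps [simp]: "q (Inl x) = j1 x" "q (Inr y) = j2 y"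
  and proj_simps [simp]: "proj (Inl x) = Inl (HLS_proj Q M1 x)" "proj (Inr y) = Inr (HLS_proj Q M2 y)"
  by (simp_all add: q_def proj_def)

lemma Z_iff [simp]: "Inl x \<in> Z \<longleftrightarrow> x \<in> mspace M1" "Inr y \<in> Z \<longleftrightarrow> y \<in> mspace M2"
  by (auto simp: Z_def)

lemma q_image: "q ` Z = mspace M"
  unfolding cover Z_def Plus_def image_Un image_image by simp

lemma proj_image: "proj ` Z = Y"
  unfolding Z_def HLS_eq_image Plus_def image_Un image_image by simp

lemma q_in: "z \<in> Z \<Longrightarrow> q z \<in> mspace M" and proj_in: "z \<in> Z \<Longrightarrow> proj z \<in> Y"
  using q_image proj_image by auto

lemma pm_D: "pseudometric_on Z D"
  using pseudometric_pt_leaf_dist[OF e1.M e1.conn_M, of Q] q_in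
  unfolding pseudometric_on_def D_def by simp

lemma gens: "{(Inl (HLS_proj Q M1 x), Inr (HLS_proj Q M2 (\<phi> x))) | x. x \<in> S} \<subseteq> Y \<times> Y"
  using S(1) \<phi>S by (auto intro!: HLS_proj_in)

lemma equiv_R: "equiv Y R"
  unfolding HLS_glue_rel_def by (rule equiv_least_equiv[OF gens])

lemma R_gen: "x \<in> S \<Longrightarrow> (proj (Inl x), proj (Inr (\<phi> x))) \<in> R"
  unfolding HLS_glue_rel_def using subset_least_equiv by fastforce

lemma R_refl: "y \<in> Y \<Longrightarrow> (y, y) \<in> R"
  using equiv_R unfolding equiv_def by (auto dest: refl_onD)

lemma D_side:
  "x \<in> mspace M1 \<Longrightarrow> x' \<in> mspace M1 \<Longrightarrow> D (Inl x) (Inl x') \<le> pt_leaf_dist Q M1 x x'"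
  "y \<in> mspace M2 \<Longrightarrow> y' \<in> mspace M2 \<Longrightarrow> D (Inr y) (Inr y') \<le> pt_leaf_dist Q M2 y y'"
  unfolding D_def using e1.pt_leaf_dist_le e2.pt_leaf_dist_le by auto

lemma E_side:
  "x \<in> mspace M1 \<Longrightarrow> x' \<in> mspace M1 \<Longrightarrow> E (Inl x) (Inl x') \<le> ereal (pt_leaf_dist Q M1 x x')"
  "y \<in> mspace M2 \<Longrightarrow> y' \<in> mspace M2 \<Longrightarrow> E (Inr y) (Inr y') \<le> ereal (pt_leaf_dist Q M2 y y')"
proof -
  show "E (Inl x) (Inl x') \<le> ereal (pt_leaf_dist Q M1 x x')" if "x \<in> mspace M1" "x' \<in> mspace M1" for x x'
    using chain_dist_le[of "proj (Inl x)" Y "proj (Inl x')" dY R] proj_in[of "Inl x"] proj_in[of "Inl x'"]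
      HLS_dist_proj[OF e1.N e1.conn_N that, of Q] that unfolding E_def by simp
  show "E (Inr y) (Inr y') \<le> ereal (pt_leaf_dist Q M2 y y')" if "y \<in> mspace M2" "y' \<in> mspace M2" for y y'
    using chain_dist_le[of "proj (Inr y)" Y "proj (Inr y')" dY R] proj_in[of "Inr y"] proj_in[of "Inr y'"]
      HLS_dist_proj[OF e2.N e2.conn_N that, of Q] that unfolding E_def by simp
qed

lemma D_proj_eq: "z \<in> Z \<Longrightarrow> z' \<in> Z \<Longrightarrow> proj z = proj z' \<Longrightarrow> D z z' = 0"
proof -
  assume zz: "z \<in> Z" "z' \<in> Z" and eq: "proj z = proj z'"
  have "D z z' \<le> 0"
  proof (cases z)
    case (Inl x)
    then obtain x' where x': "z' = Inl x'" "HLS_proj Q M1 x = HLS_proj Q M1 x'"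
      using eq by (cases z') auto
    show ?thesis
      using D_side(1)[of x x'] HLS_proj_eqD[OF e1.N e1.conn_N _ _ x'(2)] zz unfolding Inl x'(1) by simp
  next
    case (Inr y)
    then obtain y' where y': "z' = Inr y'" "HLS_proj Q M2 y = HLS_proj Q M2 y'"
      using eq by (cases z') auto
    show ?thesis
      using D_side(2)[of y y'] HLS_proj_eqD[OF e2.N e2.conn_N _ _ y'(2)] zz unfolding Inr y'(1) by simp
  qed
  then show "D z z' = 0"
    using pseudometric_onD(2)[OF pm_D zz] by simp
qed

text \<open>Leaves of the pieces map into leaves of \<open>M\<close>, without increasing distances, so the leaf
  distance of \<open>M\<close> is one of the pseudometrics among which the quotient distance is the largest.\<close>

lemma D_le_E:
  assumes z: "z \<in> Z" and w: "w \<in> Z"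
  shows "ereal (D z w) \<le> E z w"
proof -
  define rep where "rep y = (SOME z. z \<in> Z \<and> proj z = y)" for y
  have rep: "rep y \<in> Z" "proj (rep y) = y" if y: "y \<in> Y" for y
  proof -
    obtain z where "z \<in> Z \<and> proj z = y"
      using proj_image y by (metis imageE)
    then have "rep y \<in> Z \<and> proj (rep y) = y"
      unfolding rep_def by (rule someI)
    then show "rep y \<in> Z" "proj (rep y) = y"
      by auto
  qed
  \<comment> \<open>\<open>D\<close> transported to the leaf spaces by choosing points;
    \<open>D_proj_eq\<close> makes the choice immaterial.\<close>
  define \<delta> where "\<delta> y y' = D (rep y) (rep y')" for y y'
  have \<delta>_proj: "\<delta> (proj z) (proj w) = D z w" if "z \<in> Z" "w \<in> Z" for z w
    unfolding \<delta>_def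
    by (rule pseudometric_on_cong_zero[OF pm_D])
       (use that rep[OF proj_in[OF that(1)]] rep[OF proj_in[OF that(2)]] D_proj_eq in auto)
  have pm: "pseudometric_on Y \<delta>"
    using pm_D rep(1) unfolding pseudometric_on_def \<delta>_def by simp
  have "ereal (\<delta> (proj z) (proj w)) \<le> chain_dist Y dY R (proj z) (proj w)"
  proof (rule le_chain_dist)
    fix p r assume pr: "p \<in> Y" "r \<in> Y"
    obtain z w where zw: "z \<in> Z" "w \<in> Z" "p = proj z" "r = proj w"
      using pr proj_image by blast
    show "ereal (\<delta> p r) \<le> dY p r"
    proof (cases z; cases w)
      fix x x' assume x: "z = Inl x" "w = Inl x'"
      have in1: "x \<in> mspace M1" "x' \<in> mspace M1"
        using zw(1,2) unfolding x by auto
      show ?thesis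
        using \<delta>_proj[OF zw(1,2)] D_side(1)[OF in1] HLS_dist_proj[OF e1.N e1.conn_N in1, of Q]
        unfolding zw(3,4) x by simp
    next
      fix y y' assume y: "z = Inr y" "w = Inr y'"
      have in2: "y \<in> mspace M2" "y' \<in> mspace M2"
        using zw(1,2) unfolding y by auto
      show ?thesis
        using \<delta>_proj[OF zw(1,2)] D_side(2)[OF in2] HLS_dist_proj[OF e2.N e2.conn_N in2, of Q]
        unfolding zw(3,4) y by simp
    \<comment> \<open>For points of different pieces the distance \<open>dY\<close> is
      infinite.\<close>
    qed (auto simp: zw)
  next
    show "\<delta> p s \<le> \<delta> p r + \<delta> r s" if "p \<in> Y" "r \<in> Y" "s \<in> Y" for p r s
      by (rule pseudometric_onD(4)[OF pm that])
    fix p r assume pr: "(p, r) \<in> R"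
    \<comment> \<open>As \<open>R\<close> is the least equivalence relation containing the glued
      pairs, \<open>\<delta>\<close> vanishes on \<open>R\<close> once it vanishes on those
      pairs.\<close>
    have "equiv Y (zero_dist_rel Y \<delta>)"
      by (rule equiv_zero_dist_rel[OF pm])
    moreover have "\<delta> (Inl (HLS_proj Q M1 x)) (Inr (HLS_proj Q M2 (\<phi> x))) = 0" if x: "x \<in> S" for x
    proof -
      have "Inl x \<in> Z" "Inr (\<phi> x) \<in> Z"
        using x S(1) \<phi>S by auto
      then have "\<delta> (proj (Inl x)) (proj (Inr (\<phi> x))) = D (Inl x) (Inr (\<phi> x))"
        by (rule \<delta>_proj)
      also have "\<dots> = D (Inl x) (Inl x)"
        unfolding D_def using glued[OF x] by simp
      also have "\<dots> = 0"
        by (rule pseudometric_onD(1)[OF pm_D \<open>Inl x \<in> Z\<close>])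
      finally show ?thesis
        by simp
    qed
    then have "{(Inl (HLS_proj Q M1 x), Inr (HLS_proj Q M2 (\<phi> x))) | x. x \<in> S} \<subseteq> zero_dist_rel Y \<delta>"
      using gens unfolding zero_dist_rel_def by auto
    ultimately have "R \<subseteq> zero_dist_rel Y \<delta>"
      unfolding HLS_glue_rel_def by (rule least_equiv_minimal)
    then have "p \<in> Y" "r \<in> Y" "\<delta> p r = 0"
      using pr unfolding zero_dist_rel_def by auto
    then show "\<delta> r p \<le> 0"
      using pseudometric_onD(3)[OF pm] by simp
  qed
  then show ?thesis
    unfolding E_def \<delta>_proj[OF z w] .
qed

lemma E_nonneg: "z \<in> Z \<Longrightarrow> w \<in> Z \<Longrightarrow> 0 \<le> E z w"
  using D_le_E pseudometric_onD(2)[OF pm_D] by (metis ereal_less_eq(5) order_trans)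

lemma E_triangle_less:
  assumes "E x y < ereal a" "E y z < ereal b" "y \<in> Z"
  shows "E x z < ereal (a + b)"
  using chain_dist_triangle_less[OF assms(1,2)[unfolded E_def] R_refl[OF proj_in[OF assms(3)]]]
  unfolding E_def .

lemma E_self: "z \<in> Z \<Longrightarrow> E z z \<le> 0"
proof (cases z)
  case (Inl x)
  assume "z \<in> Z"
  then have "x \<in> mspace M1"
    using Inl by simp
  then show ?thesis
    using E_side(1)[of x x] pseudometric_onD(1)[OF pseudometric_pt_leaf_dist[OF e1.N e1.conn_N], of x Q]
    unfolding Inl by (simp add: zero_ereal_def)
next
  case (Inr y)
  assume "z \<in> Z"
  then have "y \<in> mspace M2"
    using Inr by simp
  then show ?thesis
    using E_side(2)[of y y] pseudometric_onD(1)[OF pseudometric_pt_leaf_dist[OF e2.N e2.conn_N], of y Q]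
    unfolding Inr by (simp add: zero_ereal_def)
qed

text \<open>A chain from \<open>z\<close> to itself, a free jump, and a chain from \<open>w\<close>
  to itself, both of arbitrarily small length.\<close>

lemma E_R:
  assumes z: "z \<in> Z" and w: "w \<in> Z" and R: "(proj w, proj z) \<in> R"
  shows "E z w \<le> 0"
proof (rule ereal_le_epsilon2)
  fix \<epsilon> :: real assume "\<epsilon> > 0"
  then have "E z z < ereal (\<epsilon> / 2)" "E w w < ereal (\<epsilon> / 2)"
    using E_self[OF z] E_self[OF w] by (auto intro: le_less_trans simp: zero_ereal_def)
  then have "E z w < ereal (\<epsilon> / 2 + \<epsilon> / 2)"
    unfolding E_def by (rule chain_dist_triangle_less[OF _ _ R])
  then show "E z w \<le> 0 + ereal \<epsilon>"
    by simp
qed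

text \<open>Two points over the same point of \<open>M\<close> either coincide, by injectivity of
  the inclusions, or are glued, by \<open>glued_only\<close>. This is why the quotient distance
  descends to \<open>M\<close>.\<close>

lemma E_q_eq:
  assumes z: "z \<in> Z" and w: "w \<in> Z" and eq: "q z = q w"
  shows "E z w \<le> 0"
proof (rule E_R[OF z w], cases z; cases w)
  fix x x' assume "z = Inl x" "w = Inl x'"
  then have "z = w"
    using eq z w inj_onD[OF e1.inj] by simp
  then show "(proj w, proj z) \<in> R"
    using R_refl[OF proj_in[OF z]] by simp
next
  fix y y' assume "z = Inr y" "w = Inr y'"
  then have "z = w"
    using eq z w inj_onD[OF e2.inj] by simp
  then show "(proj w, proj z) \<in> R"
    using R_refl[OF proj_in[OF z]] by simp
next
  fix x y assume xy: "z = Inl x" "w = Inr y"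
  then have "x \<in> S \<and> y = \<phi> x"
    using glued_only eq z w by simp
  then have "(proj z, proj w) \<in> R"
    using R_gen xy by simp
  then show "(proj w, proj z) \<in> R"
    using equiv_R unfolding equiv_def by (auto dest: symD)
next
  fix x y assume xy: "z = Inr y" "w = Inl x"
  then have "x \<in> S \<and> y = \<phi> x"
    using glued_only[of x y] eq z w by simp
  then show "(proj w, proj z) \<in> R"
    using R_gen xy by simp
qed

lemma E_finite:
  assumes z: "z \<in> Z" and w: "w \<in> Z"
  shows "\<exists>a. E z w < ereal a"
proof -
  obtain s where s: "s \<in> S"
    using S(2) by blast
  have sZ: "Inl s \<in> Z" "Inr (\<phi> s) \<in> Z"
    using s S(1) \<phi>S by auto
  have less: "\<exists>a. E z w < ereal a" if "E z w \<le> ereal b" for z w b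
    by (rule exI[of _ "b + 1"]) (rule le_less_trans[OF that], simp)
  have to: "\<exists>a. E z (Inl s) < ereal a" if zZ: "z \<in> Z" for z
  proof (cases z)
    case (Inl x)
    then show ?thesis
      using less[OF E_side(1)[of x s]] zZ sZ by simp
  next
    case (Inr y)
    obtain a where "E z (Inr (\<phi> s)) < ereal a"
      using less[OF E_side(2)[of y "\<phi> s"]] zZ sZ Inr by auto
    moreover have "E (Inr (\<phi> s)) (Inl s) < ereal 1"
      using E_q_eq[OF sZ(2,1)] glued[OF s] by (auto intro: le_less_trans)
    ultimately show ?thesis
      using E_triangle_less sZ by blast
  qed
  have from_s: "\<exists>a. E (Inl s) z < ereal a" if zZ: "z \<in> Z" for z
  proof (cases z)
    case (Inl x)
    then show ?thesis
      using less[OF E_side(1)[of s x]] zZ sZ by simp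
  next
    case (Inr y)
    obtain a where "E (Inr (\<phi> s)) z < ereal a"
      using less[OF E_side(2)[of "\<phi> s" y]] zZ sZ Inr by auto
    moreover have "E (Inl s) (Inr (\<phi> s)) < ereal 1"
      using E_q_eq[OF sZ] glued[OF s] by (auto intro: le_less_trans)
    ultimately show ?thesis
      using E_triangle_less sZ by blast
  qed
  show ?thesis
    using to[OF z] from_s[OF w] E_triangle_less sZ(1) by blast
qed

section \<open>The quotient distance as a real pseudometric on the points of
  \<open>M\<close>\<close>

definition e :: "'a + 'b \<Rightarrow> 'a + 'b \<Rightarrow> real" where "e z w = real_of_ereal (E z w)"

lemma E_eq_e: "z \<in> Z \<Longrightarrow> w \<in> Z \<Longrightarrow> E z w = ereal (e z w)"
  unfolding e_def using E_finite[of z w] E_nonneg[of z w] by (cases "E z w") auto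

lemma e_nonneg: "z \<in> Z \<Longrightarrow> w \<in> Z \<Longrightarrow> 0 \<le> e z w"
  using E_nonneg E_eq_e by (metis ereal_less_eq(5))

lemma D_le_e: "z \<in> Z \<Longrightarrow> w \<in> Z \<Longrightarrow> D z w \<le> e z w"
  using D_le_E E_eq_e by simp

lemma e_triangle:
  assumes "x \<in> Z" "y \<in> Z" "z \<in> Z"
  shows "e x z \<le> e x y + e y z"
proof (rule field_le_epsilon)
  fix \<epsilon> :: real assume "\<epsilon> > 0"
  have "E x z < ereal ((e x y + \<epsilon> / 2) + (e y z + \<epsilon> / 2))"
    by (rule E_triangle_less[where y = y]) (use assms \<open>\<epsilon> > 0\<close> in \<open>auto simp: E_eq_e\<close>)
  then show "e x z \<le> e x y + e y z + \<epsilon>"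
    using assms by (simp add: E_eq_e)
qed

lemma e_zero: "z \<in> Z \<Longrightarrow> w \<in> Z \<Longrightarrow> q z = q w \<Longrightarrow> e z w = 0"
  using E_q_eq[of z w] E_eq_e[of z w] e_nonneg[of z w] by simp

text \<open>Symmetrizing avoids reversing chains: as \<open>D\<close> is symmetric and \<open>D \<le> e\<close>, an upper bound \<open>D\<close> for the
  mean \<open>es\<close> already gives \<open>e = D\<close>.\<close>

definition es :: "'a + 'b \<Rightarrow> 'a + 'b \<Rightarrow> real" where "es z w = (e z w + e w z) / 2"

lemma pm_es: "pseudometric_on Z es"
  unfolding pseudometric_on_def es_def
proof (intro conjI ballI)
  fix x y z assume "x \<in> Z" "y \<in> Z" "z \<in> Z"
  then show "(e x z + e z x) / 2 \<le> (e x y + e y x) / 2 + (e y z + e z y) / 2"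
    using e_triangle[of x y z] e_triangle[of z y x] by (simp add: field_simps)
qed (auto simp: e_zero e_nonneg)

lemma es_side:
  "x \<in> mspace M1 \<Longrightarrow> x' \<in> mspace M1 \<Longrightarrow> es (Inl x) (Inl x') \<le> pt_leaf_dist Q M1 x x'"
  "y \<in> mspace M2 \<Longrightarrow> y' \<in> mspace M2 \<Longrightarrow> es (Inr y) (Inr y') \<le> pt_leaf_dist Q M2 y y'"
  using E_side(1)[of x x'] E_side(1)[of x' x] E_eq_e[of "Inl x" "Inl x'"] E_eq_e[of "Inl x'" "Inl x"]
    pseudometric_onD(3)[OF pseudometric_pt_leaf_dist[OF e1.N e1.conn_N], of x x' Q]
    E_side(2)[of y y'] E_side(2)[of y' y] E_eq_e[of "Inr y" "Inr y'"] E_eq_e[of "Inr y'" "Inr y"]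
    pseudometric_onD(3)[OF pseudometric_pt_leaf_dist[OF e2.N e2.conn_N], of y y' Q]
  by (auto simp: es_def)

definition rep :: "'c \<Rightarrow> 'a + 'b" where "rep p = (SOME z. z \<in> Z \<and> q z = p)"

definition em :: "'c \<Rightarrow> 'c \<Rightarrow> real" where "em p p' = es (rep p) (rep p')"

lemma rep: "p \<in> mspace M \<Longrightarrow> rep p \<in> Z" "p \<in> mspace M \<Longrightarrow> q (rep p) = p"
proof -
  assume "p \<in> mspace M"
  then obtain z where "z \<in> Z \<and> q z = p"
    using q_image by (metis imageE)
  then have "rep p \<in> Z \<and> q (rep p) = p"
    unfolding rep_def by (rule someI)
  then show "rep p \<in> Z" "q (rep p) = p"
    by auto
qed

lemma em_q: "z \<in> Z \<Longrightarrow> w \<in> Z \<Longrightarrow> em (q z) (q w) = es z w"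
  unfolding em_def
  by (rule pseudometric_on_cong_zero[OF pm_es]) (auto simp: rep q_in es_def e_zero)

lemma pm_em: "pseudometric_on (mspace M) em"
  using pm_es rep(1) unfolding pseudometric_on_def em_def by simp

lemma em_j:
  "x \<in> mspace M1 \<Longrightarrow> x' \<in> mspace M1 \<Longrightarrow> em (j1 x) (j1 x') \<le> pt_leaf_dist Q M1 x x'"
  "y \<in> mspace M2 \<Longrightarrow> y' \<in> mspace M2 \<Longrightarrow> em (j2 y) (j2 y') \<le> pt_leaf_dist Q M2 y y'"
  using em_q[of "Inl x" "Inl x'"] em_q[of "Inr y" "Inr y'"] es_side(1)[of x x'] es_side(2)[of y y'] by auto

text \<open>The value of \<open>em\<close> does not depend on the points chosen over
  \<open>p\<close> and \<open>p'\<close>, so both may be taken in whichever piece contains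
  \<open>p'\<close> and, by the choice of the neighbourhoods, also \<open>p\<close>.\<close>

lemma em_locally_bounded: "locally_bounded_by_metric M em"
  unfolding locally_bounded_by_metric_def
proof (intro ballI allI impI)
  fix p d and \<epsilon> :: real assume p: "p \<in> mspace M" and d: "d \<in> atlas M" "p \<in> cdom d" and \<epsilon>: "0 < \<epsilon>"
  define b where "b p' = (1 + \<epsilon>) * sqrt (rmetric M d p (cmap d p' - cmap d p) (cmap d p' - cmap d p))" for p'
  obtain U1 where U1: "openin (mtop M) U1" "p \<in> U1"
    "\<And>y. y \<in> mspace M1 \<Longrightarrow> j1 y \<in> U1 \<Longrightarrow> \<exists>x\<in>mspace M1. j1 x = p \<and> pt_leaf_dist Q M1 x y \<le> b (j1 y)"
    using e1.pt_leaf_dist_near[OF p d \<epsilon>] unfolding b_def by blast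
  obtain U2 where U2: "openin (mtop M) U2" "p \<in> U2"
    "\<And>y. y \<in> mspace M2 \<Longrightarrow> j2 y \<in> U2 \<Longrightarrow> \<exists>x\<in>mspace M2. j2 x = p \<and> pt_leaf_dist Q M2 x y \<le> b (j2 y)"
    using e2.pt_leaf_dist_near[OF p d \<epsilon>] unfolding b_def by blast
  have "em p p' \<le> b p'" if p': "p' \<in> U1 \<inter> U2" for p'
  proof -
    have "p' \<in> mspace M"
      using p' openin_subset[OF U1(1)] by auto
    then consider y where "y \<in> mspace M1" "p' = j1 y" | y where "y \<in> mspace M2" "p' = j2 y"
      using cover by auto
    then show ?thesis
    proof cases
      case 1
      then obtain x where "x \<in> mspace M1" "j1 x = p" "pt_leaf_dist Q M1 x y \<le> b (j1 y)"
        using U1(3)[of y] p' by auto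
      then show ?thesis
        using em_j(1)[of x y] 1 by simp
    next
      case 2
      then obtain x where "x \<in> mspace M2" "j2 x = p" "pt_leaf_dist Q M2 x y \<le> b (j2 y)"
        using U2(3)[of y] p' by auto
      then show ?thesis
        using em_j(2)[of x y] 2 by simp
    qed
  qed
  then show "\<exists>U. openin (mtop M) U \<and> p \<in> U \<and> (\<forall>p'\<in>U. em p p' \<le>
      (1 + \<epsilon>) * sqrt (rmetric M d p (cmap d p' - cmap d p) (cmap d p' - cmap d p)))"
    using U1(1,2) U2(1,2) unfolding b_def by (intro exI[of _ "U1 \<inter> U2"]) auto
qed

lemma em_le_rdist:
  assumes "p \<in> mspace M" "p' \<in> mspace M"
  shows "em p p' \<le> rdist M p p'"
  unfolding rdist_def
proof (rule cInf_greatest)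
  show "{curve_length M \<gamma> |\<gamma>. joins M \<gamma> p p'} \<noteq> {}"
    using curve_exists[OF e1.M e1.conn_M assms] by auto
  fix l assume "l \<in> {curve_length M \<gamma> |\<gamma>. joins M \<gamma> p p'}"
  then show "em p p' \<le> l"
    using le_curve_length[OF e1.M em_locally_bounded pm_em] by auto
qed

text \<open>The connected set \<open>P\<close> may fall apart into infinitely many parts in the two
  pieces, so no chain of plaques of the pieces is extracted from it. Instead,
  \<open>em u v = 0\<close> is an equivalence relation that holds locally along
  \<open>P\<close>.\<close>

lemma em_plaque_step:
  assumes "plaque_step Q M (mspace M) p p'"
  shows "em p p' = 0"
proof -
  obtain d P where d: "d \<in> fol_atlas M" "connectedin (mtop M) P" "P \<subseteq> cdom d \<inter> mspace M"
      "p \<in> P" "p' \<in> P" "\<forall>z\<in>P. plaque_eq Q d p z"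
    using assms unfolding plaque_step_def by blast
  have PM: "z \<in> mspace M" "z \<in> cdom d" if "z \<in> P" for z
    using d(3) that by auto
  show ?thesis
  proof (rule connectedin_equivalence[OF d(2) _ _ _ d(4,5), where T = "\<lambda>u v. em u v = 0"])
    fix z assume z: "z \<in> P"
    obtain U1 where U1: "openin (mtop M) U1" "z \<in> U1"
      "\<And>y. y \<in> mspace M1 \<Longrightarrow> j1 y \<in> U1 \<Longrightarrow> \<exists>x\<in>mspace M1. j1 x = z \<and> (plaque_eq Q d z (j1 y) \<longrightarrow> pt_leaf_dist Q M1 x y = 0)"
      using e1.leaf_near[OF PM(1)[OF z] d(1) PM(2)[OF z]] by blast
    obtain U2 where U2: "openin (mtop M) U2" "z \<in> U2"
      "\<And>y. y \<in> mspace M2 \<Longrightarrow> j2 y \<in> U2 \<Longrightarrow> \<exists>x\<in>mspace M2. j2 x = z \<and> (plaque_eq Q d z (j2 y) \<longrightarrow> pt_leaf_dist Q M2 x y = 0)"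
      using e2.leaf_near[OF PM(1)[OF z] d(1) PM(2)[OF z]] by blast
    have "em z w = 0" if w: "w \<in> P \<inter> (U1 \<inter> U2)" for w
    proof -
      have eq: "plaque_eq Q d z w"
        using bspec[OF d(6) z] bspec[OF d(6), of w] w by (simp add: plaque_eq_def)
      have wM: "w \<in> mspace M"
        using PM(1) w by auto
      then consider y where "y \<in> mspace M1" "w = j1 y" | y where "y \<in> mspace M2" "w = j2 y"
        using cover by auto
      then have "em z w \<le> 0"
      proof cases
        case 1
        then obtain x where "x \<in> mspace M1" "j1 x = z" "pt_leaf_dist Q M1 x y = 0"
          using U1(3)[of y] w eq by auto
        then show ?thesis
          using em_j(1)[of x y] 1 by simp
      next
        case 2
        then obtain x where "x \<in> mspace M2" "j2 x = z" "pt_leaf_dist Q M2 x y = 0"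
          using U2(3)[of y] w eq by auto
        then show ?thesis
          using em_j(2)[of x y] 2 by simp
      qed
      then show ?thesis
        using pseudometric_onD(2)[OF pm_em PM(1)[OF z] wM] by simp
    qed
    then show "\<exists>B. openin (mtop M) B \<and> z \<in> B \<and> (\<forall>w\<in>P \<inter> B. em z w = 0)"
      using U1(1,2) U2(1,2) by (intro exI[of _ "U1 \<inter> U2"]) auto
  next
    fix u v assume "u \<in> P" "v \<in> P" "em u v = 0"
    then show "em v u = 0"
      using pseudometric_onD(3)[OF pm_em PM(1) PM(1), of u v] by simp
  next
    fix u v w assume uvw: "u \<in> P" "v \<in> P" "w \<in> P" and z: "em u v = 0" "em v w = 0"
    show "em u w = 0"
      using pseudometric_onD(4)[OF pm_em uvw[THEN PM(1)]] pseudometric_onD(2)[OF pm_em PM(1)[OF uvw(1)] PM(1)[OF uvw(3)]] z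
      by simp
  qed
qed

lemma em_leaf:
  assumes "p \<in> mspace M" "p' \<in> leaf Q M (mspace M) p"
  shows "em p p' = 0"
proof -
  have "(plaque_step Q M (mspace M))\<^sup>*\<^sup>* p p'"
    using assms(2) unfolding leaf_def by simp
  then show ?thesis
  proof (induction rule: rtranclp_induct)
    case base
    then show ?case
      by (rule pseudometric_onD(1)[OF pm_em assms(1)])
  next
    case (step u v)
    have uv: "u \<in> mspace M" "v \<in> mspace M"
      using plaque_step_in[OF step(2)] by auto
    show ?case
      using pseudometric_onD(4)[OF pm_em assms(1) uv] pseudometric_onD(2)[OF pm_em assms(1) uv(2)]
        step(3) em_plaque_step[OF step(2)] by simp
  qed
qed

lemma E_eq_D:
  assumes z: "z \<in> Z" and w: "w \<in> Z"
  shows "E z w = ereal (D z w)"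
proof -
  have "es z w \<le> D z w"
    using le_pt_leaf_dist[OF e1.M e1.conn_M pm_em em_le_rdist em_leaf q_in[OF z] q_in[OF w]]
    unfolding em_q[OF z w] D_def .
  moreover have "D z w \<le> e z w" "D w z \<le> e w z" "D z w = D w z"
    using D_le_e[OF z w] D_le_e[OF w z] pseudometric_onD(3)[OF pm_D z w] by auto
  ultimately have "e z w = D z w"
    unfolding es_def by simp
  then show ?thesis
    using E_eq_e[OF z w] by simp
qed

theorem HLS_isometric:
  "isometric_spaces (HLS Q M) (\<lambda>x y. ereal (HLS_dist Q M x y)) (quotient_space Y dY R) (quotient_dist Y dY R)"
  unfolding HLS_def[of Q M] HLS_dist_def[of Q M] quotient_space_def quotient_dist_def
proof (rule quotient_isometry)
  show "(\<lambda>z. leaf Q M (mspace M) (q z)) ` Z = leaves Q M"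
    unfolding leaves_def q_image[symmetric] by (simp add: image_image)
  show "proj ` Z = Y"
    by (rule proj_image)
  show "pseudometric_on (leaves Q M) (leaf_dist Q M)"
    by (rule pseudometric_leaf_dist[OF e1.M e1.conn_M])
  show "chain_dist Y dY R (proj z) (proj w) =
      ereal (leaf_dist Q M (leaf Q M (mspace M) (q z)) (leaf Q M (mspace M) (q w)))" if "z \<in> Z" "w \<in> Z" for z w
    using E_eq_D[OF that] unfolding E_def D_def pt_leaf_dist_def .
qed

end

lemma
  assumes SX: "S \<subseteq> topspace X" and \<phi>S: "\<phi> ` S \<subseteq> topspace Y" and inj: "inj_on \<phi> S"
  shows glue_class_glued: "x \<in> S \<Longrightarrow> glue_class X Y S \<phi> (Inl x) = glue_class X Y S \<phi> (Inr (\<phi> x))"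
    and inj_on_glue_class_Inl: "inj_on (\<lambda>x. glue_class X Y S \<phi> (Inl x)) (topspace X)"
    and inj_on_glue_class_Inr: "inj_on (\<lambda>y. glue_class X Y S \<phi> (Inr y)) (topspace Y)"
    and glue_class_Inl_eq_Inr: "\<lbrakk>x \<in> topspace X; y \<in> topspace Y; glue_class X Y S \<phi> (Inl x) = glue_class X Y S \<phi> (Inr y)\<rbrakk> \<Longrightarrow> x \<in> S \<and> y = \<phi> x"
proof -
  let ?Z = "topspace X <+> topspace Y"
  let ?r = "{(Inl x, Inr (\<phi> x)) | x. x \<in> S}"
  have r: "?r \<subseteq> ?Z \<times> ?Z"
    using SX \<phi>S by auto
  note eq = equiv_least_equiv[OF r]
  \<comment> \<open>A normal form that moves glued points to the second summand. Equality of normal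
    forms is an equivalence relation containing the generating pairs, hence it contains the least
    one, and all identifications can be read off from it.\<close>
  define \<kappa> :: "'a + 'b \<Rightarrow> 'a + 'b" where "\<kappa> z = (case z of Inl x \<Rightarrow> if x \<in> S then Inr (\<phi> x) else Inl x | Inr y \<Rightarrow> Inr y)" for z
  have "equiv ?Z {(z, w). z \<in> ?Z \<and> w \<in> ?Z \<and> \<kappa> z = \<kappa> w}"
    by (rule equivI) (auto intro!: refl_onI symI transI)
  moreover have "?r \<subseteq> {(z, w). z \<in> ?Z \<and> w \<in> ?Z \<and> \<kappa> z = \<kappa> w}"
    using r by (auto simp: \<kappa>_def)
  ultimately have sub: "least_equiv ?Z ?r \<subseteq> {(z, w). z \<in> ?Z \<and> w \<in> ?Z \<and> \<kappa> z = \<kappa> w}"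
    by (rule least_equiv_minimal)
  have \<kappa>: "\<kappa> z = \<kappa> w" if "z \<in> ?Z" "w \<in> ?Z" "glue_class X Y S \<phi> z = glue_class X Y S \<phi> w" for z w
  proof -
    have "(z, w) \<in> least_equiv ?Z ?r"
      using eq_equiv_class[OF _ eq that(2)] that(3) unfolding glue_class_def by blast
    then show ?thesis
      using sub by auto
  qed
  show "glue_class X Y S \<phi> (Inl x) = glue_class X Y S \<phi> (Inr (\<phi> x))" if "x \<in> S"
    unfolding glue_class_def by (rule equiv_class_eq[OF eq]) (use subset_least_equiv that in fastforce)
  show "inj_on (\<lambda>x. glue_class X Y S \<phi> (Inl x)) (topspace X)"
  proof (rule inj_onI)
    fix x x' assume "x \<in> topspace X" "x' \<in> topspace X" "glue_class X Y S \<phi> (Inl x) = glue_class X Y S \<phi> (Inl x')"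
    then have "\<kappa> (Inl x) = \<kappa> (Inl x')"
      by (intro \<kappa>) auto
    then show "x = x'"
      using inj by (auto simp: \<kappa>_def split: if_splits dest: inj_onD)
  qed
  show "inj_on (\<lambda>y. glue_class X Y S \<phi> (Inr y)) (topspace Y)"
  proof (rule inj_onI)
    fix y y' assume "y \<in> topspace Y" "y' \<in> topspace Y" "glue_class X Y S \<phi> (Inr y) = glue_class X Y S \<phi> (Inr y')"
    then have "\<kappa> (Inr y) = \<kappa> (Inr y')"
      by (intro \<kappa>) auto
    then show "y = y'"
      by (simp add: \<kappa>_def)
  qed
  show "x \<in> S \<and> y = \<phi> x" if "x \<in> topspace X" "y \<in> topspace Y" "glue_class X Y S \<phi> (Inl x) = glue_class X Y S \<phi> (Inr y)"
  proof -
    have "\<kappa> (Inl x) = \<kappa> (Inr y)"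
      using that by (intro \<kappa>) auto
    then show ?thesis
      by (auto simp: \<kappa>_def split: if_splits)
  qed
qed

lemma boundary_components_union_subset: "boundary_components_union M S \<Longrightarrow> S \<subseteq> mspace M"
  unfolding boundary_components_union_def using connected_components_of_subset by fastforce

theorem theorem4p2:
  fixes M1 :: "('a, 'n::finite) fol_mfd" and M2 :: "('b, 'n) fol_mfd"
    and M :: "(('a + 'b) set, 'n) fol_mfd"
    and Q :: "'n set" and S1 :: "'a set" and S2 :: "'b set" and \<phi> :: "'a \<Rightarrow> 'b"
  assumes "riemannian_manifold M1" and "riemannian_manifold M2"
    and "smooth_foliation Q M1" and "smooth_foliation Q M2"
    and "compact_space (mtop M1)" and "compact_space (mtop M2)"
    and "connected_space (mtop M1)" and "connected_space (mtop M2)"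
    and "mboundary M1 \<noteq> {}" and "mboundary M2 \<noteq> {}"
    and "boundary_components_union M1 S1" and "boundary_components_union M2 S2"
    and "S1 \<noteq> {}" and "S2 \<noteq> {}"
    and "orthogonal_to_boundary Q M1 S1" and "orthogonal_to_boundary Q M2 S2"
    and "boundary_isometry M1 S1 M2 S2 \<phi>"
    and "\<And>x. x \<in> S1 \<Longrightarrow> \<phi> ` leaf Q M1 S1 x = leaf Q M2 S2 (\<phi> x)"
    and "glued_manifold Q M1 M2 S1 \<phi> M"
  shows "isometric_spaces
     (HLS Q M) (\<lambda>x y. ereal (HLS_dist Q M x y))
     (quotient_space (HLS Q M1 <+> HLS Q M2) (sum_dist (HLS_dist Q M1) (HLS_dist Q M2))
        (HLS_glue_rel Q M1 M2 S1 \<phi>))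
     (quotient_dist (HLS Q M1 <+> HLS Q M2) (sum_dist (HLS_dist Q M1) (HLS_dist Q M2))
        (HLS_glue_rel Q M1 M2 S1 \<phi>))"
proof -
  define j1 where "j1 x = glue_class (mtop M1) (mtop M2) S1 \<phi> (Inl x)" for x
  define j2 where "j2 y = glue_class (mtop M1) (mtop M2) S1 \<phi> (Inr y)" for y
  have gl: "quotient_map (plus_topology (mtop M1) (mtop M2)) (mtop M) (glue_class (mtop M1) (mtop M2) S1 \<phi>)"
    "riemannian_manifold M" "foliation Q M" "restricts_to Q M M1 j1" "restricts_to Q M M2 j2"
    using assms(19) unfolding glued_manifold_def j1_def[abs_def] j2_def[abs_def] by auto
  have S1: "S1 \<subseteq> mspace M1" and S2: "S2 \<subseteq> mspace M2"
    using assms(11,12) by (auto dest: boundary_components_union_subset)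
  have \<phi>: "\<phi> ` S1 \<subseteq> mspace M2" "inj_on \<phi> S1"
    using assms(17) S2 unfolding boundary_isometry_def bij_betw_def by auto
  have cover: "mspace M = j1 ` mspace M1 \<union> j2 ` mspace M2"
  proof -
    have "mspace M = glue_class (mtop M1) (mtop M2) S1 \<phi> ` (mspace M1 <+> mspace M2)"
      using quotient_imp_surjective_map[OF gl(1)] by (simp add: topspace_plus_topology)
    then show ?thesis
      unfolding j1_def j2_def Plus_def by (simp add: image_Un image_image)
  qed
  have smooth: "smooth_map M1 (mspace M1) M j1" "smooth_map M2 (mspace M2) M j2"
    using gl(4,5) unfolding restricts_to_def by auto
  note cont = smooth[THEN smooth_map_continuous]
  have glued: "j1 x = j2 (\<phi> x)" if "x \<in> S1" for x
    unfolding j1_def j2_def by (rule glue_class_glued[OF S1 \<phi> that])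
  \<comment> \<open>The images of the two pieces are connected and share the image of a point of
    \<open>S1\<close>.\<close>
  have conn: "connected_space (mtop M)"
  proof -
    obtain s where "s \<in> S1"
      using assms(13) by blast
    then have "j1 s \<in> j1 ` mspace M1 \<inter> j2 ` mspace M2"
      using S1 \<phi>(1) glued by blast
    then have "connectedin (mtop M) (j1 ` mspace M1 \<union> j2 ` mspace M2)"
      using assms(7,8) by (intro connectedin_Un connectedin_continuous_map_image[OF cont(1)]
        connectedin_continuous_map_image[OF cont(2)]) (auto simp: connectedin_topspace)
    then show ?thesis
      by (simp add: cover[symmetric] connectedin_topspace)
  qed
  \<comment> \<open>Compactness of the pieces enters here: a continuous map from a compact space
    into a Hausdorff space is closed.\<close>
  note closed = continuous_imp_closed_map[OF cont(1) assms(5) riemannian_manifoldD(8)[OF gl(2)]]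
    continuous_imp_closed_map[OF cont(2) assms(6) riemannian_manifoldD(8)[OF gl(2)]]
  have inj: "inj_on j1 (mspace M1)" "inj_on j2 (mspace M2)"
    unfolding j1_def[abs_def] j2_def[abs_def] by (rule inj_on_glue_class_Inl[OF S1 \<phi>], rule inj_on_glue_class_Inr[OF S1 \<phi>])
  have fol: "foliation Q M1" "foliation Q M2"
    using assms(3,4) unfolding smooth_foliation_def by auto
  interpret glued_pair Q M1 M2 M j1 j2 S1 \<phi>
  proof
    show "x \<in> S1 \<and> y = \<phi> x" if "x \<in> mspace M1" "y \<in> mspace M2" "j1 x = j2 y" for x y
      using glue_class_Inl_eq_Inr[OF S1 \<phi> that(1,2)] that(3) unfolding j1_def j2_def by simp
  qed (use assms(1,2,5-8,13) gl conn fol closed inj cover S1 \<phi>(1) glued in auto)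
  show ?thesis
    by (rule HLS_isometric)
qed

end
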